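(* Let $G$ be a finite group, and let $\mathrm{V}(\mathbb{Z}G)$ denote the group of units of augmentation one in the integral group ring $\mathbb{Z}G$. Suppose that $\mathrm{V}(\mathbb{Z}G)$ has a noncyclic abelian subgroup of order $p^{2}$, for some odd prime $p$. Then $G$ has a noncyclic abelian subgroup of order $p^{2}$ (i.e., the Sylow $p$-subgroups of $G$ are not cyclic).
   Context: For a finite group $G$, the augmentation of an element $\sum_{g\in G}a_g g$ of $\mathbb{Z}G$ (with all $a_g\in\mathbb{Z}$) is the integer $\sum_{g\in G}a_g$. $\mathrm{V}(\mathbb{Z}G)$ is the group of those units of $\mathbb{Z}G$ whose augmentation is $1$. *)

theory Defs
  imports "HOL-Algebra.Algebra"
begin

text \<open>The elements of the integral group ring are the finitely supported functions from the group
  to the integers, as for \<^const>\<open>free_Abelian_group\<close>; \<^term>\<open>frag_of g\<close> is the basis element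
  belonging to \<open>g\<close>.  The product is the biadditive extension of the product of the group.\<close>

definition integral_group_ring :: "('a, 'b) monoid_scheme \<Rightarrow> ('a \<Rightarrow>\<^sub>0 int) ring" where
  "integral_group_ring G =
    \<lparr>carrier = {x. Poly_Mapping.keys x \<subseteq> carrier G},
     monoid.mult = (\<lambda>x y. frag_extend (\<lambda>g. frag_extend (\<lambda>h. frag_of (g \<otimes>\<^bsub>G\<^esub> h)) y) x),
     monoid.one = frag_of \<one>\<^bsub>G\<^esub>,
     ring.zero = 0,
     ring.add = (+)\<rparr>"

definition augmentation :: "('a, 'b) monoid_scheme \<Rightarrow> ('a \<Rightarrow>\<^sub>0 int) \<Rightarrow> int" where
  "augmentation G x = (\<Sum>g\<in>carrier G. Poly_Mapping.lookup x g)"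

definition normalized_units :: "('a, 'b) monoid_scheme \<Rightarrow> ('a \<Rightarrow>\<^sub>0 int) monoid" where
  "normalized_units G = (units_of (integral_group_ring G))
    \<lparr>carrier := {u \<in> Units (integral_group_ring G). augmentation G u = 1}\<rparr>"

definition noncyclic_abelian_subgroup :: "'a set \<Rightarrow> ('a, 'b) monoid_scheme \<Rightarrow> bool" where
  "noncyclic_abelian_subgroup H G \<longleftrightarrow>
    subgroup H G \<and> comm_group (G\<lparr>carrier := H\<rparr>) \<and> \<not> cyclic_group (G\<lparr>carrier := H\<rparr>)"

definition sylow_subgroup :: "nat \<Rightarrow> 'a set \<Rightarrow> ('a, 'b) monoid_scheme \<Rightarrow> bool" where
  "sylow_subgroup p P G \<longleftrightarrow> subgroup P G \<and> card P = p ^ multiplicity p (order G)"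

lemma integral_group_ring_simps [simp]:
  "x \<in> carrier (integral_group_ring G) \<longleftrightarrow> Poly_Mapping.keys x \<subseteq> carrier G"
  "\<one>\<^bsub>integral_group_ring G\<^esub> = frag_of \<one>\<^bsub>G\<^esub>"
  "\<zero>\<^bsub>integral_group_ring G\<^esub> = 0"
  "x \<oplus>\<^bsub>integral_group_ring G\<^esub> y = x + y"
  by (simp_all add: integral_group_ring_def)

lemma integral_group_ring_mult:
  "x \<otimes>\<^bsub>integral_group_ring G\<^esub> y
    = frag_extend (\<lambda>g. frag_extend (\<lambda>h. frag_of (g \<otimes>\<^bsub>G\<^esub> h)) y) x"
  by (simp add: integral_group_ring_def)

lemma integral_group_ring_mult_frag_of [simp]:
  "frag_of g \<otimes>\<^bsub>integral_group_ring G\<^esub> frag_of h = frag_of (g \<otimes>\<^bsub>G\<^esub> h)"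
  by (simp add: integral_group_ring_mult)

lemma frag_extend_fun_add:
  "frag_extend (\<lambda>g. f g + f' g) x = frag_extend f x + frag_extend f' x"
  by (simp add: frag_extend_def frag_cmul_distrib2 sum.distrib)

lemma frag_extend_fun_diff:
  "frag_extend (\<lambda>g. f g - f' g) x = frag_extend f x - frag_extend f' x"
  using frag_extend_fun_add[of "\<lambda>g. f g - f' g" f' x] by simp

lemma integral_group_ring_mult_add:
  "(x + x') \<otimes>\<^bsub>integral_group_ring G\<^esub> y
    = x \<otimes>\<^bsub>integral_group_ring G\<^esub> y + x' \<otimes>\<^bsub>integral_group_ring G\<^esub> y"
  "x \<otimes>\<^bsub>integral_group_ring G\<^esub> (y + y')
    = x \<otimes>\<^bsub>integral_group_ring G\<^esub> y + x \<otimes>\<^bsub>integral_group_ring G\<^esub> y'"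
  by (simp_all add: integral_group_ring_mult frag_extend_add frag_extend_fun_add)

lemma integral_group_ring_mult_diff:
  "(x - x') \<otimes>\<^bsub>integral_group_ring G\<^esub> y
    = x \<otimes>\<^bsub>integral_group_ring G\<^esub> y - x' \<otimes>\<^bsub>integral_group_ring G\<^esub> y"
  "x \<otimes>\<^bsub>integral_group_ring G\<^esub> (y - y')
    = x \<otimes>\<^bsub>integral_group_ring G\<^esub> y - x \<otimes>\<^bsub>integral_group_ring G\<^esub> y'"
  by (simp_all add: integral_group_ring_mult frag_extend_diff frag_extend_fun_diff)

lemma integral_group_ring_mult_0 [simp]:
  "0 \<otimes>\<^bsub>integral_group_ring G\<^esub> y = 0" "x \<otimes>\<^bsub>integral_group_ring G\<^esub> 0 = 0"
  by (simp_all add: integral_group_ring_mult frag_extend_eq_0)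

lemma (in group) keys_integral_group_ring_mult:
  assumes "Poly_Mapping.keys x \<subseteq> carrier G" "Poly_Mapping.keys y \<subseteq> carrier G"
  shows "Poly_Mapping.keys (x \<otimes>\<^bsub>integral_group_ring G\<^esub> y) \<subseteq> carrier G"
proof -
  have "Poly_Mapping.keys (x \<otimes>\<^bsub>integral_group_ring G\<^esub> y)
      \<subseteq> (\<Union>g\<in>Poly_Mapping.keys x. \<Union>h\<in>Poly_Mapping.keys y. Poly_Mapping.keys (frag_of (g \<otimes> h)))"
    unfolding integral_group_ring_mult
    by (rule order.trans[OF keys_frag_extend]) (intro UN_mono order.refl keys_frag_extend)
  also have "\<dots> \<subseteq> carrier G"
    using assms by auto
  finally show ?thesis .
qed

lemma (in group) integral_group_ring_assoc:
  assumes "Poly_Mapping.keys x \<subseteq> carrier G" "Poly_Mapping.keys y \<subseteq> carrier G"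
    "Poly_Mapping.keys z \<subseteq> carrier G"
  shows "x \<otimes>\<^bsub>integral_group_ring G\<^esub> y \<otimes>\<^bsub>integral_group_ring G\<^esub> z
    = x \<otimes>\<^bsub>integral_group_ring G\<^esub> (y \<otimes>\<^bsub>integral_group_ring G\<^esub> z)"
  using assms(1)
proof (induction x rule: free_Abelian_group_induct [consumes 1, case_names zero diff basis])
  case (basis a)
  show ?case
    using assms(2)
  proof (induction y rule: free_Abelian_group_induct [consumes 1, case_names zero diff basis])
    case (basis b)
    show ?case
      using assms(3)
      by (induction z rule: free_Abelian_group_induct [consumes 1, case_names zero diff basis])
        (simp_all add: integral_group_ring_mult_diff m_assoc \<open>a \<in> carrier G\<close> \<open>b \<in> carrier G\<close>)
  qed (simp_all add: integral_group_ring_mult_diff)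
qed (simp_all add: integral_group_ring_mult_diff)

lemma (in group) integral_group_ring_one:
  assumes "Poly_Mapping.keys x \<subseteq> carrier G"
  shows integral_group_ring_l_one: "frag_of \<one> \<otimes>\<^bsub>integral_group_ring G\<^esub> x = x"
    and integral_group_ring_r_one: "x \<otimes>\<^bsub>integral_group_ring G\<^esub> frag_of \<one> = x"
proof -
  show "frag_of \<one> \<otimes>\<^bsub>integral_group_ring G\<^esub> x = x"
    using assms
    by (induction x rule: free_Abelian_group_induct [consumes 1, case_names zero diff basis])
      (simp_all add: integral_group_ring_mult_diff)
  show "x \<otimes>\<^bsub>integral_group_ring G\<^esub> frag_of \<one> = x"
    using assms
    by (induction x rule: free_Abelian_group_induct [consumes 1, case_names zero diff basis])
      (simp_all add: integral_group_ring_mult_diff)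
qed

lemma (in group) ring_integral_group_ring: "ring (integral_group_ring G)"
proof (rule ringI)
  show "abelian_group (integral_group_ring G)"
  proof (rule abelian_groupI)
    fix x y assume "x \<in> carrier (integral_group_ring G)" "y \<in> carrier (integral_group_ring G)"
    then show "x \<oplus>\<^bsub>integral_group_ring G\<^esub> y \<in> carrier (integral_group_ring G)"
      using keys_add[of x y] by auto
  next
    fix x assume "x \<in> carrier (integral_group_ring G)"
    then show "\<exists>y\<in>carrier (integral_group_ring G).
        y \<oplus>\<^bsub>integral_group_ring G\<^esub> x = \<zero>\<^bsub>integral_group_ring G\<^esub>"
      by (intro bexI[of _ "- x"]) simp_all
  qed (simp_all add: ac_simps)
  show "monoid (integral_group_ring G)"
    by (rule monoidI) (simp_all add: keys_integral_group_ring_mult integral_group_ring_assoc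
        integral_group_ring_one)
qed (simp_all add: integral_group_ring_mult_add)

lemma augmentation_diff: "augmentation G (x - y) = augmentation G x - augmentation G y"
  by (simp add: augmentation_def lookup_minus sum_subtractf)

lemma augmentation_0 [simp]: "augmentation G 0 = 0"
  by (simp add: augmentation_def)

lemma augmentation_frag_of:
  "finite (carrier G) \<Longrightarrow> g \<in> carrier G \<Longrightarrow> augmentation G (frag_of g) = 1"
  by (simp add: augmentation_def)

lemma (in group) augmentation_mult:
  assumes "finite (carrier G)"
    and "Poly_Mapping.keys x \<subseteq> carrier G" "Poly_Mapping.keys y \<subseteq> carrier G"
  shows "augmentation G (x \<otimes>\<^bsub>integral_group_ring G\<^esub> y) = augmentation G x * augmentation G y"
  using assms(2)
proof (induction x rule: free_Abelian_group_induct [consumes 1, case_names zero diff basis])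
  case (basis a)
  show ?case
    using assms(3)
    by (induction y rule: free_Abelian_group_induct [consumes 1, case_names zero diff basis])
      (simp_all add: integral_group_ring_mult_diff augmentation_diff augmentation_frag_of
        right_diff_distrib assms(1) \<open>a \<in> carrier G\<close>)
qed (simp_all add: integral_group_ring_mult_diff augmentation_diff left_diff_distrib)

lemma (in group) group_normalized_units:
  assumes "finite (carrier G)"
  shows "group (normalized_units G)"
proof -
  interpret R: ring "integral_group_ring G"
    by (rule ring_integral_group_ring)
  interpret U: group "units_of (integral_group_ring G)"
    by (rule R.units_group)
  have closed: "Poly_Mapping.keys u \<subseteq> carrier G" if "u \<in> Units (integral_group_ring G)" for u
    using R.Units_closed[OF that] by simp
  have "subgroup {u \<in> Units (integral_group_ring G). augmentation G u = 1}
      (units_of (integral_group_ring G))"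
  proof (rule U.subgroupI)
    show "{u \<in> Units (integral_group_ring G). augmentation G u = 1} \<noteq> {}"
      using R.Units_one_closed augmentation_frag_of[OF assms one_closed] by auto
  next
    fix u assume u: "u \<in> {u \<in> Units (integral_group_ring G). augmentation G u = 1}"
    let ?v = "inv\<^bsub>integral_group_ring G\<^esub> u"
    have v: "?v \<in> Units (integral_group_ring G)"
      using u by simp
    have "augmentation G u * augmentation G ?v = augmentation G (frag_of \<one>)"
      using u v R.Units_r_inv[of u] augmentation_mult[OF assms closed closed, of u ?v] by simp
    then show "inv\<^bsub>units_of (integral_group_ring G)\<^esub> u
        \<in> {u \<in> Units (integral_group_ring G). augmentation G u = 1}"
      using u v by (simp add: R.units_of_inv augmentation_frag_of assms)
  qed (auto simp: units_of_carrier units_of_mult augmentation_mult assms closed)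
  then show ?thesis
    unfolding normalized_units_def by (rule U.subgroup_imp_group)
qed

lemma (in group) lookup_integral_group_ring_mult:
  assumes "finite (carrier G)"
    and "Poly_Mapping.keys x \<subseteq> carrier G" "Poly_Mapping.keys y \<subseteq> carrier G"
    and "k \<in> carrier G"
  shows "Poly_Mapping.lookup (x \<otimes>\<^bsub>integral_group_ring G\<^esub> y) k
    = (\<Sum>g\<in>carrier G. Poly_Mapping.lookup x g * Poly_Mapping.lookup y (inv g \<otimes> k))"
  using assms(2)
proof (induction x rule: free_Abelian_group_induct [consumes 1, case_names zero diff basis])
  case (basis a)
  have "Poly_Mapping.lookup (frag_of a \<otimes>\<^bsub>integral_group_ring G\<^esub> y) k
      = Poly_Mapping.lookup y (inv a \<otimes> k)"
    using assms(3)
  proof (induction y rule: free_Abelian_group_induct [consumes 1, case_names zero diff basis])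
    case (basis b)
    have "k = a \<otimes> b \<longleftrightarrow> inv a \<otimes> k = b"
      using inv_solve_left'[of b a k] \<open>a \<in> carrier G\<close> basis assms(4) by (metis inv_solve_left)
    then show ?case
      by simp
  qed (simp_all add: integral_group_ring_mult_diff lookup_minus)
  also have "\<dots> = (\<Sum>g\<in>carrier G. Poly_Mapping.lookup (frag_of a) g
      * Poly_Mapping.lookup y (inv g \<otimes> k))"
    using assms(1) \<open>a \<in> carrier G\<close> by (simp add: if_distrib[of "\<lambda>c. c * _"] cong: if_cong)
  finally show ?case .
qed (simp_all add: integral_group_ring_mult_diff lookup_minus left_diff_distrib sum_subtractf)

end

theory Submission
  imports Defs "Jordan_Normal_Form.Jordan_Normal_Form_Existence" "HOL-Number_Theory.Residues"
begin

text \<open>Let \<open>H\<close> be a noncyclic abelian group of order \<open>p\<^sup>2\<close> of units of augmentation \<open>1\<close>.  If \<open>p\<close> is odd, a \<open>p\<close>-group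
  without noncyclic abelian subgroups of order \<open>p\<^sup>2\<close> is cyclic (\<open>p_group_cyclic_if_no_noncyclic_abelian_subgroup\<close>), so it suffices to
  show that a Sylow \<open>p\<close>-subgroup of \<open>G\<close> cannot be generated by one element \<open>z\<close>, of order \<open>p ^ n\<close> say.

  The idempotent \<open>e = 1/p\<^sup>2 \<Sum>\<^bsub>u \<in> H\<^esub> u\<close> has an integral trace, its rank, in every representation of \<open>G\<close>.  Take the \<open>p\<close>
  representations induced from the characters \<open>z \<mapsto> \<zeta> ^ j\<close> of \<open>\<langle>z\<rangle>\<close> with \<open>0 \<le> j < p\<close>, where \<open>\<zeta>\<close> is a primitive root of unity of order
  \<open>p ^ n\<close>.  The traces of a unit \<open>u\<close> are combinations of the sums \<open>\<Sum>\<^bsub>g \<in> G\<^esub> u(g b g\<inverse>)\<close> for \<open>b\<close> in \<open>\<langle>z\<rangle>\<close>.  For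
  \<open>b = 1\<close> such a sum vanishes unless \<open>u = 1\<close>, by the theorem of Berman and Higman
  (\<open>torsion_unit_coefficient_one_eq_0\<close>).  It vanishes if the order of \<open>b\<close> does not divide the order of \<open>u\<close>, by a
  theorem of Hertweck (\<open>torsion_sum_conjugates_eq_0\<close>).  The remaining \<open>b\<close> have order \<open>p\<close>, and for these the sum of the
  \<open>p\<close> characters is zero.  Thus the sum of the \<open>p\<close> traces of \<open>e\<close> is \<open>|G : \<langle>z\<rangle>| / p\<close>, which is not an integer if \<open>\<langle>z\<rangle>\<close> is a
  Sylow subgroup (\<open>elementary_abelian_units_imp_prime_dvd_index\<close>).

  Hertweck's theorem is a statement about the integrality of \<open>u\<close>.  If it is applicable, there are a prime \<open>l\<close> and a
  multiple \<open>Q\<close> of the order of \<open>u\<close> such that \<open>b ^ Q\<close> has order \<open>l\<close>.  The map \<open>v \<mapsto> u v b\<inverse>\<close> is then given by an integer matrix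
  \<open>F(y)\<close>, polynomial in the action \<open>y\<close> of \<open>b ^ - Q\<close>, with \<open>F(y) ^ Q = y\<close> whenever \<open>y ^ l = 1\<close>.  An eigenvalue \<open>\<alpha>\<close> of multiplicity
  \<open>\<mu>\<close> at \<open>y\<^sub>0\<close> forces \<open>(y\<^sub>1 - y\<^sub>0) ^ \<mu>\<close> to divide \<open>det (F(y\<^sub>1) - \<alpha>)\<close> in a ring of algebraic integers
  (\<open>multiplicity_power_dvd_det\<close>), while the determinant is a product of differences of roots of unity.  Comparing powers of the
  primes above \<open>l\<close> shows that the multiplicity of \<open>\<alpha>\<close> does not change if \<open>\<alpha>\<close> is multiplied by roots of unity of order \<open>l ^ Suc e\<close>,
  where \<open>l ^ e\<close> is the \<open>l\<close>-part of \<open>Q\<close>, so that the eigenvalues cancel in the trace (\<open>trace_constant_term_eq_0\<close>).\<close>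

section \<open>Roots of scalar matrices\<close>

abbreviation diagonal :: "nat \<Rightarrow> (nat \<Rightarrow> 'a::zero) \<Rightarrow> 'a mat" where
  "diagonal n d \<equiv> mat n n (\<lambda>(i, j). if i = j then d i else 0)"

lemma diagonal_mult:
  fixes B :: "'a::comm_ring_1 mat"
  assumes "B \<in> carrier_mat n m" "i < n" "j < m"
  shows "(diagonal n d * B) $$ (i, j) = d i * B $$ (i, j)"
proof -
  have "(diagonal n d * B) $$ (i, j) = (\<Sum>k\<in>{0..<n}. (if i = k then d i else 0) * B $$ (k, j))"
    using assms by (simp add: scalar_prod_def)
  also have "\<dots> = (\<Sum>k\<in>{0..<n}. if k = i then d i * B $$ (i, j) else 0)"
    by (intro sum.cong) auto
  finally show ?thesis using assms by simp
qed

lemma jordan_block_power_scalar_imp_dim_1: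
  fixes a :: complex
  assumes "jordan_block n a ^\<^sub>m Q = c \<cdot>\<^sub>m 1\<^sub>m n" and "Q > 0" "c \<noteq> 0" "n > 0"
  shows "n = 1"
proof (rule ccontr)
  assume "n \<noteq> 1"
  hence n: "1 < n" using assms by simp
  have e: "(jordan_block n a ^\<^sub>m Q) $$ (i, j) = (if i = j then c else 0)" if "i < n" "j < n" for i j
    using that by (simp add: assms(1))
  have "a ^ Q = c"
    using e[of 0 0] n by (simp add: jordan_block_pow)
  hence "a \<noteq> 0" using assms by (auto simp: power_0_left)
  moreover have "of_nat Q * a ^ (Q - 1) = 0"
    using e[of 0 1] n by (simp add: jordan_block_pow)
  ultimately show False using assms by simp
qed

lemma diag_block_mat_Cons_eq_scalar:
  fixes A :: "complex mat"
  assumes "diag_block_mat (A # As) = c \<cdot>\<^sub>m 1\<^sub>m N"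
    and A: "A \<in> carrier_mat n n" and As: "diag_block_mat As \<in> carrier_mat m m"
  shows "A = c \<cdot>\<^sub>m 1\<^sub>m n" "diag_block_mat As = c \<cdot>\<^sub>m 1\<^sub>m m"
proof -
  let ?D = "diag_block_mat As"
  have eq: "four_block_mat A (0\<^sub>m n m) (0\<^sub>m m n) ?D = c \<cdot>\<^sub>m 1\<^sub>m N"
    using assms by (simp add: Let_def)
  have N: "N = n + m"
    using arg_cong[OF eq, of dim_row] A As by simp
  have e: "four_block_mat A (0\<^sub>m n m) (0\<^sub>m m n) ?D $$ (i, j) = (if i = j then c else 0)"
    if "i < n + m" "j < n + m" for i j
    using that by (simp add: eq N)
  show "A = c \<cdot>\<^sub>m 1\<^sub>m n"
  proof (rule eq_matI)
    fix i j assume "i < dim_row (c \<cdot>\<^sub>m 1\<^sub>m n :: complex mat)" "j < dim_col (c \<cdot>\<^sub>m 1\<^sub>m n :: complex mat)"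
    thus "A $$ (i, j) = (c \<cdot>\<^sub>m 1\<^sub>m n) $$ (i, j)"
      using e[of i j] A As by simp
  qed (use A in auto)
  show "?D = c \<cdot>\<^sub>m 1\<^sub>m m"
  proof (rule eq_matI)
    fix i j assume "i < dim_row (c \<cdot>\<^sub>m 1\<^sub>m m :: complex mat)" "j < dim_col (c \<cdot>\<^sub>m 1\<^sub>m m :: complex mat)"
    thus "?D $$ (i, j) = (c \<cdot>\<^sub>m 1\<^sub>m m) $$ (i, j)"
      using e[of "n + i" "n + j"] A As by simp
  qed (use As in auto)
qed

lemma jordan_matrix_power_scalar_imp_diagonal:
  fixes c :: complex
  assumes "jordan_matrix n_as ^\<^sub>m Q = c \<cdot>\<^sub>m 1\<^sub>m N" and "Q > 0" "c \<noteq> 0" "0 \<notin> fst ` set n_as"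
  shows "jordan_matrix n_as = diagonal (length n_as) (\<lambda>i. snd (n_as ! i))"
  using assms(1,4)
proof (induction n_as arbitrary: N)
  case Nil
  show ?case by (intro eq_matI) (simp_all add: jordan_matrix_def)
next
  case (Cons na n_as)
  obtain n a where na: "na = (n, a)" by force
  define m where "m = sum_list (map fst n_as)"
  have J: "jordan_matrix xs ^\<^sub>m Q = diag_block_mat (map (\<lambda>(n, a). jordan_block n a ^\<^sub>m Q) xs)"
    for xs :: "(nat \<times> complex) list"
    by (rule jordan_matrix_pow)
  have carr: "jordan_matrix n_as \<in> carrier_mat m m"
    by (rule carrier_matI) (simp_all add: m_def)
  have carr': "diag_block_mat (map (\<lambda>(n, a). jordan_block n a ^\<^sub>m Q) n_as) \<in> carrier_mat m m"
    unfolding J[symmetric] using carr by (rule pow_carrier_mat)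
  have "diag_block_mat (jordan_block n a ^\<^sub>m Q # map (\<lambda>(n, a). jordan_block n a ^\<^sub>m Q) n_as)
      = c \<cdot>\<^sub>m 1\<^sub>m N"
    using Cons.prems(1) unfolding J by (simp add: na)
  note * = diag_block_mat_Cons_eq_scalar[OF this jordan_block_pow_carrier carr']
  have "n = 1"
    using jordan_block_power_scalar_imp_dim_1[OF *(1) assms(2,3)] Cons.prems(2) by (auto simp: na)
  have IH: "jordan_matrix n_as = diagonal (length n_as) (\<lambda>i. snd (n_as ! i))"
    using Cons.IH[OF *(2)[folded J]] Cons.prems(2) by simp
  have "m = length n_as"
    using arg_cong[OF IH, of dim_row] by (simp add: m_def)
  have "jordan_matrix (na # n_as)
      = four_block_mat (jordan_block 1 a) (0\<^sub>m 1 m) (0\<^sub>m m 1) (jordan_matrix n_as)"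
    using carr by (simp add: jordan_matrix_def na \<open>n = 1\<close> Let_def)
  also have "\<dots> = diagonal (length (na # n_as)) (\<lambda>i. snd ((na # n_as) ! i))"
    unfolding IH by (rule eq_matI)
      (auto simp: \<open>m = length n_as\<close> na nth_Cons split: nat.splits)
  finally show ?case .
qed

text \<open>A nontrivial Jordan block has no nonzero scalar power, because its \<open>Q\<close>-th power has the entries
  \<open>Q a ^ (Q - 1)\<close> above the diagonal.\<close>

lemma root_of_scalar_diagonalizable:
  fixes A :: "complex mat"
  assumes A: "A \<in> carrier_mat n n" and pow: "A ^\<^sub>m Q = c \<cdot>\<^sub>m 1\<^sub>m n" and Q: "Q > 0" and c: "c \<noteq> 0"
  obtains P P' d where "P \<in> carrier_mat n n" "P' \<in> carrier_mat n n" "P * P' = 1\<^sub>m n" "P' * P = 1\<^sub>m n"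
    "A = P * diagonal n d * P'" "\<forall>i<n. d i ^ Q = c"
proof -
  obtain as where "char_poly A = (\<Prod>a\<leftarrow>as. [:- a, 1:])"
    using char_poly_factorized[OF A] by auto
  from jordan_nf_exists[OF A this] obtain n_as where jnf: "jordan_nf A n_as" ..
  let ?J = "jordan_matrix n_as"
  from jnf have z: "0 \<notin> fst ` set n_as" and "similar_mat A ?J"
    by (auto simp: jordan_nf_def)
  then obtain P P' where wit: "similar_mat_wit A ?J P P'"
    by (auto simp: similar_mat_def)
  note w = similar_mat_witD2[OF A wit]
  have J: "?J ^\<^sub>m Q = P' * (A ^\<^sub>m Q) * P"
  proof -
    have "similar_mat_wit (?J ^\<^sub>m Q) (A ^\<^sub>m Q) P' P"
      by (rule similar_mat_wit_pow[OF similar_mat_wit_sym[OF wit]])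
    thus ?thesis by (simp add: similar_mat_wit_def Let_def)
  qed
  also have "\<dots> = c \<cdot>\<^sub>m 1\<^sub>m n"
  proof -
    have "P' * (c \<cdot>\<^sub>m 1\<^sub>m n) = c \<cdot>\<^sub>m P'"
      using mult_smult_distrib[OF w(7) one_carrier_mat, of c] w(7) by simp
    thus ?thesis unfolding pow using mult_smult_assoc_mat[OF w(7,6), of c] w(2) by simp
  qed
  finally have Jc: "?J ^\<^sub>m Q = c \<cdot>\<^sub>m 1\<^sub>m n" .
  define d where "d = (\<lambda>i. snd (n_as ! i))"
  from jordan_matrix_power_scalar_imp_diagonal[OF Jc Q c z]
  have Jd: "?J = diagonal (length n_as) d" unfolding d_def .
  have len: "length n_as = n"
    using arg_cong[OF Jd, of dim_row] carrier_matD(1)[OF w(5)] by simp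
  have powd: "diagonal n d ^\<^sub>m k = diagonal n (\<lambda>i. d i ^ k)" for k
  proof (induction k)
    case (Suc k)
    show ?case
    proof (rule eq_matI)
      fix i j assume "i < dim_row (diagonal n (\<lambda>i. d i ^ Suc k))"
        "j < dim_col (diagonal n (\<lambda>i. d i ^ Suc k))"
      hence ij: "i < n" "j < n" by simp_all
      thus "(diagonal n d ^\<^sub>m Suc k) $$ (i, j) = diagonal n (\<lambda>i. d i ^ Suc k) $$ (i, j)"
        by (simp add: Suc diagonal_mult[of _ n n] del: index_mult_mat)
    qed simp_all
  next
    case 0
    show ?case by (rule eq_matI) simp_all
  qed
  have "d i ^ Q = c" if "i < n" for i
  proof -
    have "(?J ^\<^sub>m Q) $$ (i, i) = d i ^ Q"
      unfolding Jd len powd using that by simp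
    thus ?thesis using that by (simp add: Jc)
  qed
  thus thesis
    using that[of P P' d] w Jd len by simp
qed

lemma trace_similar:
  fixes P :: "'a::comm_ring_1 mat"
  assumes "P \<in> carrier_mat n n" "P' \<in> carrier_mat n n" "P' * P = 1\<^sub>m n" "D \<in> carrier_mat n n"
  shows "(\<Sum>i<n. (P * D * P') $$ (i, i)) = (\<Sum>i<n. D $$ (i, i))"
proof -
  define M where "M = P * D"
  have M: "M \<in> carrier_mat n n" using assms by (simp add: M_def)
  have "(\<Sum>i<n. (M * P') $$ (i, i)) = (\<Sum>i<n. \<Sum>k<n. M $$ (i, k) * P' $$ (k, i))"
    using assms M by (simp add: scalar_prod_def lessThan_atLeast0)
  also have "\<dots> = (\<Sum>k<n. \<Sum>i<n. P' $$ (k, i) * M $$ (i, k))"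
    by (subst sum.swap) (simp add: mult.commute)
  also have "\<dots> = (\<Sum>k<n. (P' * M) $$ (k, k))"
    using assms M by (simp add: scalar_prod_def lessThan_atLeast0)
  also have "P' * M = (P' * P) * D"
    unfolding M_def using assms(1,2,4) by (metis assoc_mult_mat)
  also have "\<dots> = D" using assms by simp
  finally show ?thesis by (simp only: M_def)
qed

lemma trace_diagonal_form:
  fixes P :: "'a::comm_ring_1 mat"
  assumes "P \<in> carrier_mat n n" "P' \<in> carrier_mat n n" "P' * P = 1\<^sub>m n"
  shows "(\<Sum>i<n. (P * diagonal n d * P') $$ (i, i)) = (\<Sum>i<n. d i)"
  using trace_similar[OF assms, of "diagonal n d"] by simp

text \<open>As \<open>2 E - 1\<close> is an involution, \<open>E\<close> is similar to a diagonal matrix with entries \<open>0\<close> and \<open>1\<close>.\<close>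

lemma trace_idempotent_Ints:
  fixes E :: "complex mat"
  assumes E: "E \<in> carrier_mat n n" and idem: "E * E = E"
  shows "(\<Sum>i<n. E $$ (i, i)) \<in> \<int>"
proof -
  define A where "A = 2 \<cdot>\<^sub>m E - 1\<^sub>m n"
  have A: "A \<in> carrier_mat n n" unfolding A_def by (rule minus_carrier_mat) simp
  have "A ^\<^sub>m 2 = A * A" using A by (simp add: numeral_2_eq_2)
  also have "\<dots> = 1\<^sub>m n"
  proof -
    have EE: "(2 \<cdot>\<^sub>m E) * (2 \<cdot>\<^sub>m E) = 4 \<cdot>\<^sub>m E"
      using mult_smult_distrib[OF smult_carrier_mat[OF E] E, of 2 2] mult_smult_assoc_mat[OF E E, of 2] idem
      by (auto intro!: eq_matI)
    have "A * A = (2 \<cdot>\<^sub>m E) * (2 \<cdot>\<^sub>m E) - 2 \<cdot>\<^sub>m E - (2 \<cdot>\<^sub>m E - 1\<^sub>m n)"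
    proof -
      have "A * A = (2 \<cdot>\<^sub>m E) * A - 1\<^sub>m n * A"
        by (subst (1) A_def, rule minus_mult_distrib_mat[OF smult_carrier_mat[OF E] one_carrier_mat A])
      also have "(2 \<cdot>\<^sub>m E) * A = (2 \<cdot>\<^sub>m E) * (2 \<cdot>\<^sub>m E) - (2 \<cdot>\<^sub>m E) * 1\<^sub>m n"
        unfolding A_def
        by (rule mult_minus_distrib_mat[OF smult_carrier_mat[OF E] smult_carrier_mat[OF E] one_carrier_mat])
      finally show ?thesis using A E by (simp add: A_def)
    qed
    thus ?thesis unfolding EE using E by (auto intro!: eq_matI)
  qed
  finally have "A ^\<^sub>m 2 = 1 \<cdot>\<^sub>m 1\<^sub>m n" by (simp, intro eq_matI) simp_all
  then obtain P P' d where
    P: "P \<in> carrier_mat n n" "P' \<in> carrier_mat n n" and "P * P' = 1\<^sub>m n"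
    and P': "P' * P = 1\<^sub>m n" and AP: "A = P * diagonal n d * P'"
    and d: "\<forall>i<n. d i ^ 2 = 1"
    by (rule root_of_scalar_diagonalizable[OF A _ pos2 one_neq_zero])
  have half: "(d i + 1) / 2 \<in> \<int>" if "i < n" for i
    using d that by (auto simp: power2_eq_1_iff)
  have "(\<Sum>i<n. E $$ (i, i)) = (\<Sum>i<n. (A $$ (i, i) + 1) / 2)"
    using E by (intro sum.cong) (simp_all add: A_def)
  also have "\<dots> = (\<Sum>i<n. (d i + 1) / 2)"
    using trace_diagonal_form[OF P P', of d] AP
    by (simp add: sum.distrib sum_divide_distrib[symmetric])
  also have "\<dots> \<in> \<int>"
    using half by (intro Ints_sum) auto
  finally show ?thesis .
qed

section \<open>Rings generated by a root of unity\<close>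

definition int_adjoin :: "complex \<Rightarrow> complex set" where
  "int_adjoin \<xi> = range (\<lambda>f. poly (of_int_poly f) \<xi>)"

lemma int_adjoinI: "x = poly (of_int_poly f) \<xi> \<Longrightarrow> x \<in> int_adjoin \<xi>"
  by (auto simp: int_adjoin_def)

lemma of_int_in_int_adjoin [simp]: "of_int k \<in> int_adjoin \<xi>"
  by (rule int_adjoinI[of _ "[:k:]"], cases "k = 0") simp_all

lemma int_adjoin_0_1 [simp]: "0 \<in> int_adjoin \<xi>" "1 \<in> int_adjoin \<xi>"
  using of_int_in_int_adjoin[of 0 \<xi>] of_int_in_int_adjoin[of 1 \<xi>] by simp_all

lemma of_nat_in_int_adjoin [simp]: "of_nat k \<in> int_adjoin \<xi>"
  using of_int_in_int_adjoin[of "int k"] by simp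

lemma generator_in_int_adjoin [simp]: "\<xi> \<in> int_adjoin \<xi>"
  by (rule int_adjoinI[of _ "[:0, 1:]"]) simp

lemma int_adjoin_add [intro]: "x \<in> int_adjoin \<xi> \<Longrightarrow> y \<in> int_adjoin \<xi> \<Longrightarrow> x + y \<in> int_adjoin \<xi>"
  by (auto simp: int_adjoin_def simp flip: poly_add of_int_poly_hom.hom_add)

lemma int_adjoin_mult [intro]: "x \<in> int_adjoin \<xi> \<Longrightarrow> y \<in> int_adjoin \<xi> \<Longrightarrow> x * y \<in> int_adjoin \<xi>"
  by (auto simp: int_adjoin_def simp flip: poly_mult of_int_poly_hom.hom_mult)

lemma int_adjoin_minus [intro]: "x \<in> int_adjoin \<xi> \<Longrightarrow> - x \<in> int_adjoin \<xi>"
  using int_adjoin_mult[OF of_int_in_int_adjoin[of "-1"]] by force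

lemma int_adjoin_diff [intro]: "x \<in> int_adjoin \<xi> \<Longrightarrow> y \<in> int_adjoin \<xi> \<Longrightarrow> x - y \<in> int_adjoin \<xi>"
  using int_adjoin_add[OF _ int_adjoin_minus] by force

lemma int_adjoin_power [intro]: "x \<in> int_adjoin \<xi> \<Longrightarrow> x ^ n \<in> int_adjoin \<xi>"
  by (induction n) auto

lemma int_adjoin_sum [intro]: "(\<And>i. i \<in> I \<Longrightarrow> f i \<in> int_adjoin \<xi>) \<Longrightarrow> sum f I \<in> int_adjoin \<xi>"
  by (induction I rule: infinite_finite_induct) auto

text \<open>Multiplication by \<open>x\<close> maps the powers \<open>\<xi> ^ j\<close>, \<open>j < N\<close>, to integer combinations of these powers.
  Thus \<open>x\<close> is an eigenvalue of an integer matrix.\<close>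

lemma int_adjoin_root_of_unity_algebraic_int:
  assumes "\<xi> ^ N = 1" "N > 0" "x \<in> int_adjoin \<xi>"
  shows "algebraic_int x"
proof -
  obtain f where x: "x = poly (of_int_poly f) \<xi>"
    using assms(3) by (auto simp: int_adjoin_def)
  define D where "D = degree f"
  have x: "x = (\<Sum>i\<le>D. of_int (coeff f i) * \<xi> ^ i)"
    by (simp add: x poly_altdef D_def degree_map_poly coeff_map_poly)
  define M where "M = mat N N (\<lambda>(j, k). \<Sum>i\<le>D. if (j + i) mod N = k then coeff f i else 0)"
  define v where "v = vec N (\<lambda>k. \<xi> ^ k)"
  let ?M = "map_mat of_int M :: complex mat"
  have M: "M \<in> carrier_mat N N" "?M \<in> carrier_mat N N" by (auto simp: M_def)
  have pmod: "\<xi> ^ (k mod N) = \<xi> ^ k" for k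
  proof -
    have "\<xi> ^ k = \<xi> ^ (N * (k div N) + k mod N)" by simp
    also have "\<dots> = \<xi> ^ (k mod N)" by (simp only: power_add power_mult assms(1)) simp
    finally show ?thesis by simp
  qed
  have "?M *\<^sub>v v = x \<cdot>\<^sub>v v"
  proof (rule eq_vecI)
    fix j assume "j < dim_vec (x \<cdot>\<^sub>v v)"
    hence j: "j < N" by (simp add: v_def)
    have "(?M *\<^sub>v v) $ j = (\<Sum>k<N. (\<Sum>i\<le>D. if (j + i) mod N = k then of_int (coeff f i) else 0) * \<xi> ^ k)"
      using j by (simp add: M_def v_def scalar_prod_def lessThan_atLeast0 if_distrib cong: if_cong)
    also have "\<dots> = (\<Sum>i\<le>D. \<Sum>k<N. if k = (j + i) mod N then of_int (coeff f i) * \<xi> ^ k else 0)"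
      by (subst sum.swap) (auto simp: sum_distrib_right intro!: sum.cong)
    also have "\<dots> = (\<Sum>i\<le>D. of_int (coeff f i) * \<xi> ^ (j + i))"
      using assms(2) by (simp add: pmod)
    also have "\<dots> = (x \<cdot>\<^sub>v v) $ j"
      using j by (simp add: x v_def sum_distrib_left power_add mult_ac)
    finally show "(?M *\<^sub>v v) $ j = (x \<cdot>\<^sub>v v) $ j" .
  qed (simp_all add: M_def v_def)
  moreover have "v $ 0 \<noteq> (0\<^sub>v N) $ 0" using assms(2) by (simp add: v_def)
  hence "v \<noteq> 0\<^sub>v N" by metis
  moreover have "v \<in> carrier_vec N" by (simp add: v_def)
  ultimately have "eigenvector ?M v x" using M by (simp add: eigenvector_def)
  hence "poly (char_poly ?M) x = 0"
    using eigenvalue_root_char_poly[OF M(2)] by (auto simp: eigenvalue_def)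
  hence "poly (of_int_poly (char_poly M)) x = 0"
    by (simp only: of_int_hom.char_poly_hom[OF M(1)])
  moreover have "lead_coeff (char_poly M) = 1"
    using degree_monic_char_poly[OF M(1)] by simp
  ultimately show ?thesis unfolding algebraic_int_altdef_ipoly by blast
qed

text \<open>Divisibility in \<open>\<int>[\<xi>]\<close>; in the field of complex numbers \<open>dvd\<close> carries no information.\<close>

definition adjoin_dvd :: "complex \<Rightarrow> complex \<Rightarrow> complex \<Rightarrow> bool" where
  "adjoin_dvd \<xi> x y \<longleftrightarrow> (\<exists>w\<in>int_adjoin \<xi>. y = x * w)"

lemma adjoin_dvdI: "w \<in> int_adjoin \<xi> \<Longrightarrow> y = x * w \<Longrightarrow> adjoin_dvd \<xi> x y"
  by (auto simp: adjoin_dvd_def)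

lemma adjoin_dvd_refl [simp]: "adjoin_dvd \<xi> x x"
  by (rule adjoin_dvdI[of 1]) auto

lemma adjoin_dvd_0 [simp]: "adjoin_dvd \<xi> x 0"
  by (rule adjoin_dvdI[of 0]) auto

lemma adjoin_dvd_trans [trans]: "adjoin_dvd \<xi> x y \<Longrightarrow> adjoin_dvd \<xi> y z \<Longrightarrow> adjoin_dvd \<xi> x z"
  unfolding adjoin_dvd_def by (metis int_adjoin_mult mult.assoc)

lemma adjoin_dvd_mult: "adjoin_dvd \<xi> x y \<Longrightarrow> adjoin_dvd \<xi> x' y' \<Longrightarrow> adjoin_dvd \<xi> (x * x') (y * y')"
  unfolding adjoin_dvd_def by (elim bexE, rule_tac x = "w * wa" in bexI) auto

lemma adjoin_dvd_power: "adjoin_dvd \<xi> x y \<Longrightarrow> adjoin_dvd \<xi> (x ^ n) (y ^ n)"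
  by (induction n) (auto intro: adjoin_dvd_mult)

lemma adjoin_dvd_prod:
  "(\<And>i. i \<in> I \<Longrightarrow> adjoin_dvd \<xi> (f i) (g i)) \<Longrightarrow> adjoin_dvd \<xi> (prod f I) (prod g I)"
  by (induction I rule: infinite_finite_induct) (auto intro: adjoin_dvd_mult)

lemma adjoin_dvd_sum:
  "(\<And>i. i \<in> I \<Longrightarrow> adjoin_dvd \<xi> x (g i)) \<Longrightarrow> adjoin_dvd \<xi> x (sum g I)"
proof (induction I rule: infinite_finite_induct)
  case (insert i I)
  then obtain w w' where "w \<in> int_adjoin \<xi>" "w' \<in> int_adjoin \<xi>" "g i = x * w" "sum g I = x * w'"
    unfolding adjoin_dvd_def by (metis insert_iff)
  thus ?case using insert by (intro adjoin_dvdI[of "w + w'"]) (auto simp: algebra_simps)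
qed auto

text \<open>The quotient is rational and an algebraic integer.\<close>

lemma adjoin_dvd_of_nat_imp_dvd:
  assumes "\<xi> ^ N = 1" "N > 0" "adjoin_dvd \<xi> (of_nat a) (of_nat b)" "a > 0"
  shows "a dvd b"
proof -
  obtain w where w: "w \<in> int_adjoin \<xi>" "of_nat b = of_nat a * w"
    using assms(3) by (auto simp: adjoin_dvd_def)
  have "w = of_nat b / of_nat a" using w(2) assms(4) by (simp add: field_simps)
  hence "w \<in> \<rat>" by simp
  hence "w \<in> \<int>"
    by (intro rational_algebraic_int_is_int int_adjoin_root_of_unity_algebraic_int[OF assms(1,2) w(1)])
  then obtain k where "w = of_int k" by (auto elim: Ints_cases)
  hence "complex_of_int (int b) = of_int (int a * k)" using w(2) by simp
  hence "int b = int a * k" by (simp only: of_int_eq_iff)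
  thus ?thesis by (metis dvd_triv_left int_dvd_int_iff)
qed

lemma one_minus_dvd_one_minus_power:
  assumes "x \<in> int_adjoin \<xi>"
  shows "adjoin_dvd \<xi> (1 - x) (1 - x ^ k)"
  using assms by (intro adjoin_dvdI[of "\<Sum>i<k. x ^ i"] one_diff_power_eq) auto

text \<open>The powers of a nontrivial \<open>m\<close>-th root of unity \<open>x\<close> sum to \<open>0\<close>, so that \<open>m\<close> is the sum of the
  numbers \<open>1 - x ^ k\<close>, \<open>k < m\<close>.\<close>

lemma one_minus_root_of_unity_dvd:
  assumes "x \<in> int_adjoin \<xi>" "x ^ m = 1" "x \<noteq> 1"
  shows "adjoin_dvd \<xi> (1 - x) (of_nat m)"
proof -
  have "(1 - x) * (\<Sum>k<m. x ^ k) = 0"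
    using one_diff_power_eq[of x m] assms(2) by simp
  hence "of_nat m = (\<Sum>k<m. 1 - x ^ k)"
    using assms(3) by (simp add: sum_subtractf)
  thus ?thesis
    by (simp add: adjoin_dvd_sum one_minus_dvd_one_minus_power[OF assms(1)])
qed

text \<open>This is the Frobenius congruence \<open>(1 - z) ^ l \<equiv> 1 - z ^ l\<close> modulo the prime \<open>l\<close>.\<close>

lemma prime_dvd_one_minus_root_of_unity_power:
  assumes "Factorial_Ring.prime l" "z \<in> int_adjoin \<xi>" "z ^ l = 1"
  shows "adjoin_dvd \<xi> (of_nat l) ((1 - z) ^ l)"
proof -
  have l: "l > 0" using assms(1) prime_gt_0_nat by blast
  have "(1 - z) ^ l = (\<Sum>k\<le>l. of_nat (l choose k) * (- z) ^ k)"
    using binomial_ring[of "- z" 1 l] by simp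
  also have "{..l} = insert 0 (insert l {0<..<l})" using l by auto
  also have "(\<Sum>k\<in>\<dots>. of_nat (l choose k) * (- z) ^ k)
      = (1 + (-1) ^ l) + (\<Sum>k\<in>{0<..<l}. of_nat (l choose k) * (- z) ^ k)"
    using l assms(3) by (simp add: power_minus[of z])
  finally have eq: "(1 - z) ^ l
      = (1 + (-1) ^ l) + (\<Sum>k\<in>{0<..<l}. of_nat (l choose k) * (- z) ^ k)" .
  have "adjoin_dvd \<xi> (of_nat l) (1 + (-1) ^ l)"
  proof (cases "odd l")
    case False
    hence "l = 2" using assms(1) primes_dvd_imp_eq two_is_prime_nat by blast
    thus ?thesis by simp
  qed simp
  moreover have "adjoin_dvd \<xi> (of_nat l) (\<Sum>k\<in>{0<..<l}. of_nat (l choose k) * (- z) ^ k)"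
  proof (rule adjoin_dvd_sum)
    fix k assume k: "k \<in> {0<..<l}"
    then obtain c where "l choose k = l * c"
      using dvd_choose_prime[of k l] assms(1) l by (auto elim: dvdE)
    thus "adjoin_dvd \<xi> (of_nat l) (of_nat (l choose k) * (- z) ^ k)"
      using assms(2)
      by (intro adjoin_dvdI[of "of_nat c * (- z) ^ k"] int_adjoin_mult int_adjoin_power int_adjoin_minus)
        simp_all
  qed
  ultimately show ?thesis
    unfolding eq adjoin_dvd_def by (metis distrib_left int_adjoin_add)
qed

lemma primitive_root_of_unity:
  assumes "n > 0"
  obtains \<omega> :: complex where "\<And>k. \<omega> ^ k = 1 \<longleftrightarrow> n dvd k" "\<And>z. z ^ n = 1 \<Longrightarrow> \<exists>k<n. z = \<omega> ^ k"
proof -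
  define \<omega> where "\<omega> = cis (2 * pi / real n)"
  have pow: "\<omega> ^ k = cis (2 * pi * real k / real n)" for k
    by (simp add: \<omega>_def DeMoivre mult_ac)
  have bij: "bij_betw (\<lambda>k. \<omega> ^ k) {..<n} {z. z ^ n = 1}"
    unfolding pow by (rule bij_betw_roots_unity[OF assms])
  have one: "\<omega> ^ n = 1" using assms by (simp add: pow)
  have "\<omega> ^ k = 1 \<longleftrightarrow> n dvd k" for k
  proof -
    have "\<omega> ^ k = \<omega> ^ (n * (k div n) + k mod n)" by simp
    also have "\<dots> = \<omega> ^ (k mod n)" by (simp only: power_add power_mult one) simp
    finally have "\<omega> ^ k = 1 \<longleftrightarrow> \<omega> ^ (k mod n) = \<omega> ^ 0" by simp
    also have "\<dots> \<longleftrightarrow> k mod n = 0"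
      using bij_betw_imp_inj_on[OF bij] assms by (intro inj_on_eq_iff[of _ "{..<n}"]) auto
    finally show ?thesis by (simp add: mod_eq_0_iff_dvd)
  qed
  moreover have "\<exists>k<n. z = \<omega> ^ k" if "z ^ n = 1" for z
    using bij_betw_imp_surj_on[OF bij] that by (metis (mono_tags, lifting) imageE lessThan_iff mem_Collect_eq)
  ultimately show thesis using that by blast
qed

lemma power_gcd_eq_1:
  fixes x :: "'a::field"
  assumes "x ^ a = 1" "x ^ b = 1"
  shows "x ^ gcd a b = 1"
proof (cases "a = 0")
  case False
  then obtain s t where "a * s = b * t + gcd a b" using bezout_nat by blast
  hence "x ^ (a * s) = x ^ (b * t) * x ^ gcd a b" by (simp add: power_add)
  thus ?thesis using assms by (simp add: power_mult)
qed (use assms in simp)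

lemma prod_roots_of_unity:
  fixes x :: complex
  assumes "q > 0"
  shows "(\<Prod>z | z ^ q = 1. 1 - z * x) = 1 - x ^ q"
proof (cases "x = 0")
  case True
  thus ?thesis using assms by (simp add: power_0_left)
next
  case False
  let ?p = "monom 1 q - 1 :: complex poly"
  have deg: "degree ?p = q"
    using assms degree_add_eq_left[of "-1" "monom 1 q :: complex poly"] by (simp add: degree_monom_eq)
  have roots: "{z. poly ?p z = 0} = {z. z ^ q = 1}" by (simp add: poly_monom)
  have "rsquarefree ?p"
    unfolding rsquarefree_roots using assms
    by (auto simp: pderiv_diff pderiv_monom poly_monom power_0_left)
  from complex_poly_decompose_rsquarefree[OF this]
  have "(\<Prod>z | z ^ q = 1. [:- z, 1:]) = ?p"
    unfolding roots deg using assms by simp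
  from arg_cong[OF this, of "\<lambda>p. poly p (1 / x)"]
  have "(\<Prod>z | z ^ q = 1. 1 / x - z) = (1 / x) ^ q - 1"
    by (simp add: poly_prod poly_monom)
  moreover have "(\<Prod>z | z ^ q = 1. 1 - z * x) = (\<Prod>z | z ^ q = 1. x * (1 / x - z))"
    using False by (intro prod.cong) (auto simp: field_simps)
  ultimately have "(\<Prod>z | z ^ q = 1. 1 - z * x) = x ^ q * ((1 / x) ^ q - 1)"
    using card_roots_unity_eq[OF assms] by (simp add: prod.distrib)
  moreover have "x ^ q * ((1 / x) ^ q - 1) = 1 - x ^ q"
    using False by (simp add: right_diff_distrib power_one_over)
  ultimately show ?thesis by simp
qed

text \<open>Here \<open>x\<close> is a primitive root of unity of order \<open>q l\<close> with \<open>q = l ^ e\<close>, so that every root of unity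
  of order dividing \<open>q l\<close> is a power of \<open>x\<close>.  Hence each of the \<open>q\<close> factors \<open>1 - z x\<close>, \<open>z ^ q = 1\<close>, of
  \<open>1 - x ^ q\<close> has the form \<open>1 - x ^ k\<close> and is divisible by \<open>1 - x\<close>.\<close>

lemma one_minus_prime_power_root_of_unity_dvd:
  assumes l: "Factorial_Ring.prime l" and "x \<in> int_adjoin \<xi>" and x: "x ^ (l ^ Suc e) = 1" "x ^ (l ^ e) \<noteq> 1"
  shows "adjoin_dvd \<xi> ((1 - x) ^ (l ^ e)) (1 - x ^ (l ^ e))"
proof -
  have l0: "l > 0" using l prime_gt_0_nat by blast
  have inj: "inj_on (\<lambda>k. x ^ k) {..<l ^ Suc e}"
  proof (rule inj_onI)
    have "False" if "i < j" "j < l ^ Suc e" "x ^ i = x ^ j" for i j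
    proof -
      have "x \<noteq> 0" using x(1) l0 by (auto simp: power_0_left)
      moreover have "x ^ j = x ^ i * x ^ (j - i)" using that(1) by (simp flip: power_add)
      ultimately have "x ^ (j - i) = 1" using that(3) by simp
      hence g: "x ^ gcd (j - i) (l ^ Suc e) = 1" by (rule power_gcd_eq_1[OF _ x(1)])
      obtain f where f: "f \<le> Suc e" "gcd (j - i) (l ^ Suc e) = l ^ f"
        using divides_primepow_nat[OF l, of "gcd (j - i) (l ^ Suc e)" "Suc e"] by auto
      have "f \<noteq> Suc e"
      proof
        assume "f = Suc e"
        hence "l ^ Suc e dvd j - i" using f(2) by (metis gcd_dvd1)
        thus False using that(1,2) by (auto dest: dvd_imp_le)
      qed
      hence "l ^ f dvd l ^ e" using f(1) by (intro le_imp_power_dvd) simp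
      thus False using g x(2) unfolding f(2) by (auto simp: power_mult elim!: dvdE)
    qed
    thus "i = j" if "i \<in> {..<l ^ Suc e}" "j \<in> {..<l ^ Suc e}" "x ^ i = x ^ j" for i j
      using that by (metis lessThan_iff linorder_neqE_nat)
  qed
  have "(\<lambda>k. x ^ k) ` {..<l ^ Suc e} \<subseteq> {z. z ^ (l ^ Suc e) = 1}"
    using x(1) by (auto simp: power_commutes simp flip: power_mult) (metis mult.commute power_mult power_one)
  hence surj: "(\<lambda>k. x ^ k) ` {..<l ^ Suc e} = {z. z ^ (l ^ Suc e) = 1}"
    using card_roots_unity_eq[of "l ^ Suc e"] card_image[OF inj] l0
    by (intro card_subset_eq finite_roots_unity) auto
  have "adjoin_dvd \<xi> (\<Prod>z | z ^ (l ^ e) = (1::complex). 1 - x) (\<Prod>z | z ^ (l ^ e) = 1. 1 - z * x)"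
  proof (rule adjoin_dvd_prod)
    fix z :: complex assume "z \<in> {z. z ^ (l ^ e) = 1}"
    hence "(z * x) ^ (l ^ Suc e) = 1"
      using x(1) by (simp add: power_mult_distrib power_mult mult.commute[of l])
    then obtain k where "z * x = x ^ k" using surj by auto
    thus "adjoin_dvd \<xi> (1 - x) (1 - z * x)"
      using one_minus_dvd_one_minus_power[OF assms(2)] by simp
  qed
  thus ?thesis
    using prod_roots_of_unity[of "l ^ e" x] card_roots_unity_eq[of "l ^ e"] l0 by simp
qed

section \<open>Eigenvalue multiplicities of roots of scalar matrices\<close>

definition int_adjoin_coeffs :: "complex \<Rightarrow> complex poly \<Rightarrow> bool" where
  "int_adjoin_coeffs \<xi> f \<longleftrightarrow> (\<forall>k. coeff f k \<in> int_adjoin \<xi>)"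

lemma int_adjoin_coeffs_0 [simp]: "int_adjoin_coeffs \<xi> 0" "int_adjoin_coeffs \<xi> 1"
  by (auto simp: int_adjoin_coeffs_def)

lemma int_adjoin_coeffs_pCons [simp]:
  "int_adjoin_coeffs \<xi> (pCons c f) \<longleftrightarrow> c \<in> int_adjoin \<xi> \<and> int_adjoin_coeffs \<xi> f"
  unfolding int_adjoin_coeffs_def by (metis coeff_pCons_0 coeff_pCons_Suc not0_implies_Suc)

lemma int_adjoin_coeffs_add [intro]:
  "int_adjoin_coeffs \<xi> f \<Longrightarrow> int_adjoin_coeffs \<xi> g \<Longrightarrow> int_adjoin_coeffs \<xi> (f + g)"
  by (auto simp: int_adjoin_coeffs_def)

lemma int_adjoin_coeffs_diff [intro]:
  "int_adjoin_coeffs \<xi> f \<Longrightarrow> int_adjoin_coeffs \<xi> g \<Longrightarrow> int_adjoin_coeffs \<xi> (f - g)"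
  by (auto simp: int_adjoin_coeffs_def)

lemma int_adjoin_coeffs_mult [intro]:
  "int_adjoin_coeffs \<xi> f \<Longrightarrow> int_adjoin_coeffs \<xi> g \<Longrightarrow> int_adjoin_coeffs \<xi> (f * g)"
  by (auto simp: int_adjoin_coeffs_def coeff_mult intro!: int_adjoin_sum)

lemma int_adjoin_coeffs_smult [intro]:
  "c \<in> int_adjoin \<xi> \<Longrightarrow> int_adjoin_coeffs \<xi> f \<Longrightarrow> int_adjoin_coeffs \<xi> (smult c f)"
  by (auto simp: int_adjoin_coeffs_def)

lemma int_adjoin_coeffs_power [intro]: "int_adjoin_coeffs \<xi> f \<Longrightarrow> int_adjoin_coeffs \<xi> (f ^ n)"
  by (induction n) auto

lemma int_adjoin_coeffs_sum [intro]:
  "(\<And>i. i \<in> I \<Longrightarrow> int_adjoin_coeffs \<xi> (f i)) \<Longrightarrow> int_adjoin_coeffs \<xi> (sum f I)"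
  by (induction I rule: infinite_finite_induct) auto

lemma int_adjoin_coeffs_prod [intro]:
  "(\<And>i. i \<in> I \<Longrightarrow> int_adjoin_coeffs \<xi> (f i)) \<Longrightarrow> int_adjoin_coeffs \<xi> (prod f I)"
  by (induction I rule: infinite_finite_induct) auto

lemma int_adjoin_coeffs_det:
  assumes "M \<in> carrier_mat n n" "\<And>a b. a < n \<Longrightarrow> b < n \<Longrightarrow> int_adjoin_coeffs \<xi> (M $$ (a, b))"
  shows "int_adjoin_coeffs \<xi> (det M)"
  unfolding det_def'[OF assms(1)]
proof (intro int_adjoin_coeffs_sum int_adjoin_coeffs_mult int_adjoin_coeffs_prod)
  fix p assume "p \<in> {p. p permutes {0..<n}}"
  thus "int_adjoin_coeffs \<xi> (M $$ (i, p i))" if "i \<in> {0..<n}" for i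
    using assms(2)[of i "p i"] that by (auto dest: permutes_in_image)
  show "int_adjoin_coeffs \<xi> (signof p)"
    using int_adjoin_minus[of 1 \<xi>] by (cases p rule: sign_cases) (auto simp: int_adjoin_coeffs_def coeff_1)
qed

lemma poly_in_int_adjoin:
  "int_adjoin_coeffs \<xi> f \<Longrightarrow> s \<in> int_adjoin \<xi> \<Longrightarrow> poly f s \<in> int_adjoin \<xi>"
  unfolding poly_altdef int_adjoin_coeffs_def by (intro int_adjoin_sum int_adjoin_mult int_adjoin_power) auto

lemma det_diagonal_form_minus_scalar:
  fixes P :: "'a::comm_ring_1 mat"
  assumes P: "P \<in> carrier_mat n n" "P' \<in> carrier_mat n n" "P * P' = 1\<^sub>m n" "P' * P = 1\<^sub>m n"
  shows "det (P * diagonal n d * P' - \<alpha> \<cdot>\<^sub>m 1\<^sub>m n) = (\<Prod>i<n. d i - \<alpha>)"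
proof -
  let ?D = "diagonal n d" and ?E = "diagonal n (\<lambda>i. d i - \<alpha>)"
  have "?E = ?D - \<alpha> \<cdot>\<^sub>m 1\<^sub>m n" by (rule eq_matI) auto
  hence "P * ?E = P * ?D - \<alpha> \<cdot>\<^sub>m P"
    using mult_minus_distrib_mat[of P n n ?D n "\<alpha> \<cdot>\<^sub>m 1\<^sub>m n"] P
      mult_smult_distrib[OF P(1) one_carrier_mat, of \<alpha>] by simp
  moreover have PD: "P * ?D \<in> carrier_mat n n" using P by (intro mult_carrier_mat) auto
  ultimately have "P * ?E * P' = P * ?D * P' - \<alpha> \<cdot>\<^sub>m 1\<^sub>m n"
    using minus_mult_distrib_mat[OF PD smult_carrier_mat[OF P(1)] P(2)]
      mult_smult_assoc_mat[OF P(1,2), of \<alpha>] P(3) by simp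
  hence "det (P * ?D * P' - \<alpha> \<cdot>\<^sub>m 1\<^sub>m n) = det (P * ?E * P')" by simp
  also have "\<dots> = det ?E * (det P * det P')"
  proof -
    have "P * ?E \<in> carrier_mat n n" using P by (intro mult_carrier_mat) auto
    from det_mult[OF this P(2)] det_mult[of P n ?E] P show ?thesis by (simp add: mult_ac)
  qed
  also have "det P * det P' = 1" using det_mult[OF P(1,2)] P(3) by simp
  also have "det ?E = prod_list (diag_mat ?E)"
    by (rule det_upper_triangular[of _ n]) auto
  also have "\<dots> = (\<Prod>i<n. d i - \<alpha>)"
    by (simp add: prod_list_diag_prod lessThan_atLeast0)
  finally show ?thesis by simp
qed

text \<open>Consider the determinant of \<open>F (y\<^sub>0 + X) - \<alpha>\<close> as a polynomial in \<open>X\<close>.  In a basis of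
  eigenvectors of \<open>F y\<^sub>0\<close>, the rows belonging to the eigenvalue \<open>\<alpha>\<close> are divisible by \<open>X\<close>, so that the
  determinant is a product of \<open>X ^ card {i. i < r \<and> d i = \<alpha>}\<close> and a cofactor.  The change of basis may
  have arbitrary complex entries, but the determinant does not depend on it and has coefficients in \<open>\<int>[\<xi>]\<close>,
  hence so has the cofactor.  The claim is the value at \<open>X = y\<^sub>1 - y\<^sub>0\<close>.\<close>

lemma multiplicity_power_dvd_det:
  fixes c :: "nat \<Rightarrow> nat \<Rightarrow> nat \<Rightarrow> complex" and r l :: nat
  defines "F \<equiv> \<lambda>y. mat r r (\<lambda>(a, b). \<Sum>i<l. y ^ i * c i a b)"
  assumes c: "\<And>i a b. c i a b \<in> int_adjoin \<xi>"
    and y: "y\<^sub>0 \<in> int_adjoin \<xi>" "y\<^sub>1 \<in> int_adjoin \<xi>" and \<alpha>: "\<alpha> \<in> int_adjoin \<xi>"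
    and P: "P \<in> carrier_mat r r" "P' \<in> carrier_mat r r" "P * P' = 1\<^sub>m r" "P' * P = 1\<^sub>m r"
    and F0: "F y\<^sub>0 = P * diagonal r d * P'"
  shows "adjoin_dvd \<xi> ((y\<^sub>1 - y\<^sub>0) ^ card {i. i < r \<and> d i = \<alpha>}) (det (F y\<^sub>1 - \<alpha> \<cdot>\<^sub>m 1\<^sub>m r))"
proof -
  define S where "S = {i. i < r \<and> d i = \<alpha>}"
  have S: "finite S" "S \<subseteq> {0..<r}" by (auto simp: S_def)
  define M where "M = mat r r (\<lambda>(a, b). (\<Sum>i<l. smult (c i a b) ([:y\<^sub>0, 1:] ^ i)) - (if a = b then [:\<alpha>:] else 0))"
  have M: "M \<in> carrier_mat r r" by (simp add: M_def)
  have F: "F y \<in> carrier_mat r r" for y by (simp add: F_def)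
  have pM: "poly (M $$ (a, b)) s = (F (y\<^sub>0 + s) - \<alpha> \<cdot>\<^sub>m 1\<^sub>m r) $$ (a, b)" if "a < r" "b < r" for a b s
    using that by (simp add: M_def F_def poly_sum mult.commute)
  define K where "K = (\<lambda>A. map_mat (\<lambda>x::complex. [:x:]) A)"
  define W where "W = K P' * (M * K P)"
  have KP: "K P \<in> carrier_mat r r" "K P' \<in> carrier_mat r r" using P by (auto simp: K_def)
  have "det W = det M"
  proof -
    have "K P' * K P = 1\<^sub>m r"
    proof (rule eq_matI)
      fix i j assume ij: "i < dim_row (1\<^sub>m r :: complex poly mat)" "j < dim_col (1\<^sub>m r :: complex poly mat)"
      have s: "(\<Sum>k\<in>A. [:f k * g k:]) = [:\<Sum>k\<in>A. f k * g k:]" for A :: "nat set" and f g :: "nat \<Rightarrow> complex"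
        by (induction A rule: infinite_finite_induct) auto
      have "(K P' * K P) $$ (i, j) = [:\<Sum>k = 0..<r. P' $$ (i, k) * P $$ (k, j):]"
        using ij P(1,2) by (simp add: K_def scalar_prod_def s mult.commute)
      also have "(\<Sum>k = 0..<r. P' $$ (i, k) * P $$ (k, j)) = (P' * P) $$ (i, j)"
        using ij P(1,2) by (simp add: scalar_prod_def)
      finally have "(K P' * K P) $$ (i, j) = [:(P' * P) $$ (i, j):]" .
      thus "(K P' * K P) $$ (i, j) = 1\<^sub>m r $$ (i, j)"
        using ij by (simp add: P(4) one_pCons)
    qed (use KP in auto)
    hence "det (K P') * det (K P) = 1" using det_mult[OF KP(2,1)] by simp
    moreover have "det W = det (K P') * (det M * det (K P))"
      unfolding W_def using det_mult[OF KP(2) mult_carrier_mat[OF M KP(1)]] det_mult[OF M KP(1)] by simp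
    ultimately show ?thesis by (simp add: mult_ac)
  qed
  have Wc: "W \<in> carrier_mat r r" unfolding W_def using KP M by (intro mult_carrier_mat)
  have "[:0, 1:] dvd W $$ (i, j)" if i: "i \<in> S" and j: "j < r" for i j
  proof -
    have ir: "i < r" "d i = \<alpha>" using i by (auto simp: S_def)
    have "poly (W $$ (i, j)) 0 = (\<Sum>k<r. P' $$ (i, k) * (\<Sum>l<r. poly (M $$ (k, l)) 0 * P $$ (l, j)))"
      using ir j P M by (simp add: W_def K_def scalar_prod_def poly_sum lessThan_atLeast0 mult.commute)
    also have "\<dots> = (\<Sum>k<r. P' $$ (i, k) * ((F y\<^sub>0 - \<alpha> \<cdot>\<^sub>m 1\<^sub>m r) * P) $$ (k, j))"
      using ir j P F[of y\<^sub>0] by (simp add: pM scalar_prod_def lessThan_atLeast0)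
    also have "\<dots> = (P' * ((F y\<^sub>0 - \<alpha> \<cdot>\<^sub>m 1\<^sub>m r) * P)) $$ (i, j)"
      using ir j P F[of y\<^sub>0] by (simp add: scalar_prod_def lessThan_atLeast0)
    also have "P' * ((F y\<^sub>0 - \<alpha> \<cdot>\<^sub>m 1\<^sub>m r) * P) = diagonal r d - \<alpha> \<cdot>\<^sub>m 1\<^sub>m r"
    proof -
      have D: "diagonal r d \<in> carrier_mat r r" by simp
      have PD: "P * diagonal r d \<in> carrier_mat r r" using P D by (intro mult_carrier_mat)
      have "(F y\<^sub>0 - \<alpha> \<cdot>\<^sub>m 1\<^sub>m r) * P = F y\<^sub>0 * P - \<alpha> \<cdot>\<^sub>m P"
        using minus_mult_distrib_mat[OF F smult_carrier_mat[OF one_carrier_mat] P(1)]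
          mult_smult_assoc_mat[OF one_carrier_mat P(1), of \<alpha>] P(1) by simp
      also have "F y\<^sub>0 * P = P * diagonal r d"
        unfolding F0 using assoc_mult_mat[OF PD P(2,1)] P(4) PD by simp
      finally have "P' * ((F y\<^sub>0 - \<alpha> \<cdot>\<^sub>m 1\<^sub>m r) * P) = P' * (P * diagonal r d) - P' * (\<alpha> \<cdot>\<^sub>m P)"
        using mult_minus_distrib_mat[OF P(2) PD smult_carrier_mat[OF P(1)]] by simp
      thus ?thesis
        using assoc_mult_mat[OF P(2,1) D] mult_smult_distrib[OF P(2,1), of \<alpha>] P(4) D by simp
    qed
    also have "(diagonal r d - \<alpha> \<cdot>\<^sub>m 1\<^sub>m r) $$ (i, j) = 0" using ir j by auto
    finally show ?thesis by (simp add: poly_eq_0_iff_dvd)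
  qed
  hence "[:0, 1:] ^ card S dvd det W"
  proof -
    assume dvd: "\<And>i j. i \<in> S \<Longrightarrow> j < r \<Longrightarrow> [:0, 1:] dvd W $$ (i, j)"
    show ?thesis
      unfolding det_def'[OF Wc]
    proof (intro dvd_sum dvd_mult)
      fix p assume p: "p \<in> {p. p permutes {0..<r}}"
      have "(\<Prod>i\<in>S. [:0, 1:]) dvd (\<Prod>i\<in>S. W $$ (i, p i))"
        using S p by (intro prod_dvd_prod dvd) (auto dest: permutes_in_image)
      also have "\<dots> dvd (\<Prod>i = 0..<r. W $$ (i, p i))"
        using S by (intro prod_dvd_prod_subset) auto
      finally show "[:0, 1:] ^ card S dvd (\<Prod>i = 0..<r. W $$ (i, p i))" by simp
    qed
  qed
  then obtain E where E: "det M = [:0, 1:] ^ card S * E" unfolding \<open>det W = det M\<close> by (elim dvdE)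
  have X: "[:0, 1:] ^ card S = monom (1::complex) (card S)" by (simp add: monom_altdef)
  have "int_adjoin_coeffs \<xi> (det M)"
    by (intro int_adjoin_coeffs_det[OF M]) (auto simp: M_def c y \<alpha> intro!: int_adjoin_coeffs_diff
        int_adjoin_coeffs_sum int_adjoin_coeffs_smult int_adjoin_coeffs_power)
  hence "int_adjoin_coeffs \<xi> E"
    unfolding int_adjoin_coeffs_def E X coeff_monom_mult by (metis add_diff_cancel_left' le_add1 mult_1)
  hence "poly E (y\<^sub>1 - y\<^sub>0) \<in> int_adjoin \<xi>" using y by (intro poly_in_int_adjoin) auto
  moreover have "det (F y\<^sub>1 - \<alpha> \<cdot>\<^sub>m 1\<^sub>m r) = poly (det M) (y\<^sub>1 - y\<^sub>0)"
    using pM[of _ _ "y\<^sub>1 - y\<^sub>0"] F M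
    by (intro poly_det_cong[symmetric, of _ r]) auto
  ultimately show ?thesis
    unfolding S_def[symmetric] E by (intro adjoin_dvdI[of "poly E (y\<^sub>1 - y\<^sub>0)"]) auto
qed

text \<open>Let \<open>\<mu>\<close> be the multiplicity of \<open>\<alpha>\<close> at \<open>y\<^sub>0\<close>.  Then \<open>(y\<^sub>1 - y\<^sub>0) ^ \<mu>\<close> divides the determinant of
  \<open>F y\<^sub>1 - \<alpha>\<close>, which is the product of the differences \<open>d' i - \<alpha>\<close>.  Up to units, \<open>y\<^sub>1 - y\<^sub>0\<close> is \<open>1 - \<zeta>\<close> with \<open>\<zeta>\<close>
  of order \<open>l\<close>, and \<open>d' i - \<alpha>\<close> is \<open>1 - \<rho>\<close> with \<open>\<rho> ^ Q = \<zeta>\<close>.  If the order of \<open>\<rho>\<close> is a power of \<open>l\<close>, the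
  \<open>l ^ e\<close>-th power of \<open>1 - \<rho>\<close> divides \<open>1 - \<zeta>\<close>; otherwise \<open>1 - \<rho>\<close> divides \<open>m\<close>, which is prime to \<open>l\<close>.
  Comparing the powers of \<open>1 - \<zeta>\<close> on both sides gives the bound.\<close>

lemma multiplicity_bound:
  fixes c :: "nat \<Rightarrow> nat \<Rightarrow> nat \<Rightarrow> int" and r l Q :: nat
  defines "F \<equiv> \<lambda>y. mat r r (\<lambda>(a, b). \<Sum>i<l. y ^ i * of_int (c i a b)) :: complex mat"
  assumes l: "Factorial_Ring.prime l" and m: "\<not> l dvd m" "m > 0" and Q: "Q = l ^ e * m"
    and P: "P \<in> carrier_mat r r" "P' \<in> carrier_mat r r" "P * P' = 1\<^sub>m r" "P' * P = 1\<^sub>m r"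
      "F y\<^sub>0 = P * diagonal r d * P'"
    and R: "R \<in> carrier_mat r r" "R' \<in> carrier_mat r r" "R * R' = 1\<^sub>m r" "R' * R = 1\<^sub>m r"
      "F y\<^sub>1 = R * diagonal r d' * R'"
    and y: "y\<^sub>0 ^ l = 1" "y\<^sub>1 ^ l = 1" "y\<^sub>0 \<noteq> y\<^sub>1"
    and \<alpha>: "\<alpha> ^ Q = y\<^sub>0" and d': "\<And>i. i < r \<Longrightarrow> d' i ^ Q = y\<^sub>1"
  shows "l ^ e * card {i. i < r \<and> d i = \<alpha>} \<le> card {i. i < r \<and> (d' i / \<alpha>) ^ (l ^ Suc e) = 1}"
proof (rule ccontr)
  define S where "S = {i. i < r \<and> (d' i / \<alpha>) ^ (l ^ Suc e) = 1}"
  define \<mu> where "\<mu> = card {i. i < r \<and> d i = \<alpha>}"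
  define q where "q = l ^ e"
  have S: "finite S" "S \<subseteq> {..<r}" by (auto simp: S_def)
  assume "\<not> ?thesis"
  hence less: "card S < q * \<mu>" by (simp add: S_def \<mu>_def q_def)
  have l0: "l > 0" using l prime_gt_0_nat by blast
  have q0: "q > 0" using l0 by (simp add: q_def)
  define N where "N = Q * l"
  have N: "N > 0" using l0 m by (simp add: N_def Q)
  obtain \<xi> :: complex where \<xi>: "\<And>k. \<xi> ^ k = 1 \<longleftrightarrow> N dvd k" "\<And>z. z ^ N = 1 \<Longrightarrow> \<exists>k<N. z = \<xi> ^ k"
    using primitive_root_of_unity[OF N] by metis
  have \<xi>N: "\<xi> ^ N = 1" using \<xi>(1) by simp
  have mem: "z \<in> int_adjoin \<xi>" if "z ^ N = 1" for z
    using \<xi>(2)[OF that] by auto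
  have \<alpha>N: "\<alpha> ^ N = 1" using \<alpha> y(1) by (simp add: N_def power_mult)
  have d'N: "d' i ^ N = 1" if "i < r" for i using d'[OF that] y(2) by (simp add: N_def power_mult)
  have yN: "y\<^sub>0 ^ N = 1" "y\<^sub>1 ^ N = 1" using y by (simp_all add: N_def mult.commute[of Q l] power_mult)
  have nz: "\<alpha> \<noteq> 0" "y\<^sub>0 \<noteq> 0" using \<alpha>N yN N by (auto simp: power_0_left)
  define \<zeta> where "\<zeta> = y\<^sub>1 / y\<^sub>0"
  have \<zeta>: "\<zeta> ^ l = 1" "\<zeta> \<noteq> 1" "\<zeta> ^ N = 1" using y yN nz by (auto simp: \<zeta>_def power_divide)
  let ?dvd = "adjoin_dvd \<xi>"
  \<comment> \<open>Roots of unity are units, so that differences of roots of unity may be replaced by \<open>1 - z\<close>.\<close>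
  have unit: "?dvd x (z * x)" "?dvd (z * x) x" if "z ^ N = 1" for x z
  proof -
    have "(1 / z) ^ N = 1" "z \<noteq> 0" using that N by (auto simp: power_divide power_0_left)
    thus "?dvd x (z * x)" "?dvd (z * x) x"
      using mem[OF that] mem[of "1 / z"] by (auto intro: adjoin_dvdI[of z] adjoin_dvdI[of "1 / z"])
  qed
  have rho: "?dvd ((d' i - \<alpha>) ^ q) (if i \<in> S then 1 - \<zeta> else of_nat m ^ q)" if i: "i < r" for i
  proof -
    define \<rho> where "\<rho> = d' i / \<alpha>"
    have \<rho>Q: "\<rho> ^ Q = \<zeta>" using d'[OF i] \<alpha> by (simp add: \<rho>_def \<zeta>_def power_divide)
    have \<rho>N: "\<rho> ^ N = 1" using d'N[OF i] \<alpha>N by (simp add: \<rho>_def power_divide)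
    note \<rho> = mem[OF \<rho>N]
    have "(- \<alpha>) * (1 - \<rho>) = d' i - \<alpha>" using nz by (simp add: \<rho>_def field_simps)
    hence "(d' i - \<alpha>) ^ q = (-1) ^ q * (\<alpha> ^ q * (1 - \<rho>) ^ q)"
      by (metis minus_mult_left mult_minus_left power_minus power_mult_distrib)
    moreover have "?dvd ((-1) ^ q * (\<alpha> ^ q * (1 - \<rho>) ^ q)) (\<alpha> ^ q * (1 - \<rho>) ^ q)"
      by (rule adjoin_dvdI[of "(-1) ^ q"])
        (auto simp flip: power_mult_distrib intro!: int_adjoin_power int_adjoin_minus)
    moreover have "?dvd (\<alpha> ^ q * (1 - \<rho>) ^ q) ((1 - \<rho>) ^ q)"
      using \<alpha>N by (intro unit) (metis mult.commute power_mult power_one)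
    ultimately have *: "?dvd ((d' i - \<alpha>) ^ q) ((1 - \<rho>) ^ q)"
      using adjoin_dvd_trans by metis
    show ?thesis
    proof (cases "i \<in> S")
      case True
      hence "\<rho> ^ (l ^ Suc e) = 1" by (simp add: S_def \<rho>_def)
      moreover have "\<rho> ^ (l ^ e) \<noteq> 1" using \<rho>Q \<zeta>(2) by (auto simp: Q power_mult)
      ultimately have a: "?dvd ((1 - \<rho>) ^ q) (1 - \<rho> ^ q)"
        unfolding q_def by (rule one_minus_prime_power_root_of_unity_dvd[OF l \<rho>])
      have b: "?dvd (1 - \<rho> ^ q) (1 - \<zeta>)"
        using one_minus_dvd_one_minus_power[OF int_adjoin_power[OF \<rho>], of q m] \<rho>Q
        by (simp add: Q q_def power_mult)
      show ?thesis using True adjoin_dvd_trans[OF * adjoin_dvd_trans[OF a b]] by simp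
    next
      case False
      hence "\<rho> ^ (l ^ Suc e) \<noteq> 1" using i by (simp add: S_def \<rho>_def)
      moreover have "(\<rho> ^ (l ^ Suc e)) ^ m = 1"
        using \<rho>N by (simp add: N_def Q mult_ac flip: power_mult)
      ultimately have "?dvd (1 - \<rho> ^ (l ^ Suc e)) (of_nat m)"
        by (intro one_minus_root_of_unity_dvd int_adjoin_power \<rho>)
      hence "?dvd (1 - \<rho>) (of_nat m)"
        using one_minus_dvd_one_minus_power[OF \<rho>] adjoin_dvd_trans by blast
      thus ?thesis using False adjoin_dvd_trans[OF * adjoin_dvd_power] by simp
    qed
  qed
  define K where "K = card ({..<r} - S)"
  have "?dvd ((y\<^sub>1 - y\<^sub>0) ^ \<mu>) (det (F y\<^sub>1 - \<alpha> \<cdot>\<^sub>m 1\<^sub>m r))"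
    unfolding F_def \<mu>_def
    by (rule multiplicity_power_dvd_det[where P = P and P' = P', OF _ _ _ _ P(1-4)])
      (use mem yN \<alpha>N P(5) in \<open>auto simp: F_def\<close>)
  also have "det (F y\<^sub>1 - \<alpha> \<cdot>\<^sub>m 1\<^sub>m r) = (\<Prod>i<r. d' i - \<alpha>)"
    unfolding R(5) by (rule det_diagonal_form_minus_scalar[OF R(1-4)])
  finally have "?dvd ((y\<^sub>1 - y\<^sub>0) ^ \<mu>) (\<Prod>i<r. d' i - \<alpha>)" .
  hence "?dvd (((y\<^sub>1 - y\<^sub>0) ^ \<mu>) ^ q) ((\<Prod>i<r. d' i - \<alpha>) ^ q)"
    by (rule adjoin_dvd_power)
  also have "(\<Prod>i<r. d' i - \<alpha>) ^ q = (\<Prod>i<r. (d' i - \<alpha>) ^ q)"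
    by (rule prod_power_distrib)
  also have "?dvd \<dots> (\<Prod>i<r. if i \<in> S then 1 - \<zeta> else of_nat m ^ q)"
    by (rule adjoin_dvd_prod) (simp only: rho lessThan_iff)
  also have "(\<Prod>i<r. if i \<in> S then 1 - \<zeta> else of_nat m ^ q) = (1 - \<zeta>) ^ card S * of_nat m ^ (q * K)"
  proof -
    have "(\<Prod>i<r. if i \<in> S then 1 - \<zeta> else of_nat m ^ q)
        = (\<Prod>i\<in>S. 1 - \<zeta>) * (\<Prod>i\<in>{..<r} - S. of_nat m ^ q)"
      using S by (subst prod.If_cases) (auto simp: Int_absorb1 Diff_eq)
    thus ?thesis by (simp add: K_def power_mult)
  qed
  finally have dvd1: "?dvd (((y\<^sub>1 - y\<^sub>0) ^ \<mu>) ^ q) ((1 - \<zeta>) ^ card S * of_nat m ^ (q * K))" .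
  have "?dvd ((1 - \<zeta>) ^ (q * \<mu>)) (((y\<^sub>1 - y\<^sub>0) ^ \<mu>) ^ q)"
  proof -
    have "y\<^sub>1 - y\<^sub>0 = (- y\<^sub>0) * (1 - \<zeta>)" using nz by (simp add: \<zeta>_def field_simps)
    moreover have "- y\<^sub>0 \<in> int_adjoin \<xi>" using mem yN by auto
    ultimately have "?dvd (1 - \<zeta>) (y\<^sub>1 - y\<^sub>0)" by (intro adjoin_dvdI[of "- y\<^sub>0"]) simp_all
    from adjoin_dvd_power[OF this, of "q * \<mu>"] show ?thesis by (simp add: power_mult mult.commute)
  qed
  from adjoin_dvd_trans[OF this dvd1]
  obtain w where w: "w \<in> int_adjoin \<xi>"
    "(1 - \<zeta>) ^ card S * of_nat m ^ (q * K) = (1 - \<zeta>) ^ (q * \<mu>) * w"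
    by (auto simp: adjoin_dvd_def)
  \<comment> \<open>One factor \<open>1 - \<zeta>\<close> survives cancellation; it divides a power of \<open>m\<close>, and its \<open>l\<close>-th power is
    divisible by \<open>l\<close>.\<close>
  have "q * \<mu> = card S + Suc (q * \<mu> - Suc (card S))" using less by linarith
  hence "(1 - \<zeta>) ^ (q * \<mu>) = (1 - \<zeta>) ^ (card S + Suc (q * \<mu> - Suc (card S)))"
    by (rule arg_cong)
  also have "\<dots> = (1 - \<zeta>) ^ card S * ((1 - \<zeta>) * (1 - \<zeta>) ^ (q * \<mu> - Suc (card S)))"
    by (simp only: power_add power_Suc)
  finally have "(1 - \<zeta>) ^ (q * \<mu>) = \<dots>" .
  hence "of_nat m ^ (q * K) = (1 - \<zeta>) * ((1 - \<zeta>) ^ (q * \<mu> - Suc (card S)) * w)"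
    using w(2) \<zeta>(2) by simp
  hence "?dvd (1 - \<zeta>) (of_nat m ^ (q * K))"
    by (rule adjoin_dvdI[rotated])
      (use w(1) mem[OF \<zeta>(3)] in \<open>intro int_adjoin_mult int_adjoin_power int_adjoin_diff; simp\<close>)
  hence "?dvd ((1 - \<zeta>) ^ l) (of_nat ((m ^ (q * K)) ^ l))"
    using adjoin_dvd_power[of \<xi> "1 - \<zeta>" _ l] by simp
  hence "?dvd (of_nat l) (of_nat ((m ^ (q * K)) ^ l))"
    using prime_dvd_one_minus_root_of_unity_power[OF l mem[OF \<zeta>(3)] \<zeta>(1)] adjoin_dvd_trans by blast
  hence "l dvd (m ^ (q * K)) ^ l"
    by (rule adjoin_dvd_of_nat_imp_dvd[OF \<xi>N N]) (rule l0)
  hence "l dvd m" using l prime_dvd_power by metis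
  thus False using m by simp
qed

lemma sum_roots_of_unity_power:
  assumes "l > 0" "0 < i" "i < l"
  shows "(\<Sum>y | y ^ l = (1::complex). y ^ i) = 0"
proof -
  obtain \<omega> :: complex where \<omega>: "\<And>k. \<omega> ^ k = 1 \<longleftrightarrow> l dvd k"
    using primitive_root_of_unity[OF assms(1)] by metis
  have \<omega>0: "\<omega> \<noteq> 0" "\<omega> ^ l = 1" using \<omega>[of l] assms(1) by (auto simp: power_0_left)
  have "(\<Sum>y | y ^ l = 1. y ^ i) = (\<Sum>y | y ^ l = 1. (\<omega> * y) ^ i)"
    by (rule sum.reindex_bij_witness[of _ "\<lambda>y. \<omega> * y" "\<lambda>y. y / \<omega>"])
      (use \<omega>0 in \<open>auto simp: power_mult_distrib power_divide\<close>)
  also have "\<dots> = \<omega> ^ i * (\<Sum>y | y ^ l = 1. y ^ i)"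
    by (simp add: power_mult_distrib sum_distrib_left)
  finally have "(1 - \<omega> ^ i) * (\<Sum>y | y ^ l = 1. y ^ i) = 0" by (simp add: algebra_simps)
  moreover have "\<omega> ^ i \<noteq> 1" using \<omega> assms by (auto dest: dvd_imp_le)
  ultimately show ?thesis by simp
qed

text \<open>The matrices \<open>F y\<close> are the specializations of one matrix over \<open>\<int>[X] / (X ^ l - 1)\<close> whose \<open>Q\<close>-th power is
  \<open>X\<close>.  Their eigenvalues are roots of unity \<open>\<alpha>\<close>, each belonging to \<open>y = \<alpha> ^ Q\<close>.  Call two of them related if
  their quotient has order dividing \<open>l ^ Suc e\<close>, where \<open>q = l ^ e\<close> is the \<open>l\<close>-part of \<open>Q\<close>.  At every \<open>y\<close>
  there are at most \<open>q\<close> numbers related to \<open>\<alpha>\<close>, so if \<open>\<alpha>\<close> has maximal multiplicity among its relatives, the bound on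
  multiplicities is attained, and all relatives of \<open>\<alpha>\<close> have the same multiplicity.  In particular, multiplicities do not
  change under multiplication by a root of unity \<open>\<eta>\<close> of order \<open>l ^ Suc e\<close>, and the sum of all eigenvalues is
  \<open>\<eta>\<close> times itself.  This sum is \<open>l\<close> times the trace of the constant term.\<close>

theorem trace_constant_term_eq_0:
  fixes c :: "nat \<Rightarrow> nat \<Rightarrow> nat \<Rightarrow> int" and r l Q :: nat
  defines "F \<equiv> \<lambda>y. mat r r (\<lambda>(a, b). \<Sum>i<l. y ^ i * of_int (c i a b)) :: complex mat"
  assumes l: "Factorial_Ring.prime l" and Q: "Q > 0"
    and pow: "\<And>y. y ^ l = 1 \<Longrightarrow> F y ^\<^sub>m Q = y \<cdot>\<^sub>m 1\<^sub>m r"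
  shows "(\<Sum>a<r. c 0 a a) = 0"
proof -
  have l0: "l > 0" using l prime_gt_0_nat by blast
  define e where "e = multiplicity l Q"
  have "Q \<noteq> 0" "\<not> is_unit l" using Q not_prime_unit[of l] l by auto
  then obtain m where m: "Q = l ^ e * m" "\<not> l dvd m"
    unfolding e_def by (rule multiplicity_decompose')
  have m0: "m > 0" using m Q by (cases m) auto
  define q where "q = l ^ e"
  define Y where "Y = {y::complex. y ^ l = 1}"
  have finY: "finite Y" unfolding Y_def by (rule finite_roots_unity) (use l0 in simp)
  have F: "F y \<in> carrier_mat r r" for y by (simp add: F_def)
  define eigenform where "eigenform y P P' d \<longleftrightarrow> P \<in> carrier_mat r r \<and> P' \<in> carrier_mat r r \<and>
      P * P' = 1\<^sub>m r \<and> P' * P = 1\<^sub>m r \<and> F y = P * diagonal r d * P' \<and> (\<forall>i<r. d i ^ Q = y)"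
    for y P P' d
  have "\<exists>P P' d. eigenform y P P' d" if "y \<in> Y" for y
  proof -
    have yl: "y ^ l = 1" using that by (simp add: Y_def)
    hence "y \<noteq> 0" using l0 by (auto simp: power_0_left)
    then obtain P P' d where "P \<in> carrier_mat r r" "P' \<in> carrier_mat r r" "P * P' = 1\<^sub>m r"
      "P' * P = 1\<^sub>m r" "F y = P * diagonal r d * P'" "\<forall>i<r. d i ^ Q = y"
      by (rule root_of_scalar_diagonalizable[OF F pow[OF yl] Q])
    hence "eigenform y P P' d" by (simp add: eigenform_def)
    thus ?thesis by (intro exI)
  qed
  then obtain P P' d where "\<And>y. y \<in> Y \<Longrightarrow> eigenform y (P y) (P' y) (d y)"
    by metis
  hence D: "\<And>y. y \<in> Y \<Longrightarrow> P y \<in> carrier_mat r r" "\<And>y. y \<in> Y \<Longrightarrow> P' y \<in> carrier_mat r r"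
    "\<And>y. y \<in> Y \<Longrightarrow> P y * P' y = 1\<^sub>m r" "\<And>y. y \<in> Y \<Longrightarrow> P' y * P y = 1\<^sub>m r"
    "\<And>y. y \<in> Y \<Longrightarrow> F y = P y * diagonal r (d y) * P' y"
    and d: "\<And>y i. y \<in> Y \<Longrightarrow> i < r \<Longrightarrow> d y i ^ Q = y"
    by (simp_all add: eigenform_def)
  define U where "U = {\<alpha>::complex. \<alpha> ^ Q \<in> Y}"
  have U: "U = {\<alpha>. \<alpha> ^ (Q * l) = 1}" by (auto simp: U_def Y_def power_mult)
  have finU: "finite U" unfolding U by (rule finite_roots_unity) (use l0 Q in simp)
  have U0: "\<alpha> \<noteq> 0" if "\<alpha> \<in> U" for \<alpha> using that l0 Q by (auto simp: U power_0_left)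
  define \<mu> where "\<mu> \<alpha> = card {i. i < r \<and> d (\<alpha> ^ Q) i = \<alpha>}" for \<alpha>
  define rel where "rel \<alpha> \<beta> \<longleftrightarrow> (\<beta> / \<alpha>) ^ (l ^ Suc e) = 1" for \<alpha> \<beta> :: complex
  have rel_sym: "rel \<beta> \<alpha>" if "rel \<alpha> \<beta>" for \<alpha> \<beta>
    using that unfolding rel_def by (simp add: power_divide)
  have rel_trans: "rel \<alpha> \<gamma>" if "rel \<alpha> \<beta>" "rel \<beta> \<gamma>" for \<alpha> \<beta> \<gamma>
    using that unfolding rel_def by (simp add: power_divide)
  define C where "C \<alpha> z = {\<beta>\<in>U. \<beta> ^ Q = z \<and> rel \<alpha> \<beta>}" for \<alpha> z
  have finC: "finite (C \<alpha> z)" for \<alpha> z using finU by (simp add: C_def)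
  have bound: "q * \<mu> \<alpha> \<le> (\<Sum>\<beta>\<in>C \<alpha> z. \<mu> \<beta>)" if \<alpha>: "\<alpha> \<in> U" and z: "z \<in> Y" "z \<noteq> \<alpha> ^ Q" for \<alpha> z
  proof -
    have \<alpha>Y: "\<alpha> ^ Q \<in> Y" using \<alpha> by (simp add: U_def)
    have "q * \<mu> \<alpha> \<le> card {i. i < r \<and> (d z i / \<alpha>) ^ (l ^ Suc e) = 1}"
      unfolding q_def \<mu>_def
      by (rule multiplicity_bound[where c = c and m = m and Q = Q, OF l m(2) m0 m(1)
            D(1-4)[OF \<alpha>Y] D(5)[OF \<alpha>Y, unfolded F_def] D(1-4)[OF z(1)] D(5)[OF z(1), unfolded F_def]])
        (use \<alpha>Y z d in \<open>auto simp: Y_def\<close>)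
    also have "{i. i < r \<and> (d z i / \<alpha>) ^ (l ^ Suc e) = 1} = (\<Union>\<beta>\<in>C \<alpha> z. {i. i < r \<and> d z i = \<beta>})"
      using d[OF z(1)] z(1) by (auto simp: C_def U_def rel_def)
    also have "card \<dots> = (\<Sum>\<beta>\<in>C \<alpha> z. card {i. i < r \<and> d z i = \<beta>})"
      by (rule card_UN_disjoint) (use finC in auto)
    also have "\<dots> = (\<Sum>\<beta>\<in>C \<alpha> z. \<mu> \<beta>)"
      by (rule sum.cong) (auto simp: C_def \<mu>_def)
    finally show ?thesis .
  qed
  have "Rings.coprime l m" using prime_imp_coprime[OF l m(2)] .
  hence gcd: "gcd Q (l ^ Suc e) = q"
    by (simp add: m(1) q_def gcd_mult_distrib_nat[symmetric] mult.commute[of l] coprime_iff_gcd_eq_1 gcd.commute)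
  have cardC: "card (C \<alpha> z) \<le> q" if "\<alpha> \<in> U" for \<alpha> z
  proof (cases "C \<alpha> z = {}")
    case False
    then obtain \<beta>\<^sub>0 where \<beta>\<^sub>0: "\<beta>\<^sub>0 \<in> C \<alpha> z" by auto
    hence nz: "\<beta>\<^sub>0 \<noteq> 0" using U0 by (auto simp: C_def)
    have "(\<lambda>\<beta>. \<beta> / \<beta>\<^sub>0) ` C \<alpha> z \<subseteq> {z. z ^ q = 1}"
    proof safe
      fix \<beta> assume \<beta>: "\<beta> \<in> C \<alpha> z"
      have "(\<beta> / \<beta>\<^sub>0) ^ Q = 1" using \<beta> \<beta>\<^sub>0 nz by (auto simp: C_def power_divide)
      moreover have "(\<beta> / \<beta>\<^sub>0) ^ (l ^ Suc e) = 1"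
        using rel_trans[OF rel_sym, of \<alpha> \<beta>\<^sub>0 \<beta>] \<beta> \<beta>\<^sub>0 by (auto simp: C_def rel_def)
      ultimately show "(\<beta> / \<beta>\<^sub>0) ^ q = 1" using power_gcd_eq_1 unfolding gcd[symmetric] by blast
    qed
    moreover have "inj_on (\<lambda>\<beta>. \<beta> / \<beta>\<^sub>0) (C \<alpha> z)" using nz by (auto intro!: inj_onI)
    moreover have "q > 0" using l0 by (simp add: q_def)
    ultimately show ?thesis
      using card_inj_on_le[OF _ _ finite_roots_unity] card_roots_unity_eq[of q] by (metis Suc_leI One_nat_def)
  qed simp
  have max_eq: "\<mu> \<beta> = \<mu> \<alpha>" if \<alpha>: "\<alpha> \<in> U" and max: "\<And>\<gamma>. \<gamma> \<in> U \<Longrightarrow> rel \<alpha> \<gamma> \<Longrightarrow> \<mu> \<gamma> \<le> \<mu> \<alpha>"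
    and \<beta>: "\<beta> \<in> U" "rel \<alpha> \<beta>" "\<beta> ^ Q \<noteq> \<alpha> ^ Q" for \<alpha> \<beta>
  proof (rule ccontr)
    assume ne: "\<mu> \<beta> \<noteq> \<mu> \<alpha>"
    let ?C = "C \<alpha> (\<beta> ^ Q)"
    have "(\<Sum>\<gamma>\<in>?C. \<mu> \<gamma>) < (\<Sum>\<gamma>\<in>?C. \<mu> \<alpha>)"
    proof (rule sum_strict_mono_ex1[OF finC])
      show "\<forall>\<gamma>\<in>?C. \<mu> \<gamma> \<le> \<mu> \<alpha>" using max by (auto simp: C_def)
      have "\<mu> \<beta> < \<mu> \<alpha>" using ne max[OF \<beta>(1,2)] by simp
      thus "\<exists>\<gamma>\<in>?C. \<mu> \<gamma> < \<mu> \<alpha>" using \<beta> by (auto simp: C_def)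
    qed
    also have "\<dots> \<le> q * \<mu> \<alpha>" using cardC[OF \<alpha>] by simp
    also have "\<dots> \<le> (\<Sum>\<gamma>\<in>?C. \<mu> \<gamma>)" using bound[OF \<alpha>] \<beta> by (simp add: U_def)
    finally show False by simp
  qed
  obtain \<eta> :: complex where \<eta>: "\<And>k. \<eta> ^ k = 1 \<longleftrightarrow> l ^ Suc e dvd k"
    using primitive_root_of_unity[of "l ^ Suc e"] l0 by (metis zero_less_power)
  have \<eta>1: "\<eta> ^ (l ^ Suc e) = 1" using \<eta> by simp
  have \<eta>Q: "\<eta> ^ Q \<noteq> 1" using \<eta> m l0 by (simp add: mult.commute[of l])
  have "\<eta> ^ (Q * l) = 1" using \<eta> by (simp add: m(1) mult_ac)
  hence \<eta>U: "\<eta> \<in> U" by (simp add: U)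
  have \<eta>0: "\<eta> \<noteq> 0" using U0[OF \<eta>U] .
  have mult\<eta>: "\<eta> * \<alpha> \<in> U" "rel \<alpha> (\<eta> * \<alpha>)" "(\<eta> * \<alpha>) ^ Q \<noteq> \<alpha> ^ Q" if "\<alpha> \<in> U" for \<alpha>
    using that \<eta>U U0[OF that] \<eta>1 \<eta>Q by (auto simp: U rel_def power_mult_distrib)
  have \<mu>\<eta>: "\<mu> (\<eta> * \<alpha>) = \<mu> \<alpha>" if \<alpha>: "\<alpha> \<in> U" for \<alpha>
  proof -
    define T where "T = {\<beta>\<in>U. rel \<alpha> \<beta>}"
    have "finite (\<mu> ` T)" "\<mu> ` T \<noteq> {}" using finU \<alpha> U0[OF \<alpha>] by (auto simp: T_def rel_def)
    from Max_in[OF this] Max_ge[OF this(1)]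
    obtain \<alpha>' where \<alpha>': "\<alpha>' \<in> T" "\<And>\<beta>. \<beta> \<in> T \<Longrightarrow> \<mu> \<beta> \<le> \<mu> \<alpha>'" by force
    have rT: "\<beta> \<in> T" if "\<gamma> \<in> T" "\<beta> \<in> U" "rel \<gamma> \<beta>" for \<beta> \<gamma>
      using that rel_trans by (auto simp: T_def)
    have \<alpha>'U: "\<alpha>' \<in> U" using \<alpha>' by (simp add: T_def)
    note \<gamma> = mult\<eta>[OF \<alpha>'U]
    have \<mu>\<gamma>: "\<mu> (\<eta> * \<alpha>') = \<mu> \<alpha>'"
      by (rule max_eq[OF \<alpha>'U _ \<gamma>]) (use \<alpha>' rT in blast)
    have \<gamma>T: "\<eta> * \<alpha>' \<in> T" using rT[OF \<alpha>'(1) \<gamma>(1,2)] .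
    have "\<mu> \<beta> = \<mu> \<alpha>'" if \<beta>: "\<beta> \<in> T" for \<beta>
    proof -
      have \<beta>': "\<beta> \<in> U" "rel \<alpha> \<beta>" using \<beta> by (simp_all add: T_def)
      have r: "rel \<gamma> \<beta>" if "\<gamma> \<in> T" for \<gamma>
        using that rel_trans[OF rel_sym \<beta>'(2)] by (simp add: T_def)
      show ?thesis
      proof (cases "\<beta> ^ Q = \<alpha>' ^ Q")
        case False
        show ?thesis
          by (rule max_eq[OF \<alpha>'U _ \<beta>'(1) r[OF \<alpha>'(1)] False]) (rule \<alpha>'(2)[OF rT[OF \<alpha>'(1)]])
      next
        case True
        hence "\<beta> ^ Q \<noteq> (\<eta> * \<alpha>') ^ Q" using \<gamma>(3) by simp
        hence "\<mu> \<beta> = \<mu> (\<eta> * \<alpha>')"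
          by (intro max_eq[OF \<gamma>(1) _ \<beta>'(1) r[OF \<gamma>T]]) (unfold \<mu>\<gamma>, rule \<alpha>'(2)[OF rT[OF \<gamma>T]])
        thus ?thesis using \<mu>\<gamma> by simp
      qed
    qed
    moreover have "\<alpha> \<in> T" using \<alpha> U0[OF \<alpha>] by (simp add: T_def rel_def)
    moreover from rT[OF this mult\<eta>(1,2)[OF \<alpha>]] have "\<eta> * \<alpha> \<in> T" .
    ultimately show ?thesis by metis
  qed
  have zero: "(\<Sum>\<alpha>\<in>U. of_nat (\<mu> \<alpha>) * \<alpha>) = 0"
  proof -
    have "(\<Sum>\<alpha>\<in>U. of_nat (\<mu> \<alpha>) * \<alpha>) = (\<Sum>\<alpha>\<in>U. of_nat (\<mu> (\<eta> * \<alpha>)) * (\<eta> * \<alpha>))"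
      by (rule sum.reindex_bij_witness[of _ "\<lambda>\<alpha>. \<eta> * \<alpha>" "\<lambda>\<alpha>. \<alpha> / \<eta>"])
        (use \<eta>U \<eta>0 in \<open>auto simp: U power_mult_distrib power_divide\<close>)
    also have "\<dots> = \<eta> * (\<Sum>\<alpha>\<in>U. of_nat (\<mu> \<alpha>) * \<alpha>)"
      unfolding sum_distrib_left by (rule sum.cong[OF refl]) (simp add: \<mu>\<eta>)
    finally have "(1 - \<eta>) * (\<Sum>\<alpha>\<in>U. of_nat (\<mu> \<alpha>) * \<alpha>) = 0" by (simp add: algebra_simps)
    moreover have "\<eta> \<noteq> 1" using \<eta>Q by auto
    ultimately show ?thesis by simp
  qed
  have "(\<Sum>a<r. F y $$ (a, a)) = (\<Sum>\<alpha>\<in>{\<alpha>\<in>U. \<alpha> ^ Q = y}. of_nat (\<mu> \<alpha>) * \<alpha>)" if y: "y \<in> Y" for y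
  proof -
    have "(\<Sum>a<r. F y $$ (a, a)) = (\<Sum>i<r. d y i)"
      unfolding D(5)[OF y] by (rule trace_diagonal_form[OF D(1,2,4)[OF y]])
    also have "\<dots> = (\<Sum>\<alpha>\<in>{\<alpha>\<in>U. \<alpha> ^ Q = y}. \<Sum>i\<in>{i\<in>{..<r}. d y i = \<alpha>}. d y i)"
      by (rule sum.group[symmetric]) (use finU d[OF y] y in \<open>auto simp: U_def\<close>)
    also have "\<dots> = (\<Sum>\<alpha>\<in>{\<alpha>\<in>U. \<alpha> ^ Q = y}. of_nat (\<mu> \<alpha>) * \<alpha>)"
      by (rule sum.cong) (auto simp: \<mu>_def)
    finally show ?thesis .
  qed
  hence "(\<Sum>y\<in>Y. \<Sum>a<r. F y $$ (a, a)) = (\<Sum>y\<in>Y. \<Sum>\<alpha>\<in>{\<alpha>\<in>U. \<alpha> ^ Q = y}. of_nat (\<mu> \<alpha>) * \<alpha>)"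
    by simp
  also have "\<dots> = 0"
    unfolding zero[symmetric] by (rule sum.group) (use finU finY in \<open>auto simp: U_def\<close>)
  finally have "(\<Sum>y\<in>Y. \<Sum>a<r. \<Sum>i<l. y ^ i * of_int (c i a a)) = 0"
    by (simp add: F_def)
  moreover have "(\<Sum>y\<in>Y. \<Sum>a<r. \<Sum>i<l. y ^ i * of_int (c i a a)) = of_nat l * of_int (\<Sum>a<r. c 0 a a)"
  proof -
    have "(\<Sum>y\<in>Y. \<Sum>a<r. \<Sum>i<l. y ^ i * of_int (c i a a))
        = (\<Sum>a<r. \<Sum>i<l. (\<Sum>y\<in>Y. y ^ i) * of_int (c i a a))"
      by (subst sum.swap, intro sum.cong refl, subst sum.swap) (simp add: sum_distrib_right)
    also have "\<dots> = (\<Sum>a<r. \<Sum>i<l. if i = 0 then of_nat l * of_int (c 0 a a) else 0)"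
      using sum_roots_of_unity_power[OF l0] card_roots_unity_eq[OF l0]
      by (intro sum.cong refl) (auto simp: Y_def)
    also have "\<dots> = of_nat l * of_int (\<Sum>a<r. c 0 a a)"
      using l0 by (simp add: sum_distrib_left)
    finally show ?thesis .
  qed
  ultimately have "complex_of_nat l * of_int (\<Sum>a<r. c 0 a a) = 0" by (simp only:)
  thus ?thesis using l0 by (simp only: mult_eq_0_iff of_int_eq_0_iff of_nat_eq_0_iff) simp
qed

section \<open>Induced representations of the integral group ring\<close>

lemma sum_periodic_shift:
  fixes u :: "nat \<Rightarrow> 'a::comm_monoid_add"
  assumes "\<And>n. u (n + c) = u n"
  shows "(\<Sum>n<c. u (n + i)) = (\<Sum>n<c. u n)"
proof (induction i)
  case (Suc i)
  have "(\<Sum>n<c. u (Suc n + i)) = (\<Sum>n<c. u (n + i))"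
  proof (cases c)
    case (Suc c')
    have "(\<Sum>n<Suc c'. u (Suc n + i)) = (\<Sum>n<c'. u (Suc n + i)) + u (i + c)"
      by (simp add: Suc add.commute)
    also have "u (i + c) = u (0 + i)" using assms[of i] by simp
    also have "(\<Sum>n<c'. u (Suc n + i)) + u (0 + i) = (\<Sum>n<Suc c'. u (n + i))"
      by (subst sum.lessThan_Suc_shift) (simp add: add.commute)
    finally show ?thesis by (simp add: Suc)
  qed simp
  thus ?case using Suc by simp
qed simp

lemma sum_periodic_reflect:
  fixes u :: "nat \<Rightarrow> 'a::comm_monoid_add"
  assumes "\<And>n. u (n + c) = u n"
  shows "(\<Sum>n<c. u (c - n)) = (\<Sum>n<c. u n)"
proof -
  have "(\<Sum>n<c. u (c - n)) = (\<Sum>n<c. u (Suc (c - Suc n)))"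
    by (rule sum.cong) (auto simp: Suc_diff_Suc)
  also have "\<dots> = (\<Sum>n<c. u (Suc n))" by (rule sum.nat_diff_reindex)
  also have "\<dots> = (\<Sum>n<c. u n)" using sum_periodic_shift[of u c 1, OF assms] by simp
  finally show ?thesis .
qed

lemma (in group) inv_mult_cancel_left [simp]:
  assumes "x \<in> carrier G" "y \<in> carrier G"
  shows "inv x \<otimes> (x \<otimes> y) = y" "x \<otimes> (inv x \<otimes> y) = y"
  using assms by (simp_all add: m_assoc[symmetric])

lemma (in group) mult_inv_eq_one_iff:
  assumes "x \<in> carrier G" "y \<in> carrier G"
  shows "x \<otimes> inv y = \<one> \<longleftrightarrow> x = y"
  using assms by (metis inv_solve_right' l_one one_closed)

lemma sum_triple_swap:
  fixes a :: "nat \<Rightarrow> 'a::comm_semiring_0"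
  shows "(\<Sum>n<c. a n * (\<Sum>k<r. \<Sum>i<c. f k i * g n k i)) = (\<Sum>k<r. \<Sum>i<c. f k i * (\<Sum>n<c. a n * g n k i))"
proof -
  have "(\<Sum>n<c. a n * (\<Sum>k<r. \<Sum>i<c. f k i * g n k i)) = (\<Sum>n<c. \<Sum>k<r. \<Sum>i<c. f k i * (a n * g n k i))"
    by (simp add: sum_distrib_left mult_ac)
  also have "\<dots> = (\<Sum>k<r. \<Sum>n<c. \<Sum>i<c. f k i * (a n * g n k i))" by (rule sum.swap)
  also have "\<dots> = (\<Sum>k<r. \<Sum>i<c. \<Sum>n<c. f k i * (a n * g n k i))"
    by (rule sum.cong[OF refl]) (rule sum.swap)
  finally show ?thesis by (simp add: sum_distrib_left)
qed

text \<open>The representatives \<open>t k\<close> of the left cosets of \<open>\<langle>z\<rangle>\<close> form a basis of the group algebra as a free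
  right module over the algebra of \<open>\<langle>z\<rangle>\<close>.\<close>

locale cyclic_coset_reps = group G for G (structure) +
  fixes z :: 'a and c r :: nat and t :: "nat \<Rightarrow> 'a"
  assumes finite_carrier: "finite (carrier G)"
    and z_closed [simp]: "z \<in> carrier G"
    and t_closed [simp]: "\<And>k. k < r \<Longrightarrow> t k \<in> carrier G"
    and z_pow_c: "z [^] c = \<one>" and c_pos: "c > 0"
    and reps_bij: "bij_betw (\<lambda>(k, i). t k \<otimes> z [^] i) ({..<r} \<times> {..<c}) (carrier G)"
begin

lemma reps_inj:
  "k < r \<Longrightarrow> k' < r \<Longrightarrow> i < c \<Longrightarrow> i' < c \<Longrightarrow> t k \<otimes> z [^] i = t k' \<otimes> z [^] i' \<longleftrightarrow> k = k' \<and> i = i'"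
  using bij_betw_imp_inj_on[OF reps_bij] unfolding inj_on_def by auto

lemma sum_carrier_reps: "(\<Sum>g\<in>carrier G. f g) = (\<Sum>k<r. \<Sum>i<c. f (t k \<otimes> z [^] i))"
  by (subst sum.reindex_bij_betw[OF reps_bij, symmetric])
    (simp add: sum.cartesian_product case_prod_unfold)

lemma order_eq: "Coset.order G = r * c"
  using bij_betw_same_card[OF reps_bij] by (simp add: Coset.order_def)

lemma z_pow_periodic: "z [^] (n + c) = z [^] n"
  by (simp add: nat_pow_mult[symmetric] z_pow_c)

text \<open>For \<open>y ^ c = 1\<close> and \<open>b\<close> commuting with \<open>z\<close>, this is the matrix of \<open>v \<mapsto> x v b\<inverse>\<close> on the complex group
  algebra tensored over the algebra of \<open>\<langle>z\<rangle>\<close> with the one-dimensional module on which \<open>z\<close> acts as \<open>y\<close>.\<close>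

definition coset_matrix :: "'a \<Rightarrow> ('a \<Rightarrow>\<^sub>0 int) \<Rightarrow> complex \<Rightarrow> complex mat" where
  "coset_matrix b x y = mat r r (\<lambda>(k, k').
    \<Sum>i<c. y ^ i * of_int (Poly_Mapping.lookup x (t k \<otimes> z [^] i \<otimes> b \<otimes> inv (t k'))))"

lemma coset_matrix_carrier [simp]: "coset_matrix b x y \<in> carrier_mat r r"
  by (simp add: coset_matrix_def)

text \<open>The substitution \<open>h = t k b g\<inverse>\<close> in the coefficient \<open>\<Sum> x h * x' (h\<inverse> \<dots>)\<close> of the product, with
  \<open>g = t k' z ^ i\<close>, separates the two factors, since shifting the exponent of \<open>z\<close> amounts to a power of \<open>y\<close>.\<close>

lemma coset_matrix_mult:
  assumes b: "b \<in> carrier G" "b \<otimes> z = z \<otimes> b" and b': "b' \<in> carrier G"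
    and x: "Poly_Mapping.keys x \<subseteq> carrier G" "Poly_Mapping.keys x' \<subseteq> carrier G" and y: "y ^ c = 1"
  shows "coset_matrix b x y * coset_matrix b' x' y
    = coset_matrix (b \<otimes> b') (x \<otimes>\<^bsub>integral_group_ring G\<^esub> x') y"
proof (rule eq_matI)
  let ?X = "\<lambda>g. complex_of_int (Poly_Mapping.lookup x g)"
  let ?X' = "\<lambda>g. complex_of_int (Poly_Mapping.lookup x' g)"
  fix k k'' assume "k < dim_row (coset_matrix (b \<otimes> b') (x \<otimes>\<^bsub>integral_group_ring G\<^esub> x') y)"
    "k'' < dim_col (coset_matrix (b \<otimes> b') (x \<otimes>\<^bsub>integral_group_ring G\<^esub> x') y)"
  hence k: "k < r" "k'' < r" by (simp_all add: coset_matrix_def)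
  have y0: "y \<noteq> 0" using y c_pos by (auto simp: power_0_left)
  have yper: "y ^ (n + c) = y ^ n" for n by (simp add: power_add y)
  have bz: "b \<otimes> z [^] i = z [^] i \<otimes> b" for i :: nat
    by (rule group_commutes_pow[OF b(2)[symmetric] z_closed b(1), symmetric])
  have coeff: "Poly_Mapping.lookup (x \<otimes>\<^bsub>integral_group_ring G\<^esub> x') (t k \<otimes> z [^] n \<otimes> (b \<otimes> b') \<otimes> inv (t k''))
      = (\<Sum>k'<r. \<Sum>i<c. Poly_Mapping.lookup x (t k \<otimes> inv (z [^] i) \<otimes> b \<otimes> inv (t k'))
          * Poly_Mapping.lookup x' (t k' \<otimes> z [^] (n + i) \<otimes> b' \<otimes> inv (t k'')))" for n :: nat
  proof -
    let ?h = "\<lambda>g. t k \<otimes> b \<otimes> inv g"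
    let ?g = "t k \<otimes> z [^] n \<otimes> (b \<otimes> b') \<otimes> inv (t k'')"
    have h: "bij_betw ?h (carrier G) (carrier G)"
      by (rule bij_betw_byWitness[where f' = "\<lambda>h. inv h \<otimes> t k \<otimes> b"])
        (use k b in \<open>auto simp: m_assoc inv_mult_group\<close>)
    have "Poly_Mapping.lookup (x \<otimes>\<^bsub>integral_group_ring G\<^esub> x') ?g
        = (\<Sum>h\<in>carrier G. Poly_Mapping.lookup x h * Poly_Mapping.lookup x' (inv h \<otimes> ?g))"
      using k b b' by (intro lookup_integral_group_ring_mult[OF finite_carrier x]) simp
    also have "\<dots> = (\<Sum>g\<in>carrier G. Poly_Mapping.lookup x (?h g) * Poly_Mapping.lookup x' (inv (?h g) \<otimes> ?g))"
      by (rule sum.reindex_bij_betw[OF h, symmetric])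
    also have "\<dots> = (\<Sum>k'<r. \<Sum>i<c. Poly_Mapping.lookup x (?h (t k' \<otimes> z [^] i))
        * Poly_Mapping.lookup x' (inv (?h (t k' \<otimes> z [^] i)) \<otimes> ?g))"
      by (rule sum_carrier_reps)
    also have "\<dots> = (\<Sum>k'<r. \<Sum>i<c. Poly_Mapping.lookup x (t k \<otimes> inv (z [^] i) \<otimes> b \<otimes> inv (t k'))
          * Poly_Mapping.lookup x' (t k' \<otimes> z [^] (n + i) \<otimes> b' \<otimes> inv (t k'')))"
    proof (intro sum.cong refl)
      fix k' i assume "k' \<in> {..<r}" "i \<in> {..<c}"
      hence k': "k' < r" by simp
      have "b \<otimes> inv (z [^] i) = inv (z [^] i) \<otimes> b"
        using bz[of i] b by (metis inv_solve_left' inv_solve_right m_assoc nat_pow_closed z_closed inv_closed m_closed)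
      hence e1: "?h (t k' \<otimes> z [^] i) = t k \<otimes> inv (z [^] i) \<otimes> b \<otimes> inv (t k')"
        using k k' b by (simp add: inv_mult_group m_assoc) (simp add: m_assoc[symmetric])
      have "inv (?h (t k' \<otimes> z [^] i)) \<otimes> ?g
          = t k' \<otimes> z [^] i \<otimes> inv b \<otimes> (z [^] n \<otimes> b) \<otimes> b' \<otimes> inv (t k'')"
        using k k' b b' by (simp add: inv_mult_group m_assoc)
      also have "z [^] n \<otimes> b = b \<otimes> z [^] n" using bz by simp
      also have "t k' \<otimes> z [^] i \<otimes> inv b \<otimes> (b \<otimes> z [^] n) \<otimes> b' \<otimes> inv (t k'')
          = t k' \<otimes> (z [^] i \<otimes> z [^] n) \<otimes> b' \<otimes> inv (t k'')"
        using k k' b b' by (simp add: m_assoc)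
      also have "z [^] i \<otimes> z [^] n = z [^] (n + i)" by (simp add: nat_pow_mult add.commute)
      finally show "Poly_Mapping.lookup x (?h (t k' \<otimes> z [^] i))
          * Poly_Mapping.lookup x' (inv (?h (t k' \<otimes> z [^] i)) \<otimes> ?g)
        = Poly_Mapping.lookup x (t k \<otimes> inv (z [^] i) \<otimes> b \<otimes> inv (t k'))
          * Poly_Mapping.lookup x' (t k' \<otimes> z [^] (n + i) \<otimes> b' \<otimes> inv (t k''))"
        unfolding e1 by simp
    qed
    finally show ?thesis .
  qed
  have shift: "(\<Sum>n<c. y ^ n * ?X' (t k' \<otimes> z [^] (n + i) \<otimes> b' \<otimes> inv (t k'')))
      = inverse (y ^ i) * (\<Sum>n<c. y ^ n * ?X' (t k' \<otimes> z [^] n \<otimes> b' \<otimes> inv (t k'')))" for k' i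
  proof -
    let ?u = "\<lambda>n. y ^ n * ?X' (t k' \<otimes> z [^] n \<otimes> b' \<otimes> inv (t k''))"
    have "(\<Sum>n<c. y ^ n * ?X' (t k' \<otimes> z [^] (n + i) \<otimes> b' \<otimes> inv (t k''))) = (\<Sum>n<c. inverse (y ^ i) * ?u (n + i))"
      using y0 by (intro sum.cong) (simp_all add: power_add)
    also have "\<dots> = inverse (y ^ i) * (\<Sum>n<c. ?u (n + i))" by (simp only: sum_distrib_left)
    also have "(\<Sum>n<c. ?u (n + i)) = (\<Sum>n<c. ?u n)"
      by (rule sum_periodic_shift) (simp add: z_pow_periodic yper)
    finally show ?thesis .
  qed
  have reflect: "(\<Sum>i<c. inverse (y ^ i) * ?X (t k \<otimes> inv (z [^] i) \<otimes> b \<otimes> inv (t k')))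
      = (\<Sum>i<c. y ^ i * ?X (t k \<otimes> z [^] i \<otimes> b \<otimes> inv (t k')))" for k'
  proof -
    let ?u = "\<lambda>n. y ^ n * ?X (t k \<otimes> z [^] n \<otimes> b \<otimes> inv (t k'))"
    have "inverse (y ^ i) * ?X (t k \<otimes> inv (z [^] i) \<otimes> b \<otimes> inv (t k')) = ?u (c - i)" if "i < c" for i
    proof -
      have "z [^] (c - i) \<otimes> z [^] i = \<one>" using that by (simp add: nat_pow_mult z_pow_c)
      hence "inv (z [^] i) = z [^] (c - i)" by (intro inv_equality) simp_all
      moreover have "y ^ (c - i) * y ^ i = 1" using that y by (simp flip: power_add)
      hence "inverse (y ^ i) = y ^ (c - i)" by (metis inverse_unique mult.commute)
      ultimately show ?thesis by simp
    qed
    hence "(\<Sum>i<c. inverse (y ^ i) * ?X (t k \<otimes> inv (z [^] i) \<otimes> b \<otimes> inv (t k'))) = (\<Sum>i<c. ?u (c - i))"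
      by (intro sum.cong) auto
    also have "\<dots> = (\<Sum>i<c. ?u i)"
      by (rule sum_periodic_reflect) (simp add: z_pow_periodic yper)
    finally show ?thesis .
  qed
  have "coset_matrix (b \<otimes> b') (x \<otimes>\<^bsub>integral_group_ring G\<^esub> x') y $$ (k, k'')
      = (\<Sum>n<c. y ^ n * (\<Sum>k'<r. \<Sum>i<c. ?X (t k \<otimes> inv (z [^] i) \<otimes> b \<otimes> inv (t k'))
          * ?X' (t k' \<otimes> z [^] (n + i) \<otimes> b' \<otimes> inv (t k''))))"
    using k by (simp add: coset_matrix_def coeff)
  also have "\<dots> = (\<Sum>k'<r. \<Sum>i<c. ?X (t k \<otimes> inv (z [^] i) \<otimes> b \<otimes> inv (t k'))
      * (\<Sum>n<c. y ^ n * ?X' (t k' \<otimes> z [^] (n + i) \<otimes> b' \<otimes> inv (t k''))))"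
    by (rule sum_triple_swap)
  also have "\<dots> = (\<Sum>k'<r. (\<Sum>i<c. inverse (y ^ i) * ?X (t k \<otimes> inv (z [^] i) \<otimes> b \<otimes> inv (t k')))
      * (\<Sum>n<c. y ^ n * ?X' (t k' \<otimes> z [^] n \<otimes> b' \<otimes> inv (t k''))))"
    unfolding shift sum_distrib_right by (simp only: mult_ac)
  also have "\<dots> = (coset_matrix b x y * coset_matrix b' x' y) $$ (k, k'')"
    unfolding reflect using k by (simp add: coset_matrix_def scalar_prod_def lessThan_atLeast0)
  finally show "(coset_matrix b x y * coset_matrix b' x' y) $$ (k, k'')
      = coset_matrix (b \<otimes> b') (x \<otimes>\<^bsub>integral_group_ring G\<^esub> x') y $$ (k, k'')" ..
qed (simp_all add: coset_matrix_def)

lemma coset_matrix_one: "coset_matrix \<one> (frag_of \<one>) y = 1\<^sub>m r"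
proof (rule eq_matI)
  fix k k' assume "k < dim_row (1\<^sub>m r :: complex mat)" "k' < dim_col (1\<^sub>m r :: complex mat)"
  hence k: "k < r" "k' < r" by simp_all
  have "t k \<otimes> z [^] i \<otimes> \<one> \<otimes> inv (t k') = \<one> \<longleftrightarrow> k = k' \<and> i = 0" if "i < c" for i
  proof -
    have "t k \<otimes> z [^] i \<otimes> \<one> \<otimes> inv (t k') = \<one> \<longleftrightarrow> t k \<otimes> z [^] i = t k' \<otimes> z [^] (0::nat)"
      using k by (simp add: mult_inv_eq_one_iff)
    thus ?thesis using reps_inj[OF k that c_pos] by simp
  qed
  note iff = this
  have "coset_matrix \<one> (frag_of \<one>) y $$ (k, k') = (\<Sum>i<c. y ^ i
      * of_int (Poly_Mapping.lookup (frag_of \<one>) (t k \<otimes> z [^] i \<otimes> \<one> \<otimes> inv (t k'))))"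
    by (simp only: coset_matrix_def index_mat(1)[OF k] case_prod_conv)
  also have "\<dots> = (\<Sum>i<c. y ^ i * (if i = 0 then if k = k' then 1 else 0 else 0))"
    by (rule sum.cong) (auto simp: iff)
  also have "\<dots> = (if k = k' then 1 else 0)" using c_pos by (simp add: if_distrib cong: if_cong)
  finally show "coset_matrix \<one> (frag_of \<one>) y $$ (k, k') = 1\<^sub>m r $$ (k, k')" using k by simp
qed (simp_all add: coset_matrix_def)

lemma coset_matrix_inv_z:
  assumes "c > 1"
  shows "coset_matrix (inv z) (frag_of \<one>) y = y \<cdot>\<^sub>m 1\<^sub>m r"
proof (rule eq_matI)
  fix k k' assume "k < dim_row (y \<cdot>\<^sub>m 1\<^sub>m r)" "k' < dim_col (y \<cdot>\<^sub>m 1\<^sub>m r)"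
  hence k: "k < r" "k' < r" by simp_all
  have "t k \<otimes> z [^] i \<otimes> inv z \<otimes> inv (t k') = \<one> \<longleftrightarrow> k = k' \<and> i = 1" if "i < c" for i
  proof -
    have "t k \<otimes> z [^] i \<otimes> inv z \<otimes> inv (t k') = \<one> \<longleftrightarrow> t k \<otimes> z [^] i = t k' \<otimes> z [^] (1::nat)"
      using k mult_inv_eq_one_iff[of "t k \<otimes> z [^] i" "t k' \<otimes> z"] by (simp add: inv_mult_group m_assoc)
    thus ?thesis using reps_inj[OF k that assms] by simp
  qed
  note iff = this
  have "coset_matrix (inv z) (frag_of \<one>) y $$ (k, k') = (\<Sum>i<c. y ^ i
      * of_int (Poly_Mapping.lookup (frag_of \<one>) (t k \<otimes> z [^] i \<otimes> inv z \<otimes> inv (t k'))))"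
    by (simp only: coset_matrix_def index_mat(1)[OF k] case_prod_conv)
  also have "\<dots> = (\<Sum>i<c. if i = 1 then y * (if k = k' then 1 else 0) else 0)"
    by (rule sum.cong) (auto simp: iff)
  also have "\<dots> = y * (if k = k' then 1 else 0)" using assms by simp
  finally show "coset_matrix (inv z) (frag_of \<one>) y $$ (k, k') = (y \<cdot>\<^sub>m 1\<^sub>m r) $$ (k, k')" using k by simp
qed (simp_all add: coset_matrix_def)

lemma coset_matrix_pow:
  assumes b: "b \<in> carrier G" "b \<otimes> z = z \<otimes> b"
    and x: "Poly_Mapping.keys x \<subseteq> carrier G" and y: "y ^ c = 1"
  shows "coset_matrix b x y ^\<^sub>m n = coset_matrix (b [^] n) (x [^]\<^bsub>integral_group_ring G\<^esub> n) y"
proof (induction n)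
  case 0
  show ?case by (simp add: coset_matrix_one carrier_matD[OF coset_matrix_carrier])
next
  case (Suc n)
  interpret R: ring "integral_group_ring G" by (rule ring_integral_group_ring)
  have "b [^] n \<otimes> z = z \<otimes> b [^] n" by (rule group_commutes_pow[OF b(2,1) z_closed])
  moreover have "Poly_Mapping.keys (x [^]\<^bsub>integral_group_ring G\<^esub> n) \<subseteq> carrier G"
    using R.nat_pow_closed[of x n] x by simp
  ultimately show ?case
    using coset_matrix_mult[OF _ _ b(1) _ x y, of "b [^] n" "x [^]\<^bsub>integral_group_ring G\<^esub> n"] b
    by (simp add: Suc)
qed

lemma sum_conjugates_reps:
  assumes b: "b \<in> carrier G" "b \<otimes> z = z \<otimes> b"
  shows "(\<Sum>g\<in>carrier G. f (g \<otimes> b \<otimes> inv g)) = of_nat c * (\<Sum>k<r. f (t k \<otimes> b \<otimes> inv (t k)) :: 'c::comm_semiring_1)"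
proof -
  have "t k \<otimes> z [^] i \<otimes> b \<otimes> inv (t k \<otimes> z [^] i) = t k \<otimes> b \<otimes> inv (t k)" if "k < r" for k and i :: nat
  proof -
    have "z [^] i \<otimes> b = b \<otimes> z [^] i"
      by (rule group_commutes_pow[OF b(2)[symmetric] z_closed b(1)])
    hence "t k \<otimes> (z [^] i \<otimes> b) \<otimes> inv (z [^] i) \<otimes> inv (t k) = t k \<otimes> b \<otimes> inv (t k)"
      using that b by (simp add: m_assoc)
    thus ?thesis using that b by (simp add: m_assoc inv_mult_group)
  qed
  thus ?thesis
    unfolding sum_carrier_reps by (simp add: sum_distrib_left)
qed

end

section \<open>Coefficients of torsion units\<close>

lemma (in group) cyclic_coset_reps_exist:
  assumes fin: "finite (carrier G)" and z: "z \<in> carrier G"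
  obtains r t where "cyclic_coset_reps G z (ord z) r t"
proof -
  define c where "c = ord z"
  have c: "c > 0" using ord_ge_1[OF fin z] by (simp add: c_def)
  have zc: "z [^] c = \<one>" using z by (simp add: c_def)
  define C where "C g = range (\<lambda>i::nat. g \<otimes> z [^] i)" for g
  have mem: "g \<in> C g" if "g \<in> carrier G" for g
    using that by (auto simp: C_def intro!: image_eqI[of _ _ 0])
  have sub: "C (g \<otimes> z [^] j) \<subseteq> C g" if "g \<in> carrier G" for g and j :: nat
    using that z by (auto simp: C_def m_assoc nat_pow_mult)
  have C_eq: "C (g \<otimes> z [^] j) = C g" if g: "g \<in> carrier G" for g and j :: nat
  proof
    have "c * j = j + (c - 1) * j" using c by (cases c) auto
    hence "g \<otimes> z [^] j \<otimes> z [^] ((c - 1) * j) = g \<otimes> z [^] (c * j)"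
      using g z by (simp add: m_assoc nat_pow_mult)
    also have "z [^] (c * j) = \<one>" using z zc by (simp flip: nat_pow_pow)
    finally have "C g = C (g \<otimes> z [^] j \<otimes> z [^] ((c - 1) * j))" using g by simp
    also have "\<dots> \<subseteq> C (g \<otimes> z [^] j)" using g z by (intro sub) simp
    finally show "C g \<subseteq> C (g \<otimes> z [^] j)" .
  qed (rule sub[OF g])
  define rep where "rep g = (SOME h. h \<in> C g)" for g
  have rep: "rep g \<in> C g" if "g \<in> carrier G" for g
    unfolding rep_def using mem[OF that] by (rule someI)
  have rep_carrier: "rep g \<in> carrier G" and C_rep: "C (rep g) = C g" if g: "g \<in> carrier G" for g
  proof -
    obtain i where "rep g = g \<otimes> z [^] (i::nat)" using rep[OF g] by (auto simp: C_def)
    thus "rep g \<in> carrier G" "C (rep g) = C g" using C_eq[OF g] g z by simp_all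
  qed
  have rep_cong: "rep g = rep h" if "C g = C h" for g h
    using that by (simp add: rep_def)
  define T where "T = rep ` carrier G"
  have T: "T \<subseteq> carrier G" using rep_carrier by (auto simp: T_def)
  have rep_T: "rep x = x" if "x \<in> T" for x
    using that rep_cong[OF C_rep] by (auto simp: T_def)
  define r where "r = card T"
  have "finite T" using fin by (simp add: T_def)
  then obtain t where t: "bij_betw t {..<r} T"
    using ex_bij_betw_nat_finite unfolding r_def lessThan_atLeast0 by blast
  have tT: "t k \<in> T" if "k < r" for k using bij_betwE[OF t] that by simp
  have tG: "t k \<in> carrier G" if "k < r" for k using tT[OF that] T by auto
  have "bij_betw (\<lambda>(k, i). t k \<otimes> z [^] i) ({..<r} \<times> {..<c}) (carrier G)"
  proof (rule bij_betw_imageI)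
    show "inj_on (\<lambda>(k, i). t k \<otimes> z [^] i) ({..<r} \<times> {..<c})"
    proof (rule inj_onI, clarsimp)
      fix k k' i i' assume k: "k < r" "k' < r" "i < c" "i' < c" and eq: "t k \<otimes> z [^] i = t k' \<otimes> z [^] i'"
      have "C (t k) = C (t k')" using C_eq[OF tG[OF k(1)], of i] C_eq[OF tG[OF k(2)], of i'] eq by simp
      hence "t k = t k'" using rep_cong rep_T[OF tT] k by metis
      hence kk: "k = k'" using bij_betw_imp_inj_on[OF t] k by (auto dest: inj_onD)
      hence "z [^] i = z [^] i'" using eq tG[OF k(1)] z by simp
      hence "i = i'" using ord_inj[OF z] k c by (auto simp: c_def dest!: inj_onD)
      thus "k = k' \<and> i = i'" using kk by simp
    qed
    show "(\<lambda>(k, i). t k \<otimes> z [^] i) ` ({..<r} \<times> {..<c}) = carrier G"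
    proof (intro equalityI subsetI)
      fix g assume g: "g \<in> carrier G"
      have "rep g \<in> T" using g by (simp add: T_def)
      then obtain k where k: "k < r" "t k = rep g" using bij_betw_imp_surj_on[OF t] by (metis imageE lessThan_iff)
      have "g \<in> C (t k)" using mem[OF g] C_rep[OF g] k by simp
      then obtain i :: nat where i: "g = t k \<otimes> z [^] i" by (auto simp: C_def)
      have "z [^] i = z [^] (c * (i div c) + i mod c)" by simp
      also have "\<dots> = z [^] (i mod c)"
        using z zc by (simp only: nat_pow_mult[symmetric] nat_pow_pow[symmetric] nat_pow_one l_one nat_pow_closed)
      finally have "g = (\<lambda>(k, i). t k \<otimes> z [^] i) (k, i mod c)" using i by simp
      thus "g \<in> (\<lambda>(k, i). t k \<otimes> z [^] i) ` ({..<r} \<times> {..<c})" by (rule image_eqI) (use k c in auto)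
    qed (use tG z in auto)
  qed
  hence "cyclic_coset_reps G z c r t"
    using fin z c zc tG by unfold_locales auto
  thus thesis using that by (simp add: c_def)
qed

lemma (in cyclic_coset_reps) reps_surj:
  assumes "g \<in> carrier G"
  obtains k i where "k < r" "i < c" "g = t k \<otimes> z [^] i"
proof -
  have "g \<in> (\<lambda>(k, i). t k \<otimes> z [^] i) ` ({..<r} \<times> {..<c})"
    using bij_betw_imp_surj_on[OF reps_bij] assms by simp
  thus thesis using that by auto
qed

text \<open>This is Hertweck's theorem that the partial augmentations of a torsion unit vanish on the classes of
  elements whose order does not divide the order of the unit.  Choose \<open>Q\<close> maximal among the multiples of \<open>n\<close> dividing \<open>n\<close>
  times the order of \<open>b\<close> with \<open>b ^ Q \<noteq> 1\<close>.  Then \<open>b ^ Q\<close> has prime order \<open>l\<close>, and \<open>v \<mapsto> x v b\<inverse>\<close> is a \<open>Q\<close>-th root of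
  right multiplication by \<open>z = b ^ - Q\<close>, which acts as \<open>y\<close>.  The sum in question is
  \<open>l\<close> times the trace of the constant term in \<open>y\<close>.\<close>

lemma (in group) torsion_sum_conjugates_eq_0:
  fixes n :: nat
  assumes fin: "finite (carrier G)" and x: "Poly_Mapping.keys x \<subseteq> carrier G"
    and xn: "x [^]\<^bsub>integral_group_ring G\<^esub> n = frag_of \<one>" and n: "n > 0"
    and b: "b \<in> carrier G" "b [^] n \<noteq> \<one>"
  shows "(\<Sum>g\<in>carrier G. Poly_Mapping.lookup x (g \<otimes> b \<otimes> inv g)) = 0"
proof -
  interpret R: ring "integral_group_ring G" by (rule ring_integral_group_ring)
  define N where "N = n * ord b"
  have N: "N > 0" "b [^] N = \<one>"
    using n ord_ge_1[OF fin b(1)] b(1) by (auto simp: N_def pow_eq_id)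
  define S where "S = {Q. n dvd Q \<and> Q dvd N \<and> b [^] Q \<noteq> \<one>}"
  have finS: "finite S" by (rule finite_subset[of _ "{..N}"]) (use N in \<open>auto simp: S_def dest: dvd_imp_le\<close>)
  have "n \<in> S" using b by (simp add: S_def N_def)
  define Q where "Q = Max S"
  have QS: "Q \<in> S" unfolding Q_def using finS \<open>n \<in> S\<close> by (intro Max_in) auto
  hence Q: "n dvd Q" "Q dvd N" "b [^] Q \<noteq> \<one>" by (auto simp: S_def)
  have Q0: "Q > 0" using Q(3) by (cases Q) auto
  obtain m where m: "N = Q * m" using Q(2) by (elim dvdE)
  have "m \<noteq> 1" using m N Q by auto
  then obtain l where l: "Factorial_Ring.prime l" "l dvd m" using prime_factor_nat by blast
  have l1: "l > 1" using l(1) prime_gt_1_nat by blast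
  have "Q * l \<notin> S"
  proof
    assume "Q * l \<in> S"
    hence "Q * l \<le> Q" unfolding Q_def using finS by (intro Max_ge)
    thus False using Q0 l1 by simp
  qed
  hence bQl: "b [^] (Q * l) = \<one>" using Q(1) m l(2) by (auto simp: S_def)
  define z where "z = inv (b [^] Q)"
  have z: "z \<in> carrier G" using b by (simp add: z_def)
  have "ord z = l"
  proof -
    have "(b [^] Q) [^] l = \<one>" using bQl b by (simp add: nat_pow_pow)
    hence "ord (b [^] Q) dvd l" using b by (simp add: pow_eq_id)
    moreover have "ord (b [^] Q) \<noteq> 1" using b Q(3) ord_eq_1[of "b [^] Q"] by simp
    ultimately have "ord (b [^] Q) = l" using l(1) prime_nat_iff by blast
    thus ?thesis using b by (simp add: z_def)
  qed
  then obtain r t where "cyclic_coset_reps G z l r t"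
    using cyclic_coset_reps_exist[OF fin z] by metis
  then interpret cyclic_coset_reps G z l r t .
  have "b [^] Q \<otimes> b = b \<otimes> b [^] Q" using b(1) nat_pow_Suc2[of b Q] by simp
  hence bz: "b \<otimes> z = z \<otimes> b"
    unfolding z_def using b(1) by (metis inv_solve_left inv_solve_right m_assoc nat_pow_closed inv_closed m_closed)
  have xQ: "x [^]\<^bsub>integral_group_ring G\<^esub> Q = frag_of \<one>"
  proof -
    obtain j where "Q = n * j" using Q(1) by (elim dvdE)
    thus ?thesis using R.nat_pow_pow[of x n j] x xn R.nat_pow_one by simp
  qed
  have "(\<Sum>k<r. Poly_Mapping.lookup x (t k \<otimes> z [^] (0::nat) \<otimes> b \<otimes> inv (t k))) = 0"
  proof (rule trace_constant_term_eq_0[where Q = Q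
        and c = "\<lambda>i k k'. Poly_Mapping.lookup x (t k \<otimes> z [^] i \<otimes> b \<otimes> inv (t k'))", OF l(1) Q0])
    fix y :: complex assume y: "y ^ l = 1"
    have "coset_matrix b x y ^\<^sub>m Q = coset_matrix (inv z) (frag_of \<one>) y"
      unfolding coset_matrix_pow[OF b(1) bz x y] xQ using b by (simp add: z_def)
    also have "\<dots> = y \<cdot>\<^sub>m 1\<^sub>m r" by (rule coset_matrix_inv_z[OF l1])
    finally show "mat r r (\<lambda>(k, k'). \<Sum>i<l. y ^ i
        * of_int (Poly_Mapping.lookup x (t k \<otimes> z [^] i \<otimes> b \<otimes> inv (t k')))) ^\<^sub>m Q = y \<cdot>\<^sub>m 1\<^sub>m r"
      by (simp only: coset_matrix_def)
  qed
  thus ?thesis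
    using sum_conjugates_reps[OF b(1) bz, of "Poly_Mapping.lookup x"] b(1) by simp
qed

text \<open>This is the theorem of Berman and Higman.  Left multiplication by \<open>x\<close> on the complex group algebra has finite order and trace
  \<open>|G|\<close> times the coefficient at \<open>1\<close>.  If this integer coefficient is not \<open>0\<close>, there is no cancellation between the
  \<open>|G|\<close> eigenvalues, which are roots of unity; they all have the same value \<open>s = \<plusminus>1\<close>, and \<open>x\<close> acts as \<open>s\<close>.\<close>

lemma (in group) torsion_unit_coefficient_one_eq_0:
  fixes n :: nat
  assumes fin: "finite (carrier G)" and x: "Poly_Mapping.keys x \<subseteq> carrier G"
    and xn: "x [^]\<^bsub>integral_group_ring G\<^esub> n = frag_of \<one>" and n: "n > 0"
    and aug: "augmentation G x = 1" and ne: "x \<noteq> frag_of \<one>"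
  shows "Poly_Mapping.lookup x \<one> = 0"
proof (rule ccontr)
  assume nz: "Poly_Mapping.lookup x \<one> \<noteq> 0"
  obtain c r t where c: "c = 1" and "cyclic_coset_reps G \<one> c r t"
    using cyclic_coset_reps_exist[OF fin one_closed] by (metis ord_id)
  then interpret cyclic_coset_reps G \<one> c r t by simp
  define M where "M = coset_matrix \<one> x 1"
  have M: "M \<in> carrier_mat r r" by (simp add: M_def)
  have entry: "M $$ (k, k') = of_int (Poly_Mapping.lookup x (t k \<otimes> inv (t k')))" if "k < r" "k' < r" for k k'
    unfolding M_def coset_matrix_def using that by (simp add: c)
  have "M ^\<^sub>m n = coset_matrix (\<one> [^] n) (x [^]\<^bsub>integral_group_ring G\<^esub> n) 1"
    unfolding M_def by (rule coset_matrix_pow[OF one_closed _ x]) simp_all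
  also have "\<dots> = 1\<^sub>m r" by (simp add: xn coset_matrix_one)
  finally have "M ^\<^sub>m n = 1 \<cdot>\<^sub>m 1\<^sub>m r" by (simp, intro eq_matI) simp_all
  then obtain P P' d where P: "P \<in> carrier_mat r r" "P' \<in> carrier_mat r r" and PP': "P * P' = 1\<^sub>m r"
    and P'P: "P' * P = 1\<^sub>m r" and MP: "M = P * diagonal r d * P'" and d: "\<forall>i<r. d i ^ n = 1"
    by (rule root_of_scalar_diagonalizable[OF M _ n one_neq_zero])
  define e where "e = Poly_Mapping.lookup x \<one>"
  define s where "s = sgn (real_of_int e)"
  have s: "s = 1 \<or> s = -1" using nz by (auto simp: s_def e_def sgn_if)
  have "(\<Sum>i<r. d i) = (\<Sum>k<r. M $$ (k, k))"
    unfolding MP by (rule trace_diagonal_form[OF P P'P, symmetric])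
  also have "\<dots> = of_nat r * of_int e"
    by (simp add: entry e_def)
  finally have "(\<Sum>i<r. Re (d i)) = real r * real_of_int e"
    by (simp flip: Re_sum)
  moreover have "s * real_of_int e \<ge> 1"
    using nz by (auto simp: s_def e_def sgn_if)
  hence "real r * 1 \<le> real r * (s * real_of_int e)" by (rule mult_left_mono) simp
  ultimately have "(\<Sum>i<r. 1 - s * Re (d i)) \<le> 0"
    by (simp add: sum_subtractf sum_distrib_left[symmetric] mult_ac)
  moreover have norm: "cmod (d i) = 1" if "i < r" for i
  proof -
    have "cmod (d i) ^ n = 1 ^ n" using d that by (simp flip: norm_power)
    thus ?thesis by (rule power_eq_imp_eq_base) (use n in simp_all)
  qed
  have pos: "1 - s * Re (d i) \<ge> 0" if "i < r" for i
    using norm[OF that] abs_Re_le_cmod[of "d i"] s by auto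
  ultimately have "(\<Sum>i<r. 1 - s * Re (d i)) = 0"
    by (intro antisym sum_nonneg) auto
  hence Re: "s * Re (d i) = 1" if "i < r" for i
    using sum_nonneg_eq_0_iff[of "{..<r}" "\<lambda>i. 1 - s * Re (d i)"] pos that by auto
  have ds: "d i = of_real s" if "i < r" for i
  proof -
    have "(Re (d i))\<^sup>2 + (Im (d i))\<^sup>2 = 1" using norm[OF that] by (simp add: cmod_def)
    moreover have "Re (d i) = s" using Re[OF that] s by auto
    ultimately show ?thesis using s by (auto simp: complex_eq_iff)
  qed
  have "diagonal r d = of_real s \<cdot>\<^sub>m 1\<^sub>m r" by (rule eq_matI) (auto simp: ds)
  hence "P * diagonal r d = of_real s \<cdot>\<^sub>m P"
    using mult_smult_distrib[OF P(1) one_carrier_mat, of "of_real s"] right_mult_one_mat[OF P(1)]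
    by simp
  hence "M = of_real s \<cdot>\<^sub>m P * P'" using MP by (rule subst)
  also have "\<dots> = of_real s \<cdot>\<^sub>m (P * P')" by (rule mult_smult_assoc_mat[OF P])
  also have "\<dots> = of_real s \<cdot>\<^sub>m 1\<^sub>m r" by (simp only: PP')
  finally have Ms: "M = of_real s \<cdot>\<^sub>m 1\<^sub>m r" .
  have off: "Poly_Mapping.lookup x (t k \<otimes> inv (t k')) = 0" if "k < r" "k' < r" "k \<noteq> k'" for k k'
  proof -
    have "M $$ (k, k') = 0" unfolding Ms using that by simp
    thus ?thesis using entry[OF that(1,2)] by simp
  qed
  have surj: "\<exists>k<r. t k = g" if g: "g \<in> carrier G" for g
  proof -
    obtain k i where "k < r" "g = t k \<otimes> \<one> [^] (i::nat)" using g by (rule reps_surj)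
    thus ?thesis by (intro exI[of _ k]) simp
  qed
  have zero: "Poly_Mapping.lookup x g = 0" if g: "g \<in> carrier G" "g \<noteq> \<one>" for g
  proof -
    obtain k where k: "k < r" "t k = g" using surj[OF g(1)] by blast
    obtain k' where k': "k' < r" "t k' = \<one>" using surj[OF one_closed] by blast
    have "k \<noteq> k'" using k k' g(2) by auto
    from off[OF k(1) k'(1) this] show ?thesis using g(1) by (simp add: k k')
  qed
  have "augmentation G x = (\<Sum>g\<in>carrier G. if g = \<one> then e else 0)"
    unfolding augmentation_def by (rule sum.cong) (auto simp: zero e_def)
  hence "e = 1" using aug fin by simp
  have "x = frag_of \<one>"
  proof (rule poly_mapping_eqI)
    fix g show "Poly_Mapping.lookup x g = Poly_Mapping.lookup (frag_of \<one>) g"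
    proof (cases "g \<in> carrier G")
      case True
      thus ?thesis using zero[of g] \<open>e = 1\<close> by (auto simp: e_def)
    next
      case False
      hence "g \<notin> Poly_Mapping.keys x" using x by auto
      thus ?thesis using False by (auto simp: in_keys_iff)
    qed
  qed
  thus False using ne by simp
qed

section \<open>Groups of units and cyclic Sylow subgroups\<close>

text \<open>For \<open>j < p\<close>, the representation of \<open>G\<close> induced from the character \<open>z \<mapsto> \<zeta> ^ j\<close> of \<open>\<langle>z\<rangle>\<close> extends to the
  group ring, and the average over \<open>H\<close> acts as an idempotent, whose trace is an integer.  In the sum of these \<open>p\<close> traces all
  contributions of elements of \<open>\<langle>z\<rangle>\<close> other than \<open>1\<close> cancel: elements of order \<open>p\<close> are killed by the sum of the \<open>p\<close>
  characters, and the elements of larger order do not contribute by Hertweck's theorem.  The element \<open>1\<close> contributes only for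
  \<open>u = 1\<close> in \<open>H\<close>, by the theorem of Berman and Higman.  What is left is \<open>p |G : \<langle>z\<rangle>| / p\<^sup>2\<close>.\<close>

lemma (in group) elementary_abelian_units_imp_prime_dvd_index:
  fixes p n :: nat and H :: "('a \<Rightarrow>\<^sub>0 int) set"
  assumes fin: "finite (carrier G)" and p: "Factorial_Ring.prime p"
    and z: "z \<in> carrier G" "ord z = p ^ n"
    and card: "card H = p\<^sup>2" and one: "frag_of \<one> \<in> H"
    and keys: "\<And>u. u \<in> H \<Longrightarrow> Poly_Mapping.keys u \<subseteq> carrier G"
    and aug: "\<And>u. u \<in> H \<Longrightarrow> augmentation G u = 1"
    and pow: "\<And>u. u \<in> H \<Longrightarrow> u [^]\<^bsub>integral_group_ring G\<^esub> p = frag_of \<one>"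
    and bij: "\<And>u. u \<in> H \<Longrightarrow> bij_betw (\<lambda>v. u \<otimes>\<^bsub>integral_group_ring G\<^esub> v) H H"
  shows "p ^ Suc n dvd Coset.order G"
proof -
  have p0: "p > 0" using p prime_gt_0_nat by blast
  have finH: "finite H" using card p0 by (intro card_ge_0_finite) simp
  obtain r t where "cyclic_coset_reps G z (p ^ n) r t"
    using cyclic_coset_reps_exist[OF fin z(1)] z(2) by metis
  then interpret cyclic_coset_reps G z "p ^ n" r t .
  let ?c = "p ^ n"
  obtain \<zeta> :: complex where \<zeta>: "\<And>k. \<zeta> ^ k = 1 \<longleftrightarrow> ?c dvd k"
    using primitive_root_of_unity[OF c_pos] by metis
  define A where "A j u = coset_matrix \<one> u (\<zeta> ^ j)" for j u
  have A: "A j u \<in> carrier_mat r r" for j u by (simp add: A_def)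
  define B where "B j k k' = (\<Sum>u\<in>H. A j u $$ (k, k'))" for j k k'
  define E where "E j = mat r r (\<lambda>(k, k'). B j k k' / of_nat (p\<^sup>2))" for j
  have Amult: "A j u * A j v = A j (u \<otimes>\<^bsub>integral_group_ring G\<^esub> v)" if "u \<in> H" "v \<in> H" for j u v
  proof -
    have "(\<zeta> ^ j) ^ ?c = 1" using \<zeta> by (simp flip: power_mult)
    from coset_matrix_mult[OF one_closed _ one_closed keys[OF that(1)] keys[OF that(2)] this]
    show ?thesis by (simp add: A_def)
  qed
  have idem: "E j * E j = E j" for j
  proof (rule eq_matI)
    fix k k'' assume "k < dim_row (E j)" "k'' < dim_col (E j)"
    hence k: "k < r" "k'' < r" by (simp_all add: E_def)
    have "(\<Sum>k'<r. (\<Sum>u\<in>H. A j u $$ (k, k')) * (\<Sum>v\<in>H. A j v $$ (k', k'')))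
        = (\<Sum>k'<r. \<Sum>u\<in>H. \<Sum>v\<in>H. A j u $$ (k, k') * A j v $$ (k', k''))"
      by (simp only: sum_product)
    also have "\<dots> = (\<Sum>u\<in>H. \<Sum>k'<r. \<Sum>v\<in>H. A j u $$ (k, k') * A j v $$ (k', k''))"
      by (rule sum.swap)
    also have "\<dots> = (\<Sum>u\<in>H. \<Sum>v\<in>H. \<Sum>k'<r. A j u $$ (k, k') * A j v $$ (k', k''))"
      by (rule sum.cong[OF refl]) (rule sum.swap)
    also have "\<dots> = (\<Sum>u\<in>H. \<Sum>v\<in>H. A j (u \<otimes>\<^bsub>integral_group_ring G\<^esub> v) $$ (k, k''))"
    proof (intro sum.cong refl)
      fix u v assume uv: "u \<in> H" "v \<in> H"
      have "(A j u * A j v) $$ (k, k'') = (\<Sum>k'<r. A j u $$ (k, k') * A j v $$ (k', k''))"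
        using k carrier_matD[OF A] by (simp add: scalar_prod_def lessThan_atLeast0)
      thus "(\<Sum>k'<r. A j u $$ (k, k') * A j v $$ (k', k'')) = A j (u \<otimes>\<^bsub>integral_group_ring G\<^esub> v) $$ (k, k'')"
        by (simp only: Amult[OF uv])
    qed
    also have "\<dots> = (\<Sum>u\<in>H. \<Sum>v\<in>H. A j v $$ (k, k''))"
      by (intro sum.cong refl sum.reindex_bij_betw bij)
    also have "\<dots> = of_nat (p\<^sup>2) * (\<Sum>v\<in>H. A j v $$ (k, k''))" by (simp add: card)
    finally have "(\<Sum>k'<r. (\<Sum>u\<in>H. A j u $$ (k, k')) * (\<Sum>v\<in>H. A j v $$ (k', k'')))
      = of_nat (p\<^sup>2) * (\<Sum>v\<in>H. A j v $$ (k, k''))" .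
    hence "(\<Sum>k'<r. B j k k' * B j k' k'') = of_nat (p\<^sup>2) * B j k k''" by (simp only: B_def)
    moreover have "(E j * E j) $$ (k, k'') = (\<Sum>k'<r. B j k k' * B j k' k'') / (of_nat (p\<^sup>2) * of_nat (p\<^sup>2))"
      using k by (simp add: E_def scalar_prod_def lessThan_atLeast0 sum_divide_distrib)
    ultimately have "(E j * E j) $$ (k, k'') = of_nat (p\<^sup>2) * B j k k'' / (of_nat (p\<^sup>2) * of_nat (p\<^sup>2))"
      by (simp only:)
    also have "\<dots> = B j k k'' / of_nat (p\<^sup>2)"
      by (rule nonzero_mult_divide_mult_cancel_left) (use p0 in simp)
    finally show "(E j * E j) $$ (k, k'') = E j $$ (k, k'')"
      using k by (simp only: E_def index_mat case_prod_conv)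
  qed (simp_all add: E_def)
  have int: "(\<Sum>k<r. E j $$ (k, k)) \<in> \<int>" for j
    by (rule trace_idempotent_Ints[OF _ idem]) (simp add: E_def)
  \<comment> \<open>The contribution of \<open>z ^ i\<close>, without the value of the character.\<close>
  define a where "a i = (\<Sum>u\<in>H. \<Sum>k<r. Poly_Mapping.lookup u (t k \<otimes> z [^] i \<otimes> inv (t k)))" for i :: nat
  have trace: "of_nat (p\<^sup>2) * (\<Sum>k<r. E j $$ (k, k)) = (\<Sum>i<?c. (\<zeta> ^ i) ^ j * of_int (a i))" for j
  proof -
    have "of_nat (p\<^sup>2) * (\<Sum>k<r. E j $$ (k, k)) = (\<Sum>k<r. \<Sum>u\<in>H. A j u $$ (k, k))"
      using p0 by (simp add: E_def B_def sum_divide_distrib[symmetric])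
    also have "\<dots> = (\<Sum>k<r. \<Sum>u\<in>H. \<Sum>i<?c. (\<zeta> ^ i) ^ j
        * of_int (Poly_Mapping.lookup u (t k \<otimes> z [^] i \<otimes> inv (t k))))"
      by (simp add: A_def coset_matrix_def power_mult[symmetric] mult.commute)
    also have "\<dots> = (\<Sum>k<r. \<Sum>i<?c. \<Sum>u\<in>H. (\<zeta> ^ i) ^ j
        * of_int (Poly_Mapping.lookup u (t k \<otimes> z [^] i \<otimes> inv (t k))))"
      by (rule sum.cong[OF refl]) (rule sum.swap)
    also have "\<dots> = (\<Sum>i<?c. \<Sum>k<r. \<Sum>u\<in>H. (\<zeta> ^ i) ^ j
        * of_int (Poly_Mapping.lookup u (t k \<otimes> z [^] i \<otimes> inv (t k))))"
      by (rule sum.swap)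
    also have "\<dots> = (\<Sum>i<?c. \<Sum>u\<in>H. \<Sum>k<r. (\<zeta> ^ i) ^ j
        * of_int (Poly_Mapping.lookup u (t k \<otimes> z [^] i \<otimes> inv (t k))))"
      by (rule sum.cong[OF refl]) (rule sum.swap)
    finally show ?thesis by (simp add: a_def sum_distrib_left)
  qed
  have a0: "a 0 = int r"
  proof -
    have "Poly_Mapping.lookup u \<one> = (if u = frag_of \<one> then 1 else 0)" if "u \<in> H" for u
      using torsion_unit_coefficient_one_eq_0[OF fin keys[OF that] pow[OF that] p0 aug[OF that]] by auto
    hence "a 0 = (\<Sum>u\<in>H. if u = frag_of \<one> then int r else 0)"
      unfolding a_def by (intro sum.cong) auto
    thus ?thesis using finH one by simp
  qed
  have a_eq_0: "a i = 0" if "(z [^] i) [^] p \<noteq> \<one>" for i :: nat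
  proof -
    have "(\<Sum>k<r. Poly_Mapping.lookup u (t k \<otimes> z [^] i \<otimes> inv (t k))) = 0" if "u \<in> H" for u
    proof -
      have "z [^] i \<otimes> z = z \<otimes> z [^] i" using z(1) nat_pow_Suc2[of z i] by simp
      from sum_conjugates_reps[OF _ this, of "Poly_Mapping.lookup u"]
        torsion_sum_conjugates_eq_0[OF fin keys[OF that] pow[OF that] p0 _ \<open>(z [^] i) [^] p \<noteq> \<one>\<close>]
      show ?thesis using z(1) p0 by simp
    qed
    thus ?thesis by (simp add: a_def)
  qed
  have kill: "(\<Sum>j<p. (\<zeta> ^ i) ^ j) * of_int (a i) = (if i = 0 then of_nat (p * r) else 0)" if i: "i < ?c" for i
  proof (cases "i = 0 \<or> (z [^] i) [^] p \<noteq> \<one>")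
    case True
    thus ?thesis using a0 a_eq_0[of i] i by (cases "i = 0") auto
  next
    case False
    hence "?c dvd i * p" using z by (simp add: nat_pow_pow pow_eq_id)
    hence "(\<zeta> ^ i) ^ p = 1" using \<zeta> by (simp flip: power_mult)
    moreover have "\<zeta> ^ i \<noteq> 1" using \<zeta> False i by (auto dest: dvd_imp_le)
    ultimately have "(\<Sum>j<p. (\<zeta> ^ i) ^ j) = 0" by (simp add: geometric_sum)
    thus ?thesis using False by simp
  qed
  have "of_nat (p\<^sup>2) * (\<Sum>j<p. \<Sum>k<r. E j $$ (k, k)) = (\<Sum>j<p. \<Sum>i<?c. (\<zeta> ^ i) ^ j * of_int (a i))"
    unfolding sum_distrib_left[of _ _ "{..<p}"] trace ..
  also have "\<dots> = (\<Sum>i<?c. \<Sum>j<p. (\<zeta> ^ i) ^ j * of_int (a i))" by (rule sum.swap)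
  also have "\<dots> = (\<Sum>i<?c. if i = 0 then of_nat (p * r) else 0)"
    unfolding sum_distrib_right[symmetric] by (intro sum.cong refl kill) simp
  also have "\<dots> = of_nat (p * r)" using c_pos by simp
  finally have "of_nat (p\<^sup>2) * (\<Sum>j<p. \<Sum>k<r. E j $$ (k, k)) = complex_of_nat (p * r)" .
  moreover obtain m where "(\<Sum>j<p. \<Sum>k<r. E j $$ (k, k)) = of_int m"
    using int Ints_sum[of "{..<p}" "\<lambda>j. \<Sum>k<r. E j $$ (k, k)"] by (auto elim: Ints_cases)
  ultimately have "complex_of_int (int (p\<^sup>2) * m) = of_int (int (p * r))" by simp
  hence "int (p\<^sup>2) * m = int (p * r)" by (simp only: of_int_eq_iff)
  hence "int p * m = int r" using p0 by (simp add: power2_eq_square)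
  hence "p dvd r" by (metis dvd_triv_left int_dvd_int_iff)
  thus ?thesis unfolding order_eq by (simp add: mult_dvd_mono)
qed

lemma (in group) cyclic_group_iff_ord_eq_order:
  assumes "finite (carrier G)"
  shows "cyclic_group G \<longleftrightarrow> (\<exists>a\<in>carrier G. ord a = Coset.order G)"
proof
  assume "cyclic_group G"
  thus "\<exists>a\<in>carrier G. ord a = Coset.order G"
    unfolding cyclic_group_def by (metis cyclic_order_is_ord)
next
  assume "\<exists>a\<in>carrier G. ord a = Coset.order G"
  then obtain a where a: "a \<in> carrier G" "ord a = Coset.order G" by blast
  have "card (generate G {a}) = card (carrier G)"
    using a generate_pow_card[OF a(1)] by (simp add: Coset.order_def)
  moreover have "generate G {a} \<subseteq> carrier G" using a(1) by (intro generate_incl) simp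
  ultimately have "generate G {a} = carrier G" using assms by (intro card_subset_eq)
  hence "subgroup_generated G {a} = G" using a(1) by (simp add: subgroup_generated_def)
  thus "cyclic_group G" using a(1) cyclic_group_def by blast
qed

text \<open>A noncyclic group of order \<open>p\<^sup>2\<close> has exponent \<open>p\<close>.\<close>

lemma (in group) noncyclic_units_imp_prime_dvd_index:
  fixes p n :: nat
  assumes fin: "finite (carrier G)" and p: "Factorial_Ring.prime p"
    and z: "z \<in> carrier G" "ord z = p ^ n"
    and H: "noncyclic_abelian_subgroup H (normalized_units G)" "card H = p\<^sup>2"
  shows "p ^ Suc n dvd Coset.order G"
proof -
  interpret V: group "normalized_units G" by (rule group_normalized_units[OF fin])
  interpret R: ring "integral_group_ring G" by (rule ring_integral_group_ring)
  have sub: "subgroup H (normalized_units G)" using H(1) by (simp add: noncyclic_abelian_subgroup_def)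
  let ?H = "normalized_units G\<lparr>carrier := H\<rparr>"
  interpret H: group ?H by (rule V.subgroup_imp_group[OF sub])
  have p0: "p > 0" using p prime_gt_0_nat by blast
  have finH: "finite (carrier ?H)" using H(2) p0 by (auto intro: card_ge_0_finite)
  have sV: "u \<in> carrier (normalized_units G)" if "u \<in> H" for u
    using that subgroup.subset[OF sub] by auto
  have mult: "u \<otimes>\<^bsub>?H\<^esub> v = u \<otimes>\<^bsub>integral_group_ring G\<^esub> v" and one: "\<one>\<^bsub>?H\<^esub> = frag_of \<one>" for u v
    by (simp_all add: normalized_units_def units_of_def)
  have powH: "u [^]\<^bsub>?H\<^esub> k = u [^]\<^bsub>integral_group_ring G\<^esub> k" for u and k :: nat
    by (induction k) (simp_all add: normalized_units_def units_of_def nat_pow_def)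
  show ?thesis
  proof (rule elementary_abelian_units_imp_prime_dvd_index[OF fin p z H(2)])
    show "frag_of \<one> \<in> H" using H.one_closed one by simp
  next
    fix u assume u: "u \<in> H"
    have "u \<in> Units (integral_group_ring G)" "augmentation G u = 1"
      using sV[OF u] by (simp_all add: normalized_units_def)
    thus "Poly_Mapping.keys u \<subseteq> carrier G" "augmentation G u = 1"
      using R.Units_closed[of u] by simp_all
    have "H.ord u dvd p ^ 2"
      using H.ord_dvd_group_order[of u] u H(2) by (simp add: Coset.order_def)
    moreover have "H.ord u \<noteq> p ^ 2"
      using H(1) H.cyclic_group_iff_ord_eq_order[OF finH] u H(2)
      by (auto simp: noncyclic_abelian_subgroup_def Coset.order_def)
    ultimately have "H.ord u dvd p"
      using divides_primepow_nat[OF p, of "H.ord u" 2] by (auto simp: le_Suc_eq numeral_2_eq_2)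
    thus "u [^]\<^bsub>integral_group_ring G\<^esub> p = frag_of \<one>"
      using H.pow_eq_id[of u p] u powH one by simp
    have "bij_betw (\<lambda>v. u \<otimes>\<^bsub>?H\<^esub> v) (carrier ?H) (carrier ?H)"
      by (rule bij_betw_byWitness[where f' = "\<lambda>v. inv\<^bsub>?H\<^esub> u \<otimes>\<^bsub>?H\<^esub> v"])
        (use u H.inv_mult_cancel_left[of u] H.m_closed H.inv_closed in auto)
    thus "bij_betw (\<lambda>v. u \<otimes>\<^bsub>integral_group_ring G\<^esub> v) H H" by (simp only: mult) simp
  qed
qed

section \<open>Cyclic p-groups of odd order\<close>

lemma (in group) subgroup_nat_pow_eq:
  "x [^]\<^bsub>G\<lparr>carrier := H\<rparr>\<^esub> (n::nat) = x [^] n"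
  by (simp add: nat_pow_def)

lemma (in group) subgroup_ord_eq:
  assumes "subgroup H G" "x \<in> H"
  shows "group.ord (G\<lparr>carrier := H\<rparr>) x = ord x"
proof -
  interpret H: group "G\<lparr>carrier := H\<rparr>" by (rule subgroup_imp_group[OF assms(1)])
  have x: "x \<in> carrier G" by (rule subgroup.mem_carrier[OF assms])
  have "\<forall>n. x [^]\<^bsub>G\<lparr>carrier := H\<rparr>\<^esub> (n::nat) = \<one>\<^bsub>G\<lparr>carrier := H\<rparr>\<^esub> \<longleftrightarrow> ord x dvd n"
    by (simp add: subgroup_nat_pow_eq pow_eq_id[OF x])
  thus ?thesis using H.ord_unique[of x "ord x"] assms(2) by simp
qed

lemma (in group) subgroup_nat_pow_closed:
  assumes "subgroup H G" "x \<in> H"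
  shows "x [^] (n::nat) \<in> H"
  by (induction n) (use assms in \<open>auto intro: subgroup.one_closed subgroup.m_closed\<close>)

lemma (in group) nat_pow_coprime_mem_subgroup:
  assumes H: "subgroup H G" and x: "x \<in> carrier G" "x [^] (N::nat) = \<one>"
    and d: "x [^] d \<in> H" "Rings.coprime d N" "d > 0"
  shows "x \<in> H"
proof -
  obtain u v where uv: "d * u = N * v + 1"
    using bezout_nat[of d N] d(2,3) by (auto simp: coprime_iff_gcd_eq_1)
  have "(x [^] d) [^] u = x [^] (N * v + 1)" using x by (simp add: nat_pow_pow uv)
  also have "\<dots> = x" using x by (simp add: nat_pow_mult[symmetric] nat_pow_pow[symmetric])
  finally show ?thesis using subgroup_nat_pow_closed[OF H d(1), of u] by simp
qed

text \<open>The elements \<open>w ^ i c ^ j\<close>, \<open>i, j < p\<close>, form the required group.\<close>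

lemma (in group) commuting_elements_imp_noncyclic_abelian_subgroup:
  assumes fin: "finite (carrier G)" and p: "Factorial_Ring.prime p"
    and w: "w \<in> carrier G" "ord w = p" and c: "c \<in> carrier G" "c [^] p = \<one>" "c \<notin> generate G {w}"
    and comm: "w \<otimes> c = c \<otimes> w"
  shows "\<exists>H. noncyclic_abelian_subgroup H G \<and> card H = p\<^sup>2"
proof -
  have p0: "p > 0" "p > 1" using p prime_gt_0_nat prime_gt_1_nat by blast+
  have wp: "w [^] p = \<one>" using w by (metis pow_ord_eq_1)
  define f where "f = (\<lambda>(i, j). w [^] (i::nat) \<otimes> c [^] (j::nat))"
  define H where "H = range f"
  have red: "x [^] i = x [^] (i mod p)" if x: "x \<in> carrier G" "x [^] p = \<one>" for x and i :: nat
  proof -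
    have "x [^] i = x [^] (p * (i div p) + i mod p)" by simp
    also have "\<dots> = x [^] (i mod p)"
      using x by (simp only: nat_pow_mult[symmetric] nat_pow_pow[symmetric] nat_pow_one l_one nat_pow_closed)
    finally show ?thesis .
  qed
  have H_eq: "H = f ` ({..<p} \<times> {..<p})"
  proof
    show "H \<subseteq> f ` ({..<p} \<times> {..<p})"
    proof
      fix x assume "x \<in> H"
      then obtain i j where "x = f (i, j)" by (auto simp: H_def)
      hence "x = f (i mod p, j mod p)" using red[OF w(1) wp, of i] red[OF c(1,2), of j] by (simp add: f_def)
      thus "x \<in> f ` ({..<p} \<times> {..<p})" using p0 by (intro image_eqI) auto
    qed
  qed (auto simp: H_def)
  have comm1: "w [^] i \<otimes> c = c \<otimes> w [^] i" for i :: nat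
    by (rule group_commutes_pow[OF comm w(1) c(1)])
  have commij: "c [^] j \<otimes> w [^] i = w [^] i \<otimes> c [^] j" for i j :: nat
    by (rule group_commutes_pow[OF comm1[symmetric] c(1) nat_pow_closed[OF w(1)]])
  have fmult: "f (i, j) \<otimes> f (i', j') = f (i + i', j + j')" for i j i' j'
  proof -
    have "f (i, j) \<otimes> f (i', j') = w [^] i \<otimes> (c [^] j \<otimes> w [^] i') \<otimes> c [^] j'"
      using w(1) c(1) by (simp add: f_def m_assoc)
    also have "\<dots> = w [^] i \<otimes> w [^] i' \<otimes> (c [^] j \<otimes> c [^] j')"
      using w(1) c(1) by (simp add: commij m_assoc)
    finally show ?thesis using w(1) c(1) by (simp add: f_def nat_pow_mult)
  qed
  have fpow: "f (i, j) [^] m = f (i * m, j * m)" for i j and m :: nat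
    by (induction m) (simp_all add: fmult, simp_all add: f_def add.commute)
  have f0: "f (0, 0) = \<one>" by (simp add: f_def)
  have fp: "f (i * p, j * p) = \<one>" for i j
    using red[OF w(1) wp, of "i * p"] red[OF c(1,2), of "j * p"] by (simp add: f_def)
  have Hsub: "H \<subseteq> carrier G" using w(1) c(1) by (auto simp: H_def f_def)
  have sub: "subgroup H G"
  proof (rule subgroupI[OF Hsub])
    show "H \<noteq> {}" by (auto simp: H_def)
    fix x assume x: "x \<in> H"
    then obtain i j where ij: "x = f (i, j)" by (auto simp: H_def)
    have "x [^] (p - 1) \<otimes> x = x [^] p"
      using nat_pow_Suc[of x "p - 1"] p0 by simp
    also have "\<dots> = \<one>" by (simp add: ij fpow fp)
    finally have "inv x = x [^] (p - 1)" using x Hsub by (intro inv_equality) auto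
    thus "inv x \<in> H" by (simp add: ij fpow H_def)
    fix y assume "y \<in> H"
    then obtain i' j' where "y = f (i', j')" by (auto simp: H_def)
    thus "x \<otimes> y \<in> H" by (simp add: ij fmult H_def)
  qed
  have "inj_on f ({..<p} \<times> {..<p})"
  proof (rule inj_onI, clarsimp)
    have gen: "subgroup (generate G {w}) G" using w(1) by (intro generate_is_subgroup) simp
    have wgen: "w [^] i \<in> generate G {w}" for i :: nat
      by (rule subgroup_nat_pow_closed[OF gen]) (auto intro: generate.incl)
    have no: False if "j < j'" "j' < p" "f (i, j) = f (i', j')" for i j i' j'
    proof -
      have "w [^] i \<otimes> c [^] j = w [^] i' \<otimes> c [^] (j' - j) \<otimes> c [^] j"
        using that w(1) c(1) by (simp add: f_def m_assoc nat_pow_mult)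
      hence "w [^] i = w [^] i' \<otimes> c [^] (j' - j)" using w(1) c(1) by simp
      hence "c [^] (j' - j) = inv (w [^] i') \<otimes> w [^] i" using w(1) c(1) by simp
      also have "\<dots> \<in> generate G {w}"
        by (intro subgroup.m_closed[OF gen] subgroup.m_inv_closed[OF gen] wgen)
      finally have "c [^] (j' - j) \<in> generate G {w}" .
      moreover have "\<not> p dvd j' - j" using that by (auto dest: dvd_imp_le)
      hence "Rings.coprime (j' - j) p" using prime_imp_coprime[OF p] coprime_commute by blast
      ultimately show False
        using nat_pow_coprime_mem_subgroup[OF gen c(1,2), of "j' - j"] c(3) that(1) by simp
    qed
    fix i j i' j' assume *: "i < p" "j < p" "i' < p" "j' < p" "f (i, j) = f (i', j')"
    have "j = j'" using no[of j j' i i'] no[of j' j i' i] * by (metis linorder_neqE_nat)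
    moreover from this have "w [^] i = w [^] i'" using * w(1) c(1) by (simp add: f_def)
    hence "i = i'" using ord_inj[OF w(1)] * by (auto simp: w(2) dest!: inj_onD)
    ultimately show "i = i' \<and> j = j'" by simp
  qed
  hence card: "card H = p\<^sup>2" by (simp add: H_eq card_image power2_eq_square)
  interpret H: group "G\<lparr>carrier := H\<rparr>" by (rule subgroup_imp_group[OF sub])
  have "comm_group (G\<lparr>carrier := H\<rparr>)"
    by (rule H.group_comm_groupI) (auto simp: H_def fmult add.commute)
  moreover have "\<not> cyclic_group (G\<lparr>carrier := H\<rparr>)"
  proof
    assume "cyclic_group (G\<lparr>carrier := H\<rparr>)"
    moreover have "finite H" using finite_subset[OF Hsub fin] .
    ultimately obtain x where x: "x \<in> H" "H.ord x = p\<^sup>2"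
      using H.cyclic_group_iff_ord_eq_order card by (auto simp: Coset.order_def)
    have "x [^] p = \<one>" using x(1) by (auto simp: H_def fpow fp)
    hence "ord x dvd p" using x(1) Hsub pow_eq_id by blast
    hence "p\<^sup>2 dvd p" using subgroup_ord_eq[OF sub x(1)] x(2) by simp
    thus False using p0 by (auto simp: power2_eq_square dest!: dvd_imp_le)
  qed
  ultimately show ?thesis using sub card unfolding noncyclic_abelian_subgroup_def by blast
qed

text \<open>Modulo \<open>p\<^sup>2\<close>, the sum is \<open>p + p t (0 + 1 + \<dots> + (p - 1))\<close>, and the second summand is divisible by \<open>p\<^sup>2\<close> since \<open>p\<close>
  is odd.\<close>

lemma sum_powers_prime_factor:
  fixes p k :: nat
  assumes p: "odd p" and k: "k = 1 + p * t"
  obtains s where "(\<Sum>r<p. k ^ r) = p * s" "Rings.coprime s p"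
proof -
  have "\<exists>q. k ^ r = 1 + r * p * t + p\<^sup>2 * q" for r
  proof (induction r)
    case (Suc r)
    then obtain q where q: "k ^ r = 1 + r * p * t + p\<^sup>2 * q" by blast
    have "k ^ Suc r = k * (1 + r * p * t + p\<^sup>2 * q)" by (simp only: power_Suc q)
    also have "\<dots> = (1 + p * t) * (1 + r * p * t + p\<^sup>2 * q)" by (simp only: k)
    also have "\<dots> = 1 + Suc r * p * t + p\<^sup>2 * (q + r * t * t + p * t * q)"
      by (simp add: algebra_simps power2_eq_square)
    finally have "k ^ Suc r = \<dots>" .
    thus ?case by blast
  qed simp
  then obtain q where q: "\<And>r. k ^ r = 1 + r * p * t + p\<^sup>2 * q r" by metis
  obtain h where h: "p = 2 * h + 1" using p by (elim oddE)
  have "2 * (\<Sum>r<n. r) = n * (n - 1)" for n :: nat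
  proof (induction n)
    case (Suc n)
    thus ?case by (cases n) (simp_all add: algebra_simps)
  qed simp
  from this[of p] have sum: "(\<Sum>r<p. r) = p * h" by (simp add: h)
  have "(\<Sum>r<p. k ^ r) = p + p * t * (\<Sum>r<p. r) + p\<^sup>2 * (\<Sum>r<p. q r)"
    unfolding q by (simp add: sum_Suc sum.distrib sum_distrib_left sum_distrib_right mult_ac)
  also have "\<dots> = p * (1 + p * (t * h + (\<Sum>r<p. q r)))"
    unfolding sum by (simp add: algebra_simps power2_eq_square)
  finally have "(\<Sum>r<p. k ^ r) = p * (1 + p * (t * h + (\<Sum>r<p. q r)))" .
  moreover have "Rings.coprime (1 + p * (t * h + (\<Sum>r<p. q r))) p"
    by (rule coprimeI) (metis dvd_add_left_iff dvd_mult2)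
  ultimately show thesis using that by blast
qed

text \<open>An element \<open>b\<close> outside the subgroup \<open>\<langle>a\<rangle>\<close> of index \<open>p\<close> normalizes it, say \<open>a b = b a\<^sup>k\<close>.  As \<open>b\<^sup>p\<close> lies
  in \<open>\<langle>a\<rangle>\<close> and commutes with \<open>a\<close>, one has \<open>k \<equiv> 1\<close> modulo \<open>p\<close>.  The \<open>p\<close>-th power of \<open>b a\<^sup>i\<close> is \<open>b\<^sup>p a\<^sup>i\<^sup>S\<close>, where
  \<open>S = 1 + k + \<dots> + k ^ (p - 1)\<close> is divisible by \<open>p\<close> exactly once.  Since \<open>b\<close> does not generate the whole group, \<open>b\<^sup>p\<close> is
  a power of \<open>a\<^sup>p\<close>, so that \<open>i\<close> can be chosen with \<open>(b a\<^sup>i)\<^sup>p = 1\<close>.  This element commutes with the powers of \<open>a\<close> of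
  order \<open>p\<close>.\<close>

lemma (in group) p_group_cyclic_maximal_subgroup:
  fixes p n :: nat
  assumes fin: "finite (carrier G)" and p: "Factorial_Ring.prime p" "odd p" and n: "n > 0"
    and ord: "Coset.order G = p ^ Suc n" and a: "a \<in> carrier G" "ord a = p ^ n"
    and noncyclic: "\<And>x. x \<in> carrier G \<Longrightarrow> ord x \<noteq> p ^ Suc n"
  shows "\<exists>H. noncyclic_abelian_subgroup H G \<and> card H = p\<^sup>2"
proof -
  have p0: "p > 0" "p > 1" using p prime_gt_0_nat prime_gt_1_nat by blast+
  define M where "M = generate G {a}"
  have sub: "subgroup M G" unfolding M_def using a(1) by (intro generate_is_subgroup) simp
  have M_eq: "M = {a [^] k |k::nat. True}"
    unfolding M_def using generate_pow_on_finite_carrier[OF fin a(1)] by simp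
  have M_pow: "x \<in> M \<Longrightarrow> \<exists>k::nat. x = a [^] k" for x unfolding M_eq by blast
  have a_M: "a [^] k \<in> M" for k :: nat unfolding M_eq by blast
  have cardM: "card M = p ^ n" unfolding M_def using generate_pow_card[OF a(1)] a(2) by simp
  have Msub: "M \<subseteq> carrier G" by (rule subgroup.subset[OF sub])
  have finM: "finite M" by (rule finite_subset[OF Msub fin])
  have pown: "x [^] (p ^ Suc n) = \<one>" if "x \<in> carrier G" for x
    using pow_order_eq_1[OF that] ord by simp
  have "p ^ n < p ^ Suc n" using p0 by simp
  hence "M \<noteq> carrier G" using cardM ord by (auto simp: Coset.order_def)
  then obtain b where b: "b \<in> carrier G" "b \<notin> M" using Msub by auto
  have coprime: "Rings.coprime d (p ^ m)" if "0 < d" "d < p" for d m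
  proof -
    have "\<not> p dvd d" using that by (auto dest: dvd_imp_le)
    hence "Rings.coprime p d" using prime_imp_coprime[OF p(1)] by blast
    thus ?thesis by (simp add: coprime_commute)
  qed
  have conj_sub: "subgroup {x \<in> carrier G. inv b \<otimes> x \<otimes> b \<in> M} G"
  proof (rule subgroupI)
    show "{x \<in> carrier G. inv b \<otimes> x \<otimes> b \<in> M} \<noteq> {}"
      using b subgroup.one_closed[OF sub] by (auto intro!: exI[of _ \<one>])
  next
    fix x assume x: "x \<in> {x \<in> carrier G. inv b \<otimes> x \<otimes> b \<in> M}"
    have "inv (inv b \<otimes> x \<otimes> b) = inv b \<otimes> inv x \<otimes> b"
      using x b by (simp add: inv_mult_group m_assoc)
    thus "inv x \<in> {x \<in> carrier G. inv b \<otimes> x \<otimes> b \<in> M}"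
      using x subgroup.m_inv_closed[OF sub, of "inv b \<otimes> x \<otimes> b"] by simp
  next
    fix x y assume x: "x \<in> {x \<in> carrier G. inv b \<otimes> x \<otimes> b \<in> M}"
      and y: "y \<in> {x \<in> carrier G. inv b \<otimes> x \<otimes> b \<in> M}"
    have "inv b \<otimes> x \<otimes> b \<otimes> (inv b \<otimes> y \<otimes> b) = inv b \<otimes> (x \<otimes> y) \<otimes> b"
      using x y b by (simp add: m_assoc)
    thus "x \<otimes> y \<in> {x \<in> carrier G. inv b \<otimes> x \<otimes> b \<in> M}"
      using x y subgroup.m_closed[OF sub, of "inv b \<otimes> x \<otimes> b" "inv b \<otimes> y \<otimes> b"] by simp
  qed auto
  \<comment> \<open>Otherwise \<open>M\<close> and the sets \<open>a ^ i b M\<close>, \<open>i < p\<close>, would be \<open>p + 1\<close> different cosets.\<close>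
  have "\<exists>d. 0 < d \<and> d < p \<and> inv b \<otimes> a [^] d \<otimes> b \<in> M"
  proof (rule ccontr)
    assume no: "\<not> ?thesis"
    let ?f = "\<lambda>(i, m). a [^] (i::nat) \<otimes> b \<otimes> m"
    have neq: False if "i < j" "j < p" "m \<in> M" "m' \<in> M" "a [^] i \<otimes> b \<otimes> m = a [^] j \<otimes> b \<otimes> m'" for i j m m'
    proof -
      have mc: "m \<in> carrier G" "m' \<in> carrier G" using that Msub by auto
      have "a [^] j = a [^] i \<otimes> a [^] (j - i)" using that a(1) by (simp add: nat_pow_mult)
      hence "a [^] i \<otimes> (b \<otimes> m) = a [^] i \<otimes> (a [^] (j - i) \<otimes> b \<otimes> m')"
        using that(5) a(1) b(1) mc by (simp add: m_assoc)
      hence "b \<otimes> m = a [^] (j - i) \<otimes> b \<otimes> m'" using a(1) b(1) mc by simp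
      hence "m = inv b \<otimes> a [^] (j - i) \<otimes> b \<otimes> m'"
        using a(1) b(1) mc by (metis inv_mult_cancel_left(1) m_assoc m_closed inv_closed nat_pow_closed)
      hence "m \<otimes> inv m' = inv b \<otimes> a [^] (j - i) \<otimes> b" using a(1) b(1) mc by (simp add: m_assoc)
      moreover have "m \<otimes> inv m' \<in> M" using that sub by (simp add: subgroup.m_closed subgroup.m_inv_closed)
      ultimately show False using no that(1,2) by (metis less_imp_diff_less zero_less_diff)
    qed
    have "inj_on ?f ({..<p} \<times> M)"
    proof (rule inj_onI, clarsimp)
      fix i j m m' assume *: "i < p" "j < p" "m \<in> M" "m' \<in> M" "a [^] i \<otimes> b \<otimes> m = a [^] j \<otimes> b \<otimes> m'"
      have "i = j" using neq[of i j m m'] neq[of j i m' m] * by (metis linorder_neqE_nat)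
      moreover from this have "m = m'" using * a(1) b(1) Msub by (metis l_cancel m_closed nat_pow_closed subsetD)
      ultimately show "i = j \<and> m = m'" by simp
    qed
    hence "card (?f ` ({..<p} \<times> M)) = p ^ Suc n" by (simp add: card_image card_cartesian_product cardM)
    moreover have "?f ` ({..<p} \<times> M) \<subseteq> carrier G - M"
    proof safe
      fix i :: nat and m assume m: "m \<in> M"
      have mc: "m \<in> carrier G" using m Msub by auto
      show "a [^] i \<otimes> b \<otimes> m \<in> carrier G" using a(1) b(1) mc by simp
      assume in_M: "a [^] i \<otimes> b \<otimes> m \<in> M"
      have "b = inv (a [^] i) \<otimes> (a [^] i \<otimes> b \<otimes> m) \<otimes> inv m"
        using a(1) b(1) mc by (simp add: m_assoc)
      also have "\<dots> \<in> M"
        by (intro subgroup.m_closed[OF sub] subgroup.m_inv_closed[OF sub] in_M m a_M)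
      finally show False using b(2) by simp
    qed
    hence "card (?f ` ({..<p} \<times> M)) \<le> card (carrier G - M)" using fin by (intro card_mono) auto
    moreover have "card (carrier G - M) < p ^ Suc n"
      using card_Diff_subset[OF finM Msub] ord cardM p0 by (simp add: Coset.order_def)
    ultimately show False by simp
  qed
  then obtain d where d: "0 < d" "d < p" "inv b \<otimes> a [^] d \<otimes> b \<in> M" by blast
  have "a \<in> {x \<in> carrier G. inv b \<otimes> x \<otimes> b \<in> M}"
    by (rule nat_pow_coprime_mem_subgroup[OF conj_sub a(1) _ _ coprime[OF d(1,2), of n] d(1)])
      (use a d in \<open>auto simp: pow_eq_id\<close>)
  then obtain k where k: "inv b \<otimes> a \<otimes> b = a [^] (k::nat)" using M_pow by blast
  have ab1: "a \<otimes> b = b \<otimes> a [^] k" using k a(1) b(1) by (metis inv_mult_cancel_left(2) m_assoc m_closed inv_closed)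
  have ab: "a [^] x \<otimes> b = b \<otimes> a [^] (k * x)" for x :: nat
  proof (induction x)
    case (Suc x)
    have "a [^] Suc x \<otimes> b = a [^] x \<otimes> (a \<otimes> b)" using a(1) b(1) by (simp add: m_assoc)
    also have "\<dots> = (a [^] x \<otimes> b) \<otimes> a [^] k" using a(1) b(1) by (simp add: ab1 m_assoc)
    also have "\<dots> = b \<otimes> a [^] (k * Suc x)" using a(1) b(1) by (simp add: Suc m_assoc nat_pow_mult add.commute)
    finally show ?case .
  qed (use b in simp)
  have abm: "a \<otimes> b [^] m = b [^] m \<otimes> a [^] (k ^ m)" for m :: nat
  proof (induction m)
    case (Suc m)
    have "a \<otimes> b [^] Suc m = (a \<otimes> b [^] m) \<otimes> b" using a(1) b(1) by (simp add: m_assoc)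
    also have "\<dots> = b [^] m \<otimes> (a [^] (k ^ m) \<otimes> b)" using a(1) b(1) by (simp add: Suc m_assoc)
    also have "\<dots> = b [^] Suc m \<otimes> a [^] (k ^ Suc m)" using a(1) b(1) by (simp add: ab m_assoc)
    finally show ?case .
  qed (use a in simp)
  \<comment> \<open>Two of the \<open>p + 1\<close> cosets \<open>M\<close>, \<open>b M\<close>, \<open>\<dots>\<close>, \<open>b\<^sup>p M\<close> coincide.\<close>
  have bp: "b [^] p \<in> M"
  proof -
    let ?g = "\<lambda>(i, m). b [^] (i::nat) \<otimes> m"
    have "\<not> inj_on ?g ({..p} \<times> M)"
    proof
      assume "inj_on ?g ({..p} \<times> M)"
      hence "card (?g ` ({..p} \<times> M)) = Suc p * p ^ n" by (simp add: card_image card_cartesian_product cardM)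
      moreover have "card (?g ` ({..p} \<times> M)) \<le> card (carrier G)"
        using b(1) Msub by (intro card_mono[OF fin]) auto
      ultimately show False using ord p0 by (simp add: Coset.order_def)
    qed
    moreover have main: "b [^] p \<in> M" if "i < j" "j \<le> p" "m \<in> M" "m' \<in> M" "b [^] i \<otimes> m = b [^] j \<otimes> m'" for i j m m'
    proof -
      have mc: "m \<in> carrier G" "m' \<in> carrier G" using that Msub by auto
      have "b [^] j = b [^] i \<otimes> b [^] (j - i)" using that b(1) by (simp add: nat_pow_mult)
      hence "b [^] i \<otimes> m = b [^] i \<otimes> (b [^] (j - i) \<otimes> m')" using that(5) b(1) mc by (simp add: m_assoc)
      hence "m = b [^] (j - i) \<otimes> m'" using b(1) mc by simp
      hence "m \<otimes> inv m' = b [^] (j - i)" using b(1) mc by (simp add: m_assoc)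
      moreover have "m \<otimes> inv m' \<in> M" using that sub by (simp add: subgroup.m_closed subgroup.m_inv_closed)
      ultimately have in_M: "b [^] (j - i) \<in> M" by simp
      have "j - i = p"
      proof (rule ccontr)
        assume "j - i \<noteq> p"
        hence "j - i < p" "0 < j - i" using that by auto
        from nat_pow_coprime_mem_subgroup[OF sub b(1) pown[OF b(1)] in_M coprime[OF this(2,1)] this(2)]
        show False using b(2) by simp
      qed
      thus ?thesis using in_M by simp
    qed
    ultimately obtain i j m m' where *: "i \<le> p" "j \<le> p" "m \<in> M" "m' \<in> M"
      "b [^] i \<otimes> m = b [^] j \<otimes> m'" "(i, m) \<noteq> (j, m')"
      unfolding inj_on_def by auto
    have "i \<noteq> j" using * b(1) Msub by (metis l_cancel nat_pow_closed subsetD)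
    thus ?thesis using main[of i j m m'] main[of j i m' m] * by (metis linorder_neqE_nat)
  qed
  then obtain j where j: "b [^] p = a [^] (j::nat)" using M_pow by blast
  have "k \<noteq> 0"
  proof
    assume "k = 0"
    hence "a \<otimes> b = \<one> \<otimes> b" using ab1 b(1) by simp
    hence "a = \<one>" using a(1) b(1) by (simp del: l_one)
    moreover have "p ^ n > 1" by (rule one_less_power[OF p0(2) n])
    ultimately show False using a(2) by simp
  qed
  have "p ^ n dvd k ^ p - 1"
  proof -
    have "b [^] p \<otimes> a [^] (k ^ p) = b [^] p \<otimes> a"
      using abm[of p] a(1) by (simp add: j nat_pow_Suc2[symmetric])
    hence "a [^] (k ^ p) = a" using a(1) b(1) by simp
    moreover have "k ^ p = Suc (k ^ p - 1)" using \<open>k \<noteq> 0\<close> by simp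
    ultimately have "a [^] (k ^ p - 1) \<otimes> a = \<one> \<otimes> a" using a(1) by (metis l_one nat_pow_Suc)
    hence "a [^] (k ^ p - 1) = \<one>" using a(1) by (simp del: l_one)
    thus ?thesis using a by (simp add: pow_eq_id)
  qed
  hence pk: "p dvd k ^ p - 1" using n by (meson dvd_power dvd_trans)
  have "\<exists>t. k = 1 + p * t"
  proof -
    have "\<not> p dvd k"
    proof
      assume "p dvd k"
      hence "p dvd k ^ p" using p0 by (simp add: dvd_power_iff_le prime_dvd_power_iff dvd_trans[OF _ dvd_power])
      hence "p dvd 1" using pk \<open>k \<noteq> 0\<close> by (metis dvd_diffD1 less_one not_le power_eq_0_iff)
      thus False using p0 by simp
    qed
    from fermat_theorem[OF p(1) this] have "[k * k ^ (p - 1) = k * 1] (mod p)" by (rule cong_scalar_left)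
    hence "[k ^ p = k] (mod p)" using p0 by (simp flip: power_Suc)
    moreover have "[k ^ p = 1] (mod p)"
    proof -
      obtain x where "k ^ p - 1 = p * x" using pk by (elim dvdE)
      moreover have "k ^ p > 0" using \<open>k \<noteq> 0\<close> by simp
      ultimately have "k ^ p = 1 + p * x" by linarith
      thus ?thesis unfolding cong_def by (simp only: mod_mult_self2)
    qed
    ultimately have "[k = 1] (mod p)" by (meson cong_sym cong_trans)
    hence "p dvd k - 1" by (rule cong_to_1_nat)
    then obtain t where "k - 1 = p * t" by (elim dvdE)
    thus ?thesis using \<open>k \<noteq> 0\<close> by (intro exI[of _ t]) simp
  qed
  then obtain t where t: "k = 1 + p * t" by blast
  obtain s where s: "(\<Sum>r<p. k ^ r) = p * s" "Rings.coprime s p"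
    using sum_powers_prime_factor[OF p(2) t] by metis
  have "p dvd j"
  proof (rule ccontr)
    assume "\<not> p dvd j"
    have "\<not> ord b dvd p ^ n"
    proof
      assume "ord b dvd p ^ n"
      hence "b [^] (p ^ n) = \<one>" using b(1) pow_eq_id by blast
      moreover have "p ^ n = p * p ^ (n - 1)" using n by (simp flip: power_Suc)
      ultimately have "(b [^] p) [^] (p ^ (n - 1)) = \<one>" using b(1) by (simp add: nat_pow_pow)
      hence "a [^] (j * p ^ (n - 1)) = \<one>" using a(1) by (simp add: j nat_pow_pow)
      hence "p * p ^ (n - 1) dvd j * p ^ (n - 1)"
        using a \<open>p ^ n = p * p ^ (n - 1)\<close> by (simp add: pow_eq_id)
      thus False using \<open>\<not> p dvd j\<close> p0 by simp
    qed
    moreover have "ord b dvd p ^ Suc n" using ord_dvd_group_order[OF b(1)] ord by simp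
    then obtain i where "i \<le> Suc n" "ord b = p ^ i" using divides_primepow_nat[OF p(1)] by blast
    ultimately have "ord b = p ^ Suc n" by (metis le_SucE le_imp_power_dvd)
    thus False using noncyclic[OF b(1)] by simp
  qed
  then obtain j' where j': "j = p * j'" by (elim dvdE)
  have "Rings.coprime s (p ^ n)" using s(2) by simp
  moreover have "s \<noteq> 0" using s(2) p0 by (metis coprime_0_left_iff nat_dvd_1_iff_1 less_numeral_extra(4))
  ultimately obtain u v where uv: "s * u = p ^ n * v + 1"
    using bezout_nat[of s "p ^ n"] by (auto simp: coprime_iff_gcd_eq_1)
  \<comment> \<open>Modulo \<open>p ^ n\<close>, \<open>u\<close> is inverse to \<open>s\<close> and \<open>p ^ n - 1\<close> stands for \<open>-1\<close>, so that \<open>i s \<equiv> - j'\<close>.\<close>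
  define i where "i = u * j' * (p ^ n - 1)"
  have dvd: "p ^ n dvd j' + i * s"
  proof -
    have "j' + i * s = j' * (1 + (p ^ n - 1) * (s * u))" by (simp add: i_def algebra_simps)
    also have "1 + (p ^ n - 1) * (s * u) = p ^ n * ((p ^ n - 1) * v + 1)"
    proof -
      have "1 + (p ^ n - 1) * (s * u) = (p ^ n - 1) * (p ^ n * v) + (1 + (p ^ n - 1))"
        unfolding uv by (simp add: algebra_simps)
      also have "1 + (p ^ n - 1) = p ^ n" using p0 by simp
      finally show ?thesis by (simp add: algebra_simps)
    qed
    finally show ?thesis by simp
  qed
  define c where "c = b \<otimes> a [^] i"
  have c: "c \<in> carrier G" using a(1) b(1) by (simp add: c_def)
  have cpow: "c [^] m = b [^] m \<otimes> a [^] (i * (\<Sum>r<m. k ^ r))" for m :: nat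
  proof (induction m)
    case (Suc m)
    define y where "y = i * (\<Sum>r<m. k ^ r)"
    have "c [^] Suc m = b [^] m \<otimes> a [^] y \<otimes> c"
      by (simp only: nat_pow_Suc Suc y_def)
    also have "\<dots> = b [^] m \<otimes> (a [^] y \<otimes> b) \<otimes> a [^] i"
      using a(1) b(1) by (simp add: c_def m_assoc)
    also have "\<dots> = b [^] m \<otimes> b \<otimes> (a [^] (k * y) \<otimes> a [^] i)"
      unfolding ab using a(1) b(1) by (simp add: m_assoc)
    also have "\<dots> = b [^] Suc m \<otimes> a [^] (k * y + i)" using a(1) b(1) by (simp add: nat_pow_mult)
    also have "k * y + i = i * (\<Sum>r<Suc m. k ^ r)"
      by (subst sum.lessThan_Suc_shift) (simp add: y_def sum_distrib_left algebra_simps)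
    finally show ?case .
  qed simp
  have "c [^] p = a [^] (p * (j' + i * s))"
    using a(1) by (simp add: cpow s j j' nat_pow_mult algebra_simps)
  also have "\<dots> = \<one>" using a dvd by (simp add: pow_eq_id)
  finally have cp: "c [^] p = \<one>" .
  have cM: "c \<notin> M"
  proof
    assume "c \<in> M"
    hence "c \<otimes> inv (a [^] i) \<in> M" by (intro subgroup.m_closed[OF sub] subgroup.m_inv_closed[OF sub] a_M)
    thus False using a(1) b by (simp add: c_def m_assoc)
  qed
  define w where "w = a [^] (p ^ (n - 1))"
  have w: "w \<in> carrier G" using a(1) by (simp add: w_def)
  have ppow: "p ^ n = p ^ (n - 1) * p" using n by (simp flip: power_Suc2)
  have ordw: "ord w = p"
    unfolding w_def using ord_pow[OF a(1), of "p ^ (n - 1)"] a(2) p0 ppow by simp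
  have "w \<otimes> b = b \<otimes> w"
  proof -
    have "k * p ^ (n - 1) = p ^ (n - 1) + p ^ n * t" by (simp add: t ppow algebra_simps)
    hence "w \<otimes> b = b \<otimes> (a [^] (p ^ (n - 1)) \<otimes> a [^] (p ^ n * t))"
      unfolding w_def ab using a(1) by (simp add: nat_pow_mult)
    also have "a [^] (p ^ n * t) = \<one>" using a by (simp add: pow_eq_id)
    finally show ?thesis using a(1) by (simp add: w_def)
  qed
  moreover have "w \<otimes> a [^] i = a [^] i \<otimes> w"
    unfolding w_def using a(1) by (simp add: nat_pow_mult add.commute)
  ultimately have wc: "w \<otimes> c = c \<otimes> w"
    unfolding c_def using a(1) b(1) w by (metis m_assoc nat_pow_closed)
  have "generate G {w} \<subseteq> M"
    by (rule generate_subgroup_incl[OF _ sub]) (simp add: w_def a_M)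
  hence "c \<notin> generate G {w}" using cM by auto
  from commuting_elements_imp_noncyclic_abelian_subgroup[OF fin p(1) w ordw c cp this wc]
  show ?thesis .
qed

lemma noncyclic_abelian_subgroup_mono:
  fixes G (structure)
  assumes "group G" "subgroup M G" "noncyclic_abelian_subgroup H (G\<lparr>carrier := M\<rparr>)"
  shows "noncyclic_abelian_subgroup H G"
  using assms group.incl_subgroup[OF assms(1,2)] by (simp add: noncyclic_abelian_subgroup_def)

lemma p_group_cyclic_if_no_noncyclic_abelian_subgroup:
  fixes G :: "('a, 'b) monoid_scheme" and p n :: nat
  assumes p: "Factorial_Ring.prime p" "odd p"
    and "group G" "Coset.order G = p ^ n"
    and "\<nexists>H. noncyclic_abelian_subgroup H G \<and> card H = p\<^sup>2"
  shows "cyclic_group G"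
  using assms(3-5)
proof (induction n arbitrary: G)
  case 0
  interpret group G by fact
  have "finite (carrier G)" using 0 order_gt_0_iff_finite by simp
  moreover have "ord \<one>\<^bsub>G\<^esub> = Coset.order G" using 0 by simp
  ultimately show ?case using cyclic_group_iff_ord_eq_order one_closed by blast
next
  case (Suc n)
  interpret group G by fact
  have p0: "p > 0" "p > 1" using p prime_gt_0_nat prime_gt_1_nat by blast+
  have fin: "finite (carrier G)" using Suc.prems(2) p0 order_gt_0_iff_finite by simp
  show ?case
  proof (cases "n = 0")
    case True
    hence "card (carrier G) = p" using Suc.prems(2) by (simp add: Coset.order_def)
    hence "carrier G \<noteq> {\<one>\<^bsub>G\<^esub>}" using p0 by auto
    then obtain b where b: "b \<in> carrier G" "b \<noteq> \<one>\<^bsub>G\<^esub>" using one_closed by auto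
    have dvd: "ord b dvd p" using ord_dvd_group_order[OF b(1)] Suc.prems(2) True by simp
    have "ord b \<noteq> 1" using b ord_eq_1 by simp
    hence "ord b = p" using p(1) dvd unfolding prime_nat_iff by blast
    hence "ord b = Coset.order G" using Suc.prems(2) True by simp
    thus ?thesis using cyclic_group_iff_ord_eq_order[OF fin] b(1) by blast
  next
    case False
    obtain M where M: "subgroup M G" "card M = p ^ n"
      using sylow_thm[OF p(1) group_axioms _ fin, of n p] Suc.prems(2) by auto
    have "cyclic_group (G\<lparr>carrier := M\<rparr>)"
    proof (rule Suc.IH)
      show "\<nexists>H. noncyclic_abelian_subgroup H (G\<lparr>carrier := M\<rparr>) \<and> card H = p\<^sup>2"
        using Suc.prems(3) noncyclic_abelian_subgroup_mono[OF group_axioms M(1)] by blast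
    qed (use M subgroup_imp_group in \<open>auto simp: Coset.order_def\<close>)
    moreover have "finite M" using M(2) p0 by (auto intro: card_ge_0_finite)
    ultimately obtain a where a: "a \<in> M" "ord a = p ^ n"
      using group.cyclic_group_iff_ord_eq_order[OF subgroup_imp_group[OF M(1)]] M subgroup_ord_eq[OF M(1)]
      by (auto simp: Coset.order_def)
    have "a \<in> carrier G" by (rule subgroup.mem_carrier[OF M(1) a(1)])
    with p_group_cyclic_maximal_subgroup[OF fin p _ Suc.prems(2) _ a(2)] False Suc.prems(3)
    have "\<exists>x\<in>carrier G. ord x = p ^ Suc n" by blast
    thus ?thesis using cyclic_group_iff_ord_eq_order[OF fin] Suc.prems(2) by simp
  qed
qed

section \<open>Noncyclic abelian subgroups of order p squared\<close>

theorem theoremA: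
  fixes G :: "('a, 'b) monoid_scheme" and p :: nat
  assumes "group G" and "finite (carrier G)"
    and "Factorial_Ring.prime p" and "odd p"
    and "\<exists>H. noncyclic_abelian_subgroup H (normalized_units G) \<and> card H = p\<^sup>2"
  shows "(\<exists>H. noncyclic_abelian_subgroup H G \<and> card H = p\<^sup>2) \<and>
    (\<forall>P. sylow_subgroup p P G \<longrightarrow> \<not> cyclic_group (G\<lparr>carrier := P\<rparr>))"
proof -
  interpret group G by fact
  define n where "n = multiplicity p (Coset.order G)"
  have p0: "p > 0" using assms(3) prime_gt_0_nat by blast
  have order0: "Coset.order G \<noteq> 0" using order_gt_0_iff_finite assms(2) by simp
  have not_dvd: "\<not> p ^ Suc n dvd Coset.order G"
    using power_dvd_iff_le_multiplicity[OF order0, of p "Suc n"] assms(3) not_prime_unit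
    by (auto simp: n_def)
  have noncyclic: "\<not> cyclic_group (G\<lparr>carrier := P\<rparr>)" if P: "subgroup P G" "card P = p ^ n" for P
  proof
    assume "cyclic_group (G\<lparr>carrier := P\<rparr>)"
    moreover have "finite P" using P(2) p0 by (auto intro: card_ge_0_finite)
    ultimately obtain z where z: "z \<in> P" "ord z = p ^ n"
      using group.cyclic_group_iff_ord_eq_order[OF subgroup_imp_group[OF P(1)]] P subgroup_ord_eq[OF P(1)]
      by (auto simp: Coset.order_def)
    have "z \<in> carrier G" by (rule subgroup.mem_carrier[OF P(1) z(1)])
    then show False
      using noncyclic_units_imp_prime_dvd_index[OF assms(2,3) _ z(2)] assms(5) not_dvd by blast
  qed
  have "\<exists>H. noncyclic_abelian_subgroup H G \<and> card H = p\<^sup>2"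
  proof (rule ccontr)
    assume no: "\<not> ?thesis"
    have "p ^ n dvd Coset.order G" by (simp add: n_def multiplicity_dvd)
    then obtain m where "Coset.order G = p ^ n * m" by (elim dvdE)
    then obtain P where P: "subgroup P G" "card P = p ^ n"
      using sylow_thm[OF assms(3) group_axioms _ assms(2)] by blast
    have "cyclic_group (G\<lparr>carrier := P\<rparr>)"
      by (rule p_group_cyclic_if_no_noncyclic_abelian_subgroup[OF assms(3,4), of _ n])
        (use P no subgroup_imp_group noncyclic_abelian_subgroup_mono[OF group_axioms P(1)]
         in \<open>auto simp: Coset.order_def\<close>)
    thus False using noncyclic[OF P] by simp
  qed
  moreover have "\<not> cyclic_group (G\<lparr>carrier := P\<rparr>)" if "sylow_subgroup p P G" for P
    using that noncyclic by (simp add: sylow_subgroup_def n_def)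
  ultimately show ?thesis by blast
qed

end
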